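(* Let $G$ be a finite group, let $D=G^{\mathfrak{N}}$ be the nilpotent residual of $G$, and let $\mathcal{L}=\mathcal{L}_S(G)$ be the lattice of all $S$-permutable subgroups of $G$. Then the lattice $\mathcal{L}$ is distributive if and only if the following conditions hold: (1) (i) every two members $A,B$ of $\mathcal{L}$ are permutable, i.e. $AB=BA$; (ii) the lattice $\mathcal{L}_n(G)$ of all normal subgroups of $G$ is distributive; (iii) $G/D$ is cyclic and $D$ is a meet-distributive element of $\mathcal{L}$. (2) In every factor group $\bar G=G/R$ (with $R$ a normal subgroup of $G$), for every prime $p$, any two $O^{p}(\bar G)$-isomorphic sections $\bar H/\bar K$ and $\bar L/\bar K$, where $\bar K,\bar H,\bar L\in\mathcal{L}_{pS}(\bar G)$, coincide (i.e. $\bar H=\bar L$).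
   Context: All groups are finite. A subgroup $A$ of $G$ is $S$-permutable in $G$ if $AP=PA$ for every Sylow subgroup $P$ of $G$. The set $\mathcal{L}_S(G)$ of all $S$-permutable subgroups of $G$, ordered by inclusion, is a lattice (a sublattice of the lattice of all subgroups of $G$). $G^{\mathfrak{N}}$, the nilpotent residual of $G$, is the intersection of all normal subgroups $N$ of $G$ with $G/N$ nilpotent. An element $a$ of a lattice $\mathcal{L}$ is meet-distributive if $a\wedge(b\vee c)=(a\wedge b)\vee(a\wedge c)$ for all $b,c\in\mathcal{L}$. $\mathcal{L}_{pS}(G)$ denotes the set of all $S$-permutable $p$-subgroups of $G$. $O^{p}(G)$ is the smallest normal subgroup $N$ of $G$ such that $G/N$ is a $p$-group. It is known that $O^p(G)$ normalizes every member of $\mathcal{L}_{pS}(G)$. A section $H/K$ with $K,H\in\mathcal{L}_{pS}(G)$ means $K\trianglelefteq H$, and $O^{p}(G)$ is a group of operators for $H/K$ via $(hK)^a=h^aK$ for $hK\in H/K$, $a\in O^p(G)$. Two such sections are $O^{p}(G)$-isomorphic if there is a group isomorphism between them commuting with the action of $O^p(G)$. *)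

theory Defs
  imports "HOL-Algebra.Algebra"
begin

definition sylow_subgroup :: "nat \<Rightarrow> ('a, 'b) monoid_scheme \<Rightarrow> 'a set \<Rightarrow> bool" where
  "sylow_subgroup p G P \<longleftrightarrow>
     Factorial_Ring.prime p \<and> subgroup P G \<and> card P = p ^ multiplicity p (order G)"

definition permutable_sets :: "('a, 'b) monoid_scheme \<Rightarrow> 'a set \<Rightarrow> 'a set \<Rightarrow> bool" where
  "permutable_sets G A B \<longleftrightarrow> A <#>\<^bsub>G\<^esub> B = B <#>\<^bsub>G\<^esub> A"

definition S_permutable :: "('a, 'b) monoid_scheme \<Rightarrow> 'a set \<Rightarrow> bool" where
  "S_permutable G A \<longleftrightarrow>
     subgroup A G \<and> (\<forall>p P. sylow_subgroup p G P \<longrightarrow> permutable_sets G A P)"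

definition S_permutable_lattice :: "('a, 'b) monoid_scheme \<Rightarrow> 'a set gorder" where
  "S_permutable_lattice G = \<lparr>carrier = {A. S_permutable G A}, eq = (=), le = (\<subseteq>)\<rparr>"

definition normal_lattice :: "('a, 'b) monoid_scheme \<Rightarrow> 'a set gorder" where
  "normal_lattice G = \<lparr>carrier = {N. N \<lhd> G}, eq = (=), le = (\<subseteq>)\<rparr>"

definition meet_distributive :: "('a, 'b) gorder_scheme \<Rightarrow> 'a \<Rightarrow> bool" where
  "meet_distributive L a \<longleftrightarrow> a \<in> carrier L \<and>
     (\<forall>b\<in>carrier L. \<forall>c\<in>carrier L.
        a \<sqinter>\<^bsub>L\<^esub> (b \<squnion>\<^bsub>L\<^esub> c) = (a \<sqinter>\<^bsub>L\<^esub> b) \<squnion>\<^bsub>L\<^esub> (a \<sqinter>\<^bsub>L\<^esub> c))"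

definition distributive_lattice :: "('a, 'b) gorder_scheme \<Rightarrow> bool" where
  "distributive_lattice L \<longleftrightarrow> lattice L \<and> (\<forall>a\<in>carrier L. meet_distributive L a)"

primrec lower_central :: "('a, 'b) monoid_scheme \<Rightarrow> nat \<Rightarrow> 'a set" where
  "lower_central G 0 = carrier G"
| "lower_central G (Suc n) = generate G
     {x \<otimes>\<^bsub>G\<^esub> y \<otimes>\<^bsub>G\<^esub> inv\<^bsub>G\<^esub> x \<otimes>\<^bsub>G\<^esub> inv\<^bsub>G\<^esub> y | x y. x \<in> lower_central G n \<and> y \<in> carrier G}"

definition nilpotent_group :: "('a, 'b) monoid_scheme \<Rightarrow> bool" where
  "nilpotent_group G \<longleftrightarrow> group G \<and> (\<exists>n. lower_central G n = {\<one>\<^bsub>G\<^esub>})"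

definition nilpotent_residual :: "('a, 'b) monoid_scheme \<Rightarrow> 'a set" where
  "nilpotent_residual G = \<Inter>{N. N \<lhd> G \<and> nilpotent_group (G Mod N)}"

definition p_group :: "nat \<Rightarrow> ('a, 'b) monoid_scheme \<Rightarrow> bool" where
  "p_group p G \<longleftrightarrow> group G \<and> (\<exists>n. order G = p ^ n)"

definition S_permutable_p_subgroups :: "nat \<Rightarrow> ('a, 'b) monoid_scheme \<Rightarrow> 'a set set" where
  "S_permutable_p_subgroups p G = {A. S_permutable G A \<and> p_group p (G\<lparr>carrier := A\<rparr>)}"

text \<open>Subgroups are ordered by inclusion, so the least element is the smallest normal subgroup
  with the required quotient.\<close>

definition p_residual :: "nat \<Rightarrow> ('a, 'b) monoid_scheme \<Rightarrow> 'a set" where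
  "p_residual p G = (LEAST N. N \<lhd> G \<and> p_group p (G Mod N))"

definition conjugate_by :: "('a, 'b) monoid_scheme \<Rightarrow> 'a \<Rightarrow> 'a \<Rightarrow> 'a" where
  "conjugate_by G h a = inv\<^bsub>G\<^esub> a \<otimes>\<^bsub>G\<^esub> h \<otimes>\<^bsub>G\<^esub> a"

text \<open>The isomorphism \<open>\<phi>\<close> commutes with the action \<open>(hK)\<^sup>a = h\<^sup>aK\<close>, expressed on coset
  representatives. Elements of \<open>Mod\<close> are right cosets, which agree with the left cosets here
  since \<open>K\<^sub>1\<close> and \<open>K\<^sub>2\<close> are normal in \<open>H\<close> and \<open>L\<close>.\<close>

definition operator_isomorphic_sections ::
  "('a, 'b) monoid_scheme \<Rightarrow> 'a set \<Rightarrow> 'a set \<Rightarrow> 'a set \<Rightarrow> 'a set \<Rightarrow> 'a set \<Rightarrow> bool" where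
  "operator_isomorphic_sections G \<Omega> H K\<^sub>1 L K\<^sub>2 \<longleftrightarrow>
     (\<exists>\<phi> \<in> iso (G\<lparr>carrier := H\<rparr> Mod K\<^sub>1) (G\<lparr>carrier := L\<rparr> Mod K\<^sub>2).
        \<forall>a\<in>\<Omega>. \<forall>h\<in>H. \<forall>l\<in>L. \<phi> (K\<^sub>1 #>\<^bsub>G\<^esub> h) = K\<^sub>2 #>\<^bsub>G\<^esub> l \<longrightarrow>
          \<phi> (K\<^sub>1 #>\<^bsub>G\<^esub> conjugate_by G h a) = K\<^sub>2 #>\<^bsub>G\<^esub> conjugate_by G l a)"

definition isomorphic_sections_coincide :: "nat \<Rightarrow> ('a, 'b) monoid_scheme \<Rightarrow> bool" where
  "isomorphic_sections_coincide p G \<longleftrightarrow>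
     (\<forall>K \<in> S_permutable_p_subgroups p G.
      \<forall>H \<in> S_permutable_p_subgroups p G.
      \<forall>L \<in> S_permutable_p_subgroups p G.
        K \<lhd> G\<lparr>carrier := H\<rparr> \<and> K \<lhd> G\<lparr>carrier := L\<rparr> \<and>
        operator_isomorphic_sections G (p_residual p G) H K L K \<longrightarrow> H = L)"

end

theory Submission
  imports Defs
begin

text \<open>
  If \<open>A\<close> is S-permutable and \<open>P\<close>, \<open>Q\<close> are Sylow subgroups for different primes \<open>p\<close>, \<open>q\<close>, then
  the indices of \<open>A\<close> in \<open>AP\<close> and \<open>AQ\<close> are coprime. Hence \<open>AP \<inter> AQ = A\<close>, and \<open>A\<close> contains every
  element of \<open>AP\<close> whose order is a power of a prime other than \<open>p\<close>. This one observation yields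
  that S-permutable subgroups are closed under intersection, that a proper one lies in a proper
  normal subgroup (Kegel), that a core-free one has its \<open>p\<close>-elements in \<open>O\<^sub>p(G)\<close> (Deskins), and
  that the S-permutable \<open>p\<close>-subgroups are the subgroups of \<open>O\<^sub>p(G)\<close> normalized by \<open>O\<^sup>p(G)\<close> (Schmid).

  Let the lattice be distributive. Maximal S-permutable subgroups of an S-permutable subgroup are
  normal in it, and induction on \<open>A\<close> gives \<open>AB = BA\<close>. In a minimal pair of distinct
  \<open>O\<^sup>p(G)\<close>-isomorphic sections \<open>H/K\<close> and \<open>L/K\<close>, both \<open>H\<close> and \<open>L\<close> have a unique maximal member above
  \<open>K\<close>; choosing maximal \<open>M \<supseteq> H\<close> and \<open>N \<supseteq> L\<close> in \<open>HL\<close>, the isomorphism induces one between \<open>HL/M\<close> and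
  \<open>HL/N\<close>, whose graph is a third complement that contradicts distributivity. All subgroups of the
  nilpotent group \<open>G/D\<close> are S-permutable, and a nilpotent group with distributive subgroup lattice
  is cyclic.

  Conversely, permutability makes the lattice modular, so if it is not distributive there is a
  diamond \<open>K < A, B, C < M\<close> all of whose inclusions are covers. Modulo the core of \<open>K\<close> the quotients
  \<open>A/K\<close> and \<open>B/K\<close> come from \<open>p\<close>-subgroups in \<open>O\<^sub>p\<close>, and \<open>C\<close> is the graph of an \<open>O\<^sup>p\<close>-isomorphism
  between them, so they coincide, which is absurd.
\<close>

section \<open>Products and conjugates of subgroups\<close>

text \<open>Two difficulties shape the argument. The join of two members is a generated subgroup,
  while counting and Dedekind's law speak about products; hence permutability comes first, and
  distributivity is carried afterwards in the product form \<open>Sp_distributive\<close>. Second,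
  an isomorphism of H/K onto L/K does not directly give a complement in HL/K, since H and L may meet
  above K. Passing to M and N repairs this: L and M, and likewise H and N, meet exactly in the
  unique maximal members, which correspond under the isomorphism. As M and N are normal in HL, they
  commute modulo their intersection, so the products of partners form a subgroup modulo it. Schmid's
  criterion makes the constructions cheap: an image under the isomorphism, or a graph, is a member
  as soon as it is a subgroup of O_p(G) stable under O^p(G). In the converse, A/K is not a priori a
  p-group. The three complements of the diamond force A/K to be abelian; together with a trivial
  core of K this places some p-element of A outside K in O_p(G), so that A is the product of K with
  the part of A in O_p(G).\<close>

locale finite_group = group +
  assumes fin [simp]: "finite (carrier G)"

context group
begin

lemma inv_mult_cancel [simp]:
  assumes "x \<in> carrier G" "y \<in> carrier G"
  shows "inv x \<otimes> (x \<otimes> y) = y" "x \<otimes> (inv x \<otimes> y) = y"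
  using assms by (simp_all add: m_assoc[symmetric])

lemma set_multI: "a \<in> A \<Longrightarrow> b \<in> B \<Longrightarrow> a \<otimes> b \<in> A <#> B"
  by (auto simp: set_mult_def)

lemma set_multE:
  assumes "x \<in> A <#> B" obtains a b where "a \<in> A" "b \<in> B" "x = a \<otimes> b"
  using assms by (auto simp: set_mult_def)

lemma subgroup_set_mult_left:
  assumes "subgroup B G" "A \<subseteq> carrier G" shows "A \<subseteq> A <#> B"
  using assms set_multI[of _ A \<one> B] by (force simp: subgroup.one_closed)

lemma subgroup_set_mult_right:
  assumes "subgroup A G" "B \<subseteq> carrier G" shows "B \<subseteq> A <#> B"
  using assms set_multI[of \<one> A _ B] by (force simp: subgroup.one_closed)

lemma subgroup_set_mult_subset:
  assumes "subgroup C G" "A \<subseteq> C" "B \<subseteq> C" shows "A <#> B \<subseteq> C"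
  using assms by (auto simp: set_mult_def subset_iff intro: subgroup.m_closed)

lemma subset_set_mult1: "subgroup A G \<Longrightarrow> subgroup B G \<Longrightarrow> A \<subseteq> A <#> B"
  by (simp add: subgroup_set_mult_left subgroup.subset)

lemma subset_set_mult2: "subgroup A G \<Longrightarrow> subgroup B G \<Longrightarrow> B \<subseteq> A <#> B"
  by (simp add: subgroup_set_mult_right subgroup.subset)

lemma set_mult_absorb_right:
  assumes "subgroup A G" "subgroup B G" "B \<subseteq> A" shows "A <#> B = A"
  using subgroup_set_mult_subset[of A A B] subgroup_set_mult_left[of B A] assms
  by (auto simp: subgroup.subset)

lemma set_mult_absorb_left:
  assumes "subgroup A G" "subgroup B G" "B \<subseteq> A" shows "B <#> A = A"
  using subgroup_set_mult_subset[of A B A] subgroup_set_mult_right[of B A] assms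
  by (auto simp: subgroup.subset)

lemma inv_set_mult:
  assumes "subgroup A G" "subgroup B G"
  shows "m_inv G ` (A <#> B) = B <#> A"
proof -
  have *: "m_inv G ` (A <#> B) \<subseteq> B <#> A" if "subgroup A G" "subgroup B G" for A B
  proof
    fix x assume "x \<in> m_inv G ` (A <#> B)"
    then obtain a b where ab: "a \<in> A" "b \<in> B" "x = inv (a \<otimes> b)"
      by (auto simp: set_mult_def)
    then have "x = inv b \<otimes> inv a"
      using that by (simp add: inv_mult_group subgroup.mem_carrier)
    then show "x \<in> B <#> A"
      using ab that by (auto intro!: set_multI subgroup.m_inv_closed)
  qed
  have "B <#> A \<subseteq> m_inv G ` (A <#> B)"
  proof
    fix x assume x: "x \<in> B <#> A"
    then have "x \<in> carrier G"
      using assms setmult_subset_G subgroup.subset by blast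
    moreover have "inv x \<in> A <#> B"
      using x *[OF assms(2,1)] by auto
    ultimately show "x \<in> m_inv G ` (A <#> B)"
      by (metis imageI inv_inv)
  qed
  then show ?thesis
    using *[OF assms] by blast
qed

lemma subgroup_set_mult_iff:
  assumes A: "subgroup A G" and B: "subgroup B G"
  shows "subgroup (A <#> B) G \<longleftrightarrow> A <#> B = B <#> A"
proof
  assume S: "subgroup (A <#> B) G"
  have "m_inv G ` (A <#> B) = A <#> B"
  proof
    show "m_inv G ` (A <#> B) \<subseteq> A <#> B"
      using S by (auto intro: subgroup.m_inv_closed)
    show "A <#> B \<subseteq> m_inv G ` (A <#> B)"
    proof
      fix x assume "x \<in> A <#> B"
      then have "inv x \<in> A <#> B" "x = inv (inv x)"
        using S by (auto intro: subgroup.m_inv_closed simp: subgroup.mem_carrier)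
      then show "x \<in> m_inv G ` (A <#> B)" by blast
    qed
  qed
  then show "A <#> B = B <#> A"
    using inv_set_mult[OF A B] by simp
next
  assume eq: "A <#> B = B <#> A"
  show "subgroup (A <#> B) G"
  proof (rule subgroupI)
    show "A <#> B \<subseteq> carrier G"
      using A B by (simp add: setmult_subset_G subgroup.subset)
    show "A <#> B \<noteq> {}"
      using set_multI[OF subgroup.one_closed[OF A] subgroup.one_closed[OF B]] by auto
  next
    fix x assume "x \<in> A <#> B"
    then show "inv x \<in> A <#> B"
      using inv_set_mult[OF A B] eq by blast
  next
    fix x y assume "x \<in> A <#> B" "y \<in> A <#> B"
    then have "x \<otimes> y \<in> (A <#> B) <#> (A <#> B)"
      by (rule set_multI)
    also have "(A <#> B) <#> (A <#> B) = A <#> ((B <#> A) <#> B)"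
      using A B by (simp add: set_mult_assoc subgroup.subset setmult_subset_G)
    also have "\<dots> = (A <#> A) <#> (B <#> B)"
      unfolding eq[symmetric] using A B
      by (simp add: set_mult_assoc subgroup.subset setmult_subset_G)
    also have "\<dots> = A <#> B"
      using A B by (simp add: subgroup_mult_id)
    finally show "x \<otimes> y \<in> A <#> B" .
  qed
qed

lemma dedekind_right:
  assumes "subgroup C G" "A \<subseteq> C" "A \<subseteq> carrier G" "B \<subseteq> carrier G"
  shows "(A <#> B) \<inter> C = A <#> (B \<inter> C)"
proof
  show "(A <#> B) \<inter> C \<subseteq> A <#> (B \<inter> C)"
  proof
    fix x assume x: "x \<in> (A <#> B) \<inter> C"
    then obtain a b where ab: "a \<in> A" "b \<in> B" "x = a \<otimes> b" by (auto elim: set_multE)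
    then have "b = inv a \<otimes> x"
      using assms by (auto simp: subset_iff)
    moreover have "inv a \<otimes> x \<in> C"
      using x ab assms(1,2) by (blast intro: subgroup.m_closed subgroup.m_inv_closed)
    ultimately have "b \<in> C" by simp
    then show "x \<in> A <#> (B \<inter> C)"
      using ab by (auto intro: set_multI)
  qed
  show "A <#> (B \<inter> C) \<subseteq> (A <#> B) \<inter> C"
    using assms by (auto elim!: set_multE intro!: set_multI intro: subgroup.m_closed)
qed

lemma dedekind_left:
  assumes "subgroup C G" "B \<subseteq> C" "A \<subseteq> carrier G" "B \<subseteq> carrier G"
  shows "(A <#> B) \<inter> C = (A \<inter> C) <#> B"
proof
  show "(A <#> B) \<inter> C \<subseteq> (A \<inter> C) <#> B"
  proof
    fix x assume x: "x \<in> (A <#> B) \<inter> C"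
    then obtain a b where ab: "a \<in> A" "b \<in> B" "x = a \<otimes> b" by (auto elim: set_multE)
    then have "a = x \<otimes> inv b"
      using assms by (auto simp: subset_iff m_assoc)
    moreover have "x \<otimes> inv b \<in> C"
      using x ab assms(1,2) by (blast intro: subgroup.m_closed subgroup.m_inv_closed)
    ultimately have "a \<in> C" by simp
    then show "x \<in> (A \<inter> C) <#> B"
      using ab by (auto intro: set_multI)
  qed
  show "(A \<inter> C) <#> B \<subseteq> (A <#> B) \<inter> C"
    using assms by (auto elim!: set_multE intro!: set_multI intro: subgroup.m_closed)
qed

end

text \<open>This is conjugation by the inverse of what \<open>conjugate_by\<close> uses.\<close>

definition conj_by :: "('a, 'b) monoid_scheme \<Rightarrow> 'a \<Rightarrow> 'a \<Rightarrow> 'a" where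
  "conj_by G g x = g \<otimes>\<^bsub>G\<^esub> x \<otimes>\<^bsub>G\<^esub> inv\<^bsub>G\<^esub> g"

section \<open>Conjugation of elements and subsets\<close>

context group
begin

abbreviation cj where "cj \<equiv> conj_by G"

lemma cj_closed [simp]: "g \<in> carrier G \<Longrightarrow> x \<in> carrier G \<Longrightarrow> cj g x \<in> carrier G"
  by (simp add: conj_by_def)

lemma cj_mult: "g \<in> carrier G \<Longrightarrow> x \<in> carrier G \<Longrightarrow> y \<in> carrier G \<Longrightarrow> cj g (x \<otimes> y) = cj g x \<otimes> cj g y"
  by (simp add: conj_by_def m_assoc)

lemma cj_inv: "g \<in> carrier G \<Longrightarrow> x \<in> carrier G \<Longrightarrow> cj g (inv x) = inv (cj g x)"
  by (simp add: conj_by_def m_assoc inv_mult_group)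

lemma cj_cj: "g \<in> carrier G \<Longrightarrow> h \<in> carrier G \<Longrightarrow> x \<in> carrier G \<Longrightarrow> cj g (cj h x) = cj (g \<otimes> h) x"
  by (simp add: conj_by_def m_assoc inv_mult_group)

lemma cj_one [simp]: "x \<in> carrier G \<Longrightarrow> cj \<one> x = x" "g \<in> carrier G \<Longrightarrow> cj g \<one> = \<one>"
  by (simp_all add: conj_by_def)

lemma cj_inv_cancel [simp]:
  assumes "g \<in> carrier G" "x \<in> carrier G"
  shows "cj g (cj (inv g) x) = x" "cj (inv g) (cj g x) = x"
  using assms by (simp_all add: cj_cj)

lemma inj_cj: "g \<in> carrier G \<Longrightarrow> inj_on (cj g) (carrier G)"
  by (metis cj_inv_cancel(2) inj_onI)

lemma cj_hom: "g \<in> carrier G \<Longrightarrow> group_hom G G (cj g)"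
  by unfold_locales (auto simp: hom_def cj_mult)

lemma cj_subgroup: "g \<in> carrier G \<Longrightarrow> subgroup H G \<Longrightarrow> subgroup (cj g ` H) G"
  by (rule group_hom.subgroup_img_is_subgroup[OF cj_hom])

lemma cj_card: "g \<in> carrier G \<Longrightarrow> H \<subseteq> carrier G \<Longrightarrow> card (cj g ` H) = card H"
  by (meson card_image inj_cj inj_on_subset)

lemma cj_image_image:
  assumes "g \<in> carrier G" "h \<in> carrier G" "H \<subseteq> carrier G"
  shows "cj g ` cj h ` H = cj (g \<otimes> h) ` H"
  using assms by (force simp: image_image cj_cj subset_iff)

lemma cj_image_one [simp]: "H \<subseteq> carrier G \<Longrightarrow> cj \<one> ` H = H"
  by (force simp: subset_iff image_iff)

lemma cj_set_mult:
  assumes "g \<in> carrier G" "A \<subseteq> carrier G" "B \<subseteq> carrier G"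
  shows "cj g ` (A <#> B) = cj g ` A <#> cj g ` B"
proof
  show "cj g ` (A <#> B) \<subseteq> cj g ` A <#> cj g ` B"
    using assms by (auto simp: subset_iff cj_mult elim!: set_multE intro!: set_multI)
  show "cj g ` A <#> cj g ` B \<subseteq> cj g ` (A <#> B)"
  proof
    fix x assume "x \<in> cj g ` A <#> cj g ` B"
    then obtain a b where "a \<in> A" "b \<in> B" "x = cj g a \<otimes> cj g b" by (auto elim!: set_multE)
    then have "a \<otimes> b \<in> A <#> B" "x = cj g (a \<otimes> b)"
      using assms by (auto simp: subset_iff cj_mult set_multI)
    then show "x \<in> cj g ` (A <#> B)" by blast
  qed
qed

lemma cj_image_eq_self:
  assumes "subgroup H G" "g \<in> H" shows "cj g ` H = H"
proof
  have *: "cj h ` H \<subseteq> H" if "h \<in> H" for h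
    using that assms by (auto simp: conj_by_def subgroup.m_closed subgroup.m_inv_closed)
  show "cj g ` H \<subseteq> H" using * assms by blast
  have "cj (inv g) ` H \<subseteq> H" using *[of "inv g"] assms by (simp add: subgroup.m_inv_closed)
  then have "cj g ` cj (inv g) ` H \<subseteq> cj g ` H" by blast
  then show "H \<subseteq> cj g ` H"
    using assms by (simp add: cj_image_image subgroup.mem_carrier subgroup.subset)
qed

lemma normal_cj_iff: "N \<lhd> G \<longleftrightarrow> subgroup N G \<and> (\<forall>g\<in>carrier G. \<forall>x\<in>N. cj g x \<in> N)"
  by (auto simp: normal_inv_iff conj_by_def)

lemma cj_pow: "g \<in> carrier G \<Longrightarrow> x \<in> carrier G \<Longrightarrow> cj g (x [^] (n::nat)) = cj g x [^] n"
  using group_hom.hom_nat_pow[OF cj_hom] by blast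

lemma ord_cj [simp]:
  assumes "g \<in> carrier G" "x \<in> carrier G" shows "ord (cj g x) = ord x"
proof -
  have *: "cj g x [^] n = \<one> \<longleftrightarrow> x [^] n = \<one>" for n :: nat
    using assms cj_pow[OF assms, of n] by (metis cj_inv_cancel(2) cj_one(2) inv_closed nat_pow_closed)
  show ?thesis
    using assms * pow_eq_id[of x] pow_eq_id[of "cj g x"]
    by (metis cj_closed dvd_antisym dvd_refl)
qed

lemma cj_normalizer_subgroup:
  assumes "Y \<subseteq> carrier G" "finite Y"
  shows "subgroup {g \<in> carrier G. cj g ` Y = Y} G"
proof (rule subgroupI)
  show "{g \<in> carrier G. cj g ` Y = Y} \<noteq> {}"
    using assms cj_image_one by force
next
  fix a assume "a \<in> {g \<in> carrier G. cj g ` Y = Y}"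
  then have a: "a \<in> carrier G" "cj a ` Y = Y" by auto
  have "cj (inv a) ` cj a ` Y = Y" using a(1) assms by (subst cj_image_image) auto
  then have "cj (inv a) ` Y = Y" using a(2) by simp
  then show "inv a \<in> {g \<in> carrier G. cj g ` Y = Y}" using a by simp
next
  fix a b assume "a \<in> {g \<in> carrier G. cj g ` Y = Y}" "b \<in> {g \<in> carrier G. cj g ` Y = Y}"
  then have ab: "a \<in> carrier G" "cj a ` Y = Y" "b \<in> carrier G" "cj b ` Y = Y" by auto
  then have "cj (a \<otimes> b) ` Y = Y" using assms by (simp flip: cj_image_image)
  then show "a \<otimes> b \<in> {g \<in> carrier G. cj g ` Y = Y}" using ab by simp
qed auto

lemma set_mult_permute_cj:
  assumes "subgroup A G" "subgroup B G" "\<And>b a. b \<in> B \<Longrightarrow> a \<in> A \<Longrightarrow> cj b a \<in> A"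
  shows "A <#> B = B <#> A"
proof
  show "B <#> A \<subseteq> A <#> B"
  proof
    fix x assume "x \<in> B <#> A"
    then obtain b a where ab: "b \<in> B" "a \<in> A" "x = b \<otimes> a" by (auto elim: set_multE)
    then have "x = cj b a \<otimes> b"
      using assms(1,2) by (simp add: conj_by_def m_assoc subgroup.mem_carrier)
    then show "x \<in> A <#> B" using ab assms by (auto intro: set_multI)
  qed
  show "A <#> B \<subseteq> B <#> A"
  proof
    fix x assume "x \<in> A <#> B"
    then obtain b a where ab: "b \<in> B" "a \<in> A" "x = a \<otimes> b" by (auto elim: set_multE)
    then have "x = b \<otimes> cj (inv b) a"
      using assms(1,2) by (simp add: conj_by_def m_assoc subgroup.mem_carrier)
    then show "x \<in> B <#> A" using ab assms subgroup.m_inv_closed[OF assms(2)] by (auto intro: set_multI)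
  qed
qed

end

context finite_group
begin

lemma subgroup_finite: "subgroup H G \<Longrightarrow> finite H"
  using fin finite_subset subgroup.subset by blast

lemma card_subgroup_pos: "subgroup H G \<Longrightarrow> 0 < card H"
  using subgroup_finite subgroup.one_closed by (metis card_gt_0_iff empty_iff)

lemma card_dvd:
  assumes "subgroup H G" "subgroup K G" "H \<subseteq> K" shows "card H dvd card K"
proof -
  interpret K: group "G\<lparr>carrier := K\<rparr>" using assms by (simp add: subgroup_imp_group)
  have "subgroup H (G\<lparr>carrier := K\<rparr>)" using assms by (simp add: subgroup_incl)
  from K.lagrange[OF this] have "card K = card H * card (rcosets\<^bsub>G\<lparr>carrier := K\<rparr>\<^esub> H)"
    by (simp add: order_def mult.commute)
  then show ?thesis by (rule dvdI)
qed

lemma card_subgroup_dvd_order: "subgroup H G \<Longrightarrow> card H dvd order G"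
  using card_dvd[OF _ subgroup_self] by (simp add: order_def subgroup.subset)

text \<open>Multiplication maps \<open>A \<times> B\<close> onto the product, and the fibre over ab
  consists of the pairs (ac, c^-1 b) with c in \<open>A \<inter> B\<close>, so all fibres have the
  same size.\<close>

lemma card_set_mult:
  assumes A: "subgroup A G" and B: "subgroup B G"
  shows "card (A <#> B) * card (A \<inter> B) = card A * card B"
proof -
  define f where "f = (\<lambda>(a, b). a \<otimes> b)"
  have fin': "finite (A \<times> B)" using subgroup_finite A B by blast
  have im: "f ` (A \<times> B) = A <#> B" by (auto simp: f_def set_mult_def)
  have fib: "card {x \<in> A \<times> B. f x = y} = card (A \<inter> B)" if y: "y \<in> A <#> B" for y
  proof -
    from y obtain a b where ab: "a \<in> A" "b \<in> B" "y = a \<otimes> b" by (auto elim: set_multE)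
    have abC: "a \<in> carrier G" "b \<in> carrier G" using ab A B by (auto simp: subgroup.mem_carrier)
    have C: "u \<in> carrier G" if "u \<in> A \<or> u \<in> B" for u
      using that subgroup.subset[OF A] subgroup.subset[OF B] by auto
    have *: "inv a \<otimes> u \<in> A \<inter> B \<and> inv (inv a \<otimes> u) \<otimes> b = v"
      if uv: "u \<in> A" "v \<in> B" "u \<otimes> v = a \<otimes> b" for u v
    proof -
      have uvC: "u \<in> carrier G" "v \<in> carrier G" using uv C by auto
      have "u = a \<otimes> b \<otimes> inv v" using uv(3) uvC abC by (metis inv_solve_right m_closed)
      then have eq: "inv a \<otimes> u = b \<otimes> inv v" using uvC abC by (simp add: m_assoc)
      have "inv a \<otimes> u \<in> A" using ab(1) uv(1) A by (blast intro: subgroup.m_closed subgroup.m_inv_closed)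
      moreover have "b \<otimes> inv v \<in> B" using ab(2) uv(2) B by (blast intro: subgroup.m_closed subgroup.m_inv_closed)
      moreover have "inv (b \<otimes> inv v) \<otimes> b = v" using uvC abC by (simp add: inv_mult_group m_assoc)
      ultimately show ?thesis using eq by simp
    qed
    have **: "a \<otimes> c \<in> A \<and> inv c \<otimes> b \<in> B \<and> a \<otimes> c \<otimes> (inv c \<otimes> b) = y" if c: "c \<in> A \<inter> B" for c
    proof -
      have "c \<in> carrier G" using c C by blast
      then have "a \<otimes> c \<otimes> (inv c \<otimes> b) = y" using abC ab(3) by (simp add: m_assoc)
      moreover have "a \<otimes> c \<in> A" "inv c \<otimes> b \<in> B"
        using c ab A B by (blast intro: subgroup.m_closed subgroup.m_inv_closed)+
      ultimately show ?thesis by simp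
    qed
    have "bij_betw (\<lambda>c. (a \<otimes> c, inv c \<otimes> b)) (A \<inter> B) {x \<in> A \<times> B. f x = y}"
    proof (rule bij_betw_byWitness[where f' = "\<lambda>(u, v). inv a \<otimes> u"])
      show "\<forall>c\<in>A \<inter> B. (\<lambda>(u, v). inv a \<otimes> u) (a \<otimes> c, inv c \<otimes> b) = c"
        using C abC by simp
      show "(\<lambda>c. (a \<otimes> c, inv c \<otimes> b)) ` (A \<inter> B) \<subseteq> {x \<in> A \<times> B. f x = y}"
        using ** by (auto simp: f_def)
      show "\<forall>x\<in>{x \<in> A \<times> B. f x = y}. (\<lambda>c. (a \<otimes> c, inv c \<otimes> b)) ((\<lambda>(u, v). inv a \<otimes> u) x) = x"
        using * abC C ab by (simp add: f_def split: prod.splits)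
      show "(\<lambda>(u, v). inv a \<otimes> u) ` {x \<in> A \<times> B. f x = y} \<subseteq> A \<inter> B"
        using * ab by (auto simp: f_def)
    qed
    then show ?thesis using bij_betw_same_card[symmetric] by blast
  qed
  have "card A * card B = card (A \<times> B)" by (simp add: card_cartesian_product)
  also have "\<dots> = (\<Sum>y\<in>f ` (A \<times> B). card {x \<in> A \<times> B. f x = y})"
    unfolding card_eq_sum by (rule sum.image_gen[OF fin'])
  also have "\<dots> = card (A <#> B) * card (A \<inter> B)"
    unfolding im using fib by simp
  finally show ?thesis by simp
qed

text \<open>The index of \<open>A\<close> in \<open>A <#> S\<close> is card S / card (A \<inter> S),
  and the index of \<open>A\<close> in \<open>W\<close> divides it. When \<open>S\<close> is a Sylow
  p-subgroup this index is a power of p; comparing two primes then forces it to be 1.\<close>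

lemma subgroup_between_index:
  assumes "subgroup A G" "subgroup S G" "subgroup W G" "subgroup (A <#> S) G" "A \<subseteq> W" "W \<subseteq> A <#> S"
  obtains w where "card W = card A * w" "w dvd card S"
proof -
  obtain w where w: "card W = card A * w"
    using card_dvd[OF assms(1,3,5)] by blast
  obtain u where u: "card (A <#> S) = card W * u"
    using card_dvd[OF assms(3,4,6)] by blast
  have "card A * (w * u * card (A \<inter> S)) = card A * card S"
    using card_set_mult[OF assms(1,2)] w u by (simp add: mult.assoc)
  then have "w * u * card (A \<inter> S) = card S"
    using card_subgroup_pos[OF assms(1)] by simp
  then have "w dvd card S" by (metis dvd_mult_left dvd_triv_left)
  then show ?thesis using that w by blast
qed

lemma subgroup_eq_card:
  assumes "subgroup K G" "H \<subseteq> K" "card K \<le> card H" shows "H = K"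
  using assms subgroup_finite by (metis card_seteq)

end

section \<open>Sylow subgroups\<close>

lemma only_prime_divisor_imp_power:
  fixes k p :: nat
  assumes "Factorial_Ring.prime p" "k > 0" "\<And>q. Factorial_Ring.prime q \<Longrightarrow> q dvd k \<Longrightarrow> q = p"
  shows "\<exists>j. k = p ^ j"
proof -
  have "\<not> is_unit p" using assms(1) by (metis not_prime_unit)
  then obtain x where x: "k = p ^ multiplicity p k * x" "\<not> p dvd x"
    using multiplicity_decompose'[of k p] assms(2) by auto
  have "x = 1"
  proof (rule ccontr)
    assume "x \<noteq> 1"
    then obtain q where q: "Factorial_Ring.prime q" "q dvd x" using prime_factor_nat by blast
    moreover have "q dvd k" using q(2) x(1) by (metis dvd_mult)
    ultimately have "q = p" using assms(3) by blast
    then show False using q(2) x(2) by simp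
  qed
  then show ?thesis using x(1) by auto
qed

text \<open>The hypothesis makes \<open>m\<close> and \<open>n\<close> agree in multiplicity at
  every prime other than \<open>p\<close>, so the quotient n/m has no prime factor except
  \<open>p\<close>.\<close>

lemma index_prime_power:
  fixes m n p :: nat
  assumes p: "Factorial_Ring.prime p" and n: "n > 0" and "m dvd n"
    and *: "\<And>q. Factorial_Ring.prime q \<Longrightarrow> q \<noteq> p \<Longrightarrow> q ^ multiplicity q n dvd m"
  shows "\<exists>j. n = m * p ^ j"
proof -
  obtain k where k: "n = m * k" using \<open>m dvd n\<close> by blast
  then have pos: "m > 0" "k > 0" using n by auto
  have "q = p" if q: "Factorial_Ring.prime q" "q dvd k" for q
  proof (rule ccontr)
    assume "q \<noteq> p"
    then have "multiplicity q n \<le> multiplicity q m"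
      using * q(1) pos by (metis multiplicity_geI not_prime_unit less_irrefl)
    moreover have "multiplicity q n = multiplicity q m + multiplicity q k"
      unfolding k using q pos by (intro prime_elem_multiplicity_mult_distrib) auto
    moreover have "multiplicity q k > 0"
      using q pos by (simp add: prime_multiplicity_gt_zero_iff)
    ultimately show False by simp
  qed
  then show ?thesis using only_prime_divisor_imp_power[OF p pos(2)] k by blast
qed

lemma coprime_prime_powers:
  fixes p q w :: nat
  assumes "Factorial_Ring.prime p" "Factorial_Ring.prime q" "p \<noteq> q" "w dvd p ^ a" "w dvd q ^ b"
  shows "w = 1"
proof -
  have "coprime (p ^ a) (q ^ b)" using assms(1-3) by (simp add: primes_coprime)
  then show ?thesis using assms(4,5) by (metis coprime_common_divisor nat_dvd_1_iff_1)
qed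

section \<open>Double coset counting\<close>

context group
begin

definition double_coset :: "'a set \<Rightarrow> 'a set \<Rightarrow> 'a \<Rightarrow> 'a set" where
  "double_coset K H x = {k \<otimes> x \<otimes> h | k h. k \<in> K \<and> h \<in> H}"

lemma double_coset_eq:
  assumes "subgroup K G" "subgroup H G" "x \<in> carrier G" "z \<in> double_coset K H x"
  shows "double_coset K H z = double_coset K H x"
proof -
  interpret K: subgroup K G by fact
  interpret H: subgroup H G by fact
  obtain k h where kh: "k \<in> K" "h \<in> H" "z = k \<otimes> x \<otimes> h"
    using assms(4) by (auto simp: double_coset_def)
  have "\<exists>k'' h''. k' \<otimes> z \<otimes> h' = k'' \<otimes> x \<otimes> h'' \<and> k'' \<in> K \<and> h'' \<in> H" if "k' \<in> K" "h' \<in> H" for k' h'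
    using that kh assms(3)
    by (intro exI[of _ "k' \<otimes> k"] exI[of _ "h \<otimes> h'"]) (simp add: m_assoc)
  moreover have "\<exists>k'' h''. k' \<otimes> x \<otimes> h' = k'' \<otimes> z \<otimes> h'' \<and> k'' \<in> K \<and> h'' \<in> H" if "k' \<in> K" "h' \<in> H" for k' h'
    using that kh assms(3)
    by (intro exI[of _ "k' \<otimes> inv k"] exI[of _ "inv h \<otimes> h'"]) (simp add: m_assoc)
  ultimately show ?thesis
    unfolding double_coset_def by blast
qed

lemma double_coset_self:
  assumes "subgroup K G" "subgroup H G" "x \<in> carrier G"
  shows "x \<in> double_coset K H x"
proof -
  have "x = \<one> \<otimes> x \<otimes> \<one>" using assms by simp
  then show ?thesis unfolding double_coset_def
    using assms(1,2) subgroup.one_closed by blast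
qed

lemma double_coset_closed:
  assumes "subgroup K G" "subgroup H G" "x \<in> carrier G"
  shows "double_coset K H x \<subseteq> carrier G"
proof -
  interpret K: subgroup K G by fact
  interpret H: subgroup H G by fact
  show ?thesis using assms(3) by (auto simp: double_coset_def)
qed

end

context finite_group
begin

text \<open>Right translation by x^-1 turns \<open>double_coset K H x\<close> into the product of
  \<open>K\<close> with the conjugate xHx^-1, so the product formula applies.\<close>

lemma card_double_coset:
  assumes "subgroup K G" "subgroup H G" "x \<in> carrier G"
  shows "card (double_coset K H x) * card (K \<inter> cj x ` H) = card K * card H"
proof -
  interpret K: subgroup K G by fact
  interpret H: subgroup H G by fact
  have eq: "double_coset K H x = (\<lambda>y. y \<otimes> x) ` (K <#> cj x ` H)"
    using assms(3) by (force simp: double_coset_def set_mult_def conj_by_def m_assoc)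
  have sub: "K <#> cj x ` H \<subseteq> carrier G"
    using assms by (intro setmult_subset_G) auto
  have "inj_on (\<lambda>y. y \<otimes> x) (carrier G)"
    using assms(3) by (simp add: inj_on_def)
  then have "card (double_coset K H x) = card (K <#> cj x ` H)"
    unfolding eq using card_image inj_on_subset sub by metis
  then show ?thesis
    using card_set_mult[OF assms(1) cj_subgroup[OF assms(3,2)]] cj_card[OF assms(3) H.subset]
    by simp
qed

lemma dvd_double_cosets:
  assumes K: "subgroup K G" and H: "subgroup H G" and S: "S \<subseteq> carrier G"
    and closed: "\<And>x. x \<in> S \<Longrightarrow> double_coset K H x \<subseteq> S"
    and dvd: "\<And>x. x \<in> S \<Longrightarrow> N dvd card (double_coset K H x)"
  shows "N dvd card S"
proof -
  let ?C = "double_coset K H ` S"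
  have U: "\<Union>?C = S"
  proof
    show "\<Union>?C \<subseteq> S" using closed by blast
    show "S \<subseteq> \<Union>?C" using double_coset_self[OF K H] S by auto
  qed
  have "finite S" using finite_subset[OF S fin] .
  have "N dvd card (\<Union>?C)"
  proof (rule dvd_partition)
    show "finite (\<Union>?C)" unfolding U by fact
    show "\<forall>c\<in>?C. N dvd card c" using dvd by blast
    show "\<forall>c1\<in>?C. \<forall>c2\<in>?C. c1 \<noteq> c2 \<longrightarrow> c1 \<inter> c2 = {}"
    proof (intro ballI impI, rule ccontr)
      fix c d assume "c \<in> ?C" "d \<in> ?C" "c \<noteq> d" "c \<inter> d \<noteq> {}"
      then obtain x y z where "x \<in> S" "y \<in> S" "c = double_coset K H x" "d = double_coset K H y"
        "z \<in> double_coset K H x" "z \<in> double_coset K H y" by auto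
      moreover from this have "c = double_coset K H z" "d = double_coset K H z"
        using double_coset_eq[OF K H] S by auto
      ultimately show False using \<open>c \<noteq> d\<close> by simp
    qed
  qed
  then show ?thesis unfolding U .
qed

text \<open>If no conjugate of \<open>H\<close> lies in \<open>K\<close>, then \<open>K\<close>
  meets every conjugate of \<open>H\<close> in fewer than p^n elements, so every double coset KxH
  has size divisible by p times card K; summing over the double cosets, so is the group order.
  Containment in a Sylow subgroup and conjugacy of Sylow subgroups both follow from this.\<close>

lemma p_subgroup_in_conjugate:
  assumes p: "Factorial_Ring.prime p" and H: "subgroup H G" "card H = p ^ n" and K: "subgroup K G"
    and nd: "\<not> card K * p dvd order G"
  shows "\<exists>x\<in>carrier G. cj x ` H \<subseteq> K"
proof (rule ccontr)
  assume no: "\<not> (\<exists>x\<in>carrier G. cj x ` H \<subseteq> K)"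
  have "card K * p dvd card (double_coset K H x)" if x: "x \<in> carrier G" for x
  proof -
    have sg: "subgroup (cj x ` H) G" "subgroup (K \<inter> cj x ` H) G"
      using cj_subgroup[OF x H(1)] K by (auto intro: subgroups_Inter_pair)
    have cd: "card (cj x ` H) = p ^ n" using cj_card[OF x] H subgroup.subset by metis
    have "card (K \<inter> cj x ` H) dvd p ^ n" using card_dvd[OF sg(2,1)] cd by simp
    then obtain i where i: "i \<le> n" "card (K \<inter> cj x ` H) = p ^ i" using p by (auto simp: divides_primepow_nat)
    have "i \<noteq> n"
    proof
      assume "i = n"
      then have "K \<inter> cj x ` H = cj x ` H" using i cd by (intro subgroup_eq_card[OF sg(1)]) auto
      then show False using no x by blast
    qed
    then have "n = i + Suc (n - i - 1)" using i by simp
    then have pn: "p ^ n = p ^ i * (p * p ^ (n - i - 1))" by (metis power_Suc power_add)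
    have "card (double_coset K H x) * p ^ i = p ^ i * (card K * p * p ^ (n - i - 1))"
      using card_double_coset[OF K H(1) x] i H(2) pn by simp
    then have "card (double_coset K H x) = card K * p * p ^ (n - i - 1)"
      using prime_gt_0_nat[OF p] by simp
    then show ?thesis by simp
  qed
  then have "card K * p dvd card (carrier G)"
    using dvd_double_cosets[OF K H(1), of "carrier G"] double_coset_closed[OF K H(1)] by simp
  then show False using nd by (simp add: order_def)
qed

text \<open>The growth of normalizers in p-groups, lifted along a normal \<open>Y\<close> of p-power
  index without forming the quotient. If no x outside \<open>A\<close> normalized \<open>A\<close>,
  each double coset AxA outside \<open>A\<close> would have size divisible by p times card A,
  because \<open>A\<close> and its conjugate meet in a smaller subgroup above \<open>Y\<close>. Then
  card A itself would be divisible by p times card A.\<close>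

lemma normalizer_growth:
  assumes p: "Factorial_Ring.prime p" and Y: "Y \<lhd> G" and A: "subgroup A G" "Y \<subseteq> A" "A \<noteq> carrier G"
    and idx: "order G = card Y * p ^ j"
  shows "\<exists>x\<in>carrier G - A. cj x ` A = A"
proof (rule ccontr)
  assume no: "\<not> (\<exists>x\<in>carrier G - A. cj x ` A = A)"
  have Ysg: "subgroup Y G" using Y by (rule normal_imp_subgroup)
  have between: "\<exists>i. card B = card Y * p ^ i" if B: "subgroup B G" "Y \<subseteq> B" for B
  proof -
    obtain b where b: "card B = card Y * b" using card_dvd[OF Ysg B] by blast
    moreover have "card B dvd order G" using B(1) by (rule card_subgroup_dvd_order)
    ultimately have "b dvd p ^ j" using idx card_subgroup_pos[OF Ysg] by simp
    then show ?thesis using b p by (auto simp: divides_primepow_nat)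
  qed
  obtain a where a: "card A = card Y * p ^ a" using between A by blast
  obtain c where c: "order G = card A * c" using card_subgroup_dvd_order[OF A(1)] by blast
  have "p ^ j = p ^ a * c" using c a idx card_subgroup_pos[OF Ysg] by simp
  then have "c dvd p ^ j" by simp
  then obtain b where b: "c = p ^ b" using p by (auto simp: divides_primepow_nat)
  have "b \<noteq> 0"
  proof
    assume "b = 0"
    then have "card A = card (carrier G)" using c b by (simp add: order_def)
    then show False using A subgroup_eq_card[OF subgroup_self] subgroup.subset by (metis order_refl)
  qed
  then have "card A * p dvd order G" using c b by (auto simp: dvd_power)
  have dc: "card A * p dvd card (double_coset A A x)" if x: "x \<in> carrier G - A" for x
  proof -
    have xG: "x \<in> carrier G" using x by simp
    have sg: "subgroup (cj x ` A) G" "subgroup (A \<inter> cj x ` A) G"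
      using cj_subgroup[OF xG A(1)] A(1) by (auto intro: subgroups_Inter_pair)
    have cd: "card (cj x ` A) = card A" using cj_card[OF xG] A subgroup.subset by metis
    have "Y \<subseteq> cj x ` A"
    proof
      fix y assume y: "y \<in> Y"
      then have "cj (inv x) y \<in> A" using Y xG A(2) by (auto simp: normal_cj_iff)
      moreover have "y = cj x (cj (inv x) y)" using xG y Ysg by (simp add: subgroup.mem_carrier)
      ultimately show "y \<in> cj x ` A" by blast
    qed
    then obtain i where i: "card (A \<inter> cj x ` A) = card Y * p ^ i" using between[OF sg(2)] A by blast
    have "card (A \<inter> cj x ` A) dvd card A" using card_dvd[OF sg(2) A(1)] by simp
    then have "p ^ i dvd p ^ a" using a i card_subgroup_pos[OF Ysg] by simp
    then have ia: "i \<le> a" using p prime_gt_1_nat power_dvd_imp_le by blast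
    have "i \<noteq> a"
    proof
      assume "i = a"
      then have "card (A \<inter> cj x ` A) = card A" using a i by simp
      then have "A \<inter> cj x ` A = A" "A \<inter> cj x ` A = cj x ` A"
        using subgroup_eq_card[OF A(1)] subgroup_eq_card[OF sg(1)] cd by auto
      then show False using no x by auto
    qed
    then have "a = i + Suc (a - i - 1)" using ia by simp
    then have pn: "p ^ a = p ^ i * (p * p ^ (a - i - 1))" by (metis power_Suc power_add)
    have "card (double_coset A A x) * (card Y * p ^ i) = (card A * p * p ^ (a - i - 1)) * (card Y * p ^ i)"
    proof -
      have "card (double_coset A A x) * (card Y * p ^ i) = card A * card A"
        using card_double_coset[OF A(1,1) xG] i by simp
      also have "\<dots> = card A * (card Y * (p ^ i * (p * p ^ (a - i - 1))))"
        by (metis a pn)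
      finally show ?thesis by (simp add: ac_simps)
    qed
    then have "card (double_coset A A x) = card A * p * p ^ (a - i - 1)"
      using prime_gt_0_nat[OF p] card_subgroup_pos[OF Ysg] by simp
    then show ?thesis by simp
  qed
  have "double_coset A A x \<subseteq> carrier G - A" if x: "x \<in> carrier G - A" for x
  proof
    interpret A: subgroup A G by fact
    fix z assume z: "z \<in> double_coset A A x"
    then obtain k h where kh: "k \<in> A" "h \<in> A" "z = k \<otimes> x \<otimes> h" by (auto simp: double_coset_def)
    then have "x = inv k \<otimes> z \<otimes> inv h" using x by (simp add: m_assoc)
    moreover have "inv k \<otimes> z \<otimes> inv h \<in> A" if "z \<in> A"
      using kh(1,2) that by simp
    ultimately have "z \<notin> A" using x by auto
    moreover have "z \<in> carrier G" using kh x by auto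
    ultimately show "z \<in> carrier G - A" by simp
  qed
  then have "card A * p dvd card (carrier G - A)"
    using dvd_double_cosets[OF A(1,1), of "carrier G - A"] dc by simp
  moreover have "card (carrier G - A) = order G - card A"
    unfolding order_def using A(1) by (intro card_Diff_subset subgroup_finite) (auto dest: subgroup.subset)
  ultimately have "card A * p dvd order G - card A" by simp
  moreover have "card A \<le> order G"
    using card_mono[OF fin subgroup.subset[OF A(1)]] by (simp add: order_def)
  ultimately have "card A * p dvd card A"
    using \<open>card A * p dvd order G\<close> by (metis diff_diff_cancel dvd_diff_nat)
  then show False
    using card_subgroup_pos[OF A(1)] prime_gt_1_nat[OF p] by (simp add: nat_dvd_not_less)
qed

end

section \<open>Elements of prime power order and Sylow's theorems\<close>

context group
begin

definition p_element :: "nat \<Rightarrow> 'a \<Rightarrow> bool" where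
  "p_element p x \<longleftrightarrow> x \<in> carrier G \<and> (\<exists>k. ord x = p ^ k)"

text \<open>The order is a power of a single prime different from p, rather than merely coprime to
  p: such an element lies in a Sylow subgroup, the only kind of subgroup that S-permutability speaks
  about. The identity qualifies.\<close>

definition other_prime_element :: "nat \<Rightarrow> 'a \<Rightarrow> bool" where
  "other_prime_element p x \<longleftrightarrow> (\<exists>q. Factorial_Ring.prime q \<and> q \<noteq> p \<and> p_element q x)"

lemma other_prime_element_carrier: "other_prime_element p x \<Longrightarrow> x \<in> carrier G"
  by (auto simp: other_prime_element_def p_element_def)

lemma p_element_cj: "g \<in> carrier G \<Longrightarrow> p_element p x \<Longrightarrow> p_element p (cj g x)"
  by (simp add: p_element_def)

lemma other_prime_element_cj: "g \<in> carrier G \<Longrightarrow> other_prime_element p x \<Longrightarrow> other_prime_element p (cj g x)"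
  by (auto simp: other_prime_element_def p_element_cj)

end

context finite_group
begin

lemma finite_group_subgroup:
  assumes "subgroup T G" shows "finite_group (G\<lparr>carrier := T\<rparr>)"
  using assms by (simp add: finite_group_def finite_group_axioms_def subgroup_imp_group subgroup_finite)

lemma ord_dvd_card:
  assumes "subgroup Q G" "x \<in> Q" shows "ord x dvd card Q"
proof -
  have x: "x \<in> carrier G" using assms by (simp add: subgroup.mem_carrier)
  have "generate G {x} \<subseteq> Q" using assms by (simp add: generate_subgroup_incl)
  then have "card (generate G {x}) dvd card Q"
    using x assms by (intro card_dvd generate_is_subgroup) auto
  then show ?thesis by (simp add: generate_pow_card[OF x])
qed

lemma p_element_in_p_subgroup:
  assumes "Factorial_Ring.prime q" "subgroup Q G" "card Q = q ^ n" "x \<in> Q"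
  shows "p_element q x"
proof -
  have "ord x dvd q ^ n" using ord_dvd_card[OF assms(2,4)] assms(3) by simp
  then have "\<exists>k. ord x = q ^ k" using assms(1) by (auto simp: divides_primepow_nat)
  then show ?thesis using subgroup.mem_carrier[OF assms(2,4)] by (simp add: p_element_def)
qed

lemma sylow_in_subgroup:
  assumes T: "subgroup T G" and q: "Factorial_Ring.prime q"
  shows "\<exists>Q. subgroup Q G \<and> Q \<subseteq> T \<and> card Q = q ^ multiplicity q (card T)"
proof -
  interpret T: finite_group "G\<lparr>carrier := T\<rparr>" by (rule finite_group_subgroup[OF T])
  obtain m where "card T = q ^ multiplicity q (card T) * m"
    using multiplicity_dvd by blast
  then have "\<exists>H. subgroup H (G\<lparr>carrier := T\<rparr>) \<and> card H = q ^ multiplicity q (card T)"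
    using q T.is_group T.fin by (intro sylow_thm) (auto simp: order_def)
  then show ?thesis
    using incl_subgroup[OF T] subgroup.subset by force
qed

lemma sylow_exists:
  assumes "Factorial_Ring.prime p" shows "\<exists>P. sylow_subgroup p G P"
  using sylow_in_subgroup[OF subgroup_self assms] assms
  by (auto simp: sylow_subgroup_def order_def)

lemma sylow_prime: "sylow_subgroup p G P \<Longrightarrow> Factorial_Ring.prime p"
  and sylow_subgrp: "sylow_subgroup p G P \<Longrightarrow> subgroup P G"
  and sylow_card: "sylow_subgroup p G P \<Longrightarrow> card P = p ^ multiplicity p (order G)"
  by (auto simp: sylow_subgroup_def)

lemma order_pos: "order G > 0" by (simp add: order_gt_0_iff_finite)

lemma sylow_index_not_dvd:
  assumes "sylow_subgroup p G P" shows "\<not> card P * p dvd order G"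
proof
  assume "card P * p dvd order G"
  then have "p ^ Suc (multiplicity p (order G)) dvd order G"
    using sylow_card[OF assms] by (simp add: mult.commute)
  then show False
    using order_pos sylow_prime[OF assms]
    by (metis multiplicity_geI not_less_eq_eq not_prime_unit order_refl less_irrefl)
qed

lemma sylow_cj:
  assumes "sylow_subgroup p G P" "g \<in> carrier G" shows "sylow_subgroup p G (cj g ` P)"
  using assms cj_subgroup cj_card subgroup.subset by (metis sylow_subgroup_def)

lemma p_subgroup_in_sylow_conj:
  assumes P: "sylow_subgroup p G P" and H: "subgroup H G" "card H = p ^ n"
  shows "\<exists>g\<in>carrier G. H \<subseteq> cj g ` P"
proof -
  obtain x where x: "x \<in> carrier G" "cj x ` H \<subseteq> P"
    using p_subgroup_in_conjugate[OF sylow_prime[OF P] H sylow_subgrp[OF P] sylow_index_not_dvd[OF P]] by blast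
  have "cj (inv x) ` cj x ` H \<subseteq> cj (inv x) ` P" using x by blast
  then have "H \<subseteq> cj (inv x) ` P" using x(1) H by (simp add: cj_image_image subgroup.subset)
  then show ?thesis using x by blast
qed

lemma p_subgroup_in_sylow:
  assumes "Factorial_Ring.prime p" "subgroup H G" "card H = p ^ n"
  shows "\<exists>P. sylow_subgroup p G P \<and> H \<subseteq> P"
  using sylow_exists[OF assms(1)] p_subgroup_in_sylow_conj[OF _ assms(2,3)] sylow_cj by blast

lemma sylow_conjugate:
  assumes "sylow_subgroup p G P" "sylow_subgroup p G Q"
  shows "\<exists>g\<in>carrier G. Q = cj g ` P"
proof -
  obtain g where g: "g \<in> carrier G" "Q \<subseteq> cj g ` P"
    using p_subgroup_in_sylow_conj[OF assms(1) sylow_subgrp[OF assms(2)] sylow_card[OF assms(2)]] by blast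
  have "sylow_subgroup p G (cj g ` P)" using sylow_cj assms g by blast
  then have "Q = cj g ` P"
    using g(2) assms(2) by (intro subgroup_eq_card) (auto simp: sylow_subgroup_def)
  then show ?thesis using g by blast
qed

lemma p_element_in_sylow:
  assumes "Factorial_Ring.prime p" "p_element p x"
  shows "\<exists>P. sylow_subgroup p G P \<and> x \<in> P"
proof -
  have x: "x \<in> carrier G" using assms by (simp add: p_element_def)
  obtain k where "card (generate G {x}) = p ^ k"
    using assms x by (auto simp: p_element_def simp flip: generate_pow_card)
  then obtain P where "sylow_subgroup p G P" "generate G {x} \<subseteq> P"
    using p_subgroup_in_sylow[OF assms(1), of "generate G {x}" k] generate_is_subgroup[of "{x}"] x by auto
  then show ?thesis by (meson generate.incl singletonI subsetD)
qed

lemma sylow_p_element: "sylow_subgroup p G P \<Longrightarrow> x \<in> P \<Longrightarrow> p_element p x"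
  using p_element_in_p_subgroup by (metis sylow_subgroup_def)

text \<open>For a prime q other than \<open>p\<close>, a Sylow q-subgroup of \<open>T\<close>
  consists of elements of q-power order, so it lies in \<open>Y\<close>; hence the index has no
  prime factor besides \<open>p\<close>.\<close>

lemma p_power_subgroup_index:
  assumes p: "Factorial_Ring.prime p" and Y: "subgroup Y G" and T: "subgroup T G" and "Y \<subseteq> T"
    and *: "\<And>x. x \<in> T \<Longrightarrow> other_prime_element p x \<Longrightarrow> x \<in> Y"
  shows "\<exists>j. card T = card Y * p ^ j"
proof (rule index_prime_power[OF p card_subgroup_pos[OF T] card_dvd[OF Y T \<open>Y \<subseteq> T\<close>]])
  fix q :: nat assume q: "Factorial_Ring.prime q" "q \<noteq> p"
  obtain Q where Q: "subgroup Q G" "Q \<subseteq> T" "card Q = q ^ multiplicity q (card T)"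
    using sylow_in_subgroup[OF T q(1)] by blast
  have "Q \<subseteq> Y"
    using p_element_in_p_subgroup[OF q(1) Q(1,3)] q Q(2) * by (auto simp: other_prime_element_def)
  then show "q ^ multiplicity q (card T) dvd card Y"
    using card_dvd[OF Q(1) Y] Q(3) by simp
qed

lemma subgroup_eq_if_prime_power_elements:
  assumes Y: "subgroup Y G" and T: "subgroup T G" and "Y \<subseteq> T"
    and *: "\<And>x p. x \<in> T \<Longrightarrow> Factorial_Ring.prime p \<Longrightarrow> p_element p x \<Longrightarrow> x \<in> Y"
  shows "Y = T"
proof -
  have "\<exists>j. card T = card Y * p ^ j" if "Factorial_Ring.prime p" for p
    using * by (intro p_power_subgroup_index[OF that Y T \<open>Y \<subseteq> T\<close>]) (auto simp: other_prime_element_def)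
  \<comment> \<open>Any two distinct primes would serve: the index is a power of 2 and a power of 3,
    hence 1.\<close>
  moreover have three: "Factorial_Ring.prime (3 :: nat)" by simp
  ultimately obtain i j where ij: "card T = card Y * 2 ^ i" "card T = card Y * 3 ^ j"
    by (metis two_is_prime_nat)
  then have "(2::nat) ^ i = 3 ^ j" using card_subgroup_pos[OF Y] by simp
  then have "(2::nat) ^ i = 1"
    using coprime_prime_powers[of 2 3 "2 ^ i" i j] two_is_prime_nat three by simp
  then have "card T = card Y" using ij(1) by simp
  then show ?thesis using subgroup_eq_card[OF T \<open>Y \<subseteq> T\<close>] by simp
qed

lemma sylow_multiplicity_le:
  assumes "sylow_subgroup p G P" "subgroup T G" "card T = m * p ^ k"
  shows "p ^ k \<le> card P"
proof -
  have "p ^ k dvd order G" using card_subgroup_dvd_order[OF assms(2)] assms(3) by (metis dvd_mult_right)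
  then have "k \<le> multiplicity p (order G)"
    using order_pos sylow_prime[OF assms(1)] by (metis multiplicity_geI not_prime_unit less_irrefl)
  then show ?thesis using sylow_card[OF assms(1)] prime_ge_1_nat[OF sylow_prime[OF assms(1)]]
    by (simp add: power_increasing)
qed

lemma p_subgroup_card_le_sylow:
  assumes "sylow_subgroup p G P" "subgroup T G" "card T = p ^ k" "P \<subseteq> T" shows "T = P"
  using sylow_multiplicity_le[OF assms(1,2), of 1 k] assms subgroup_eq_card[OF assms(2), of P] by simp

text \<open>The index of \<open>Y\<close> in \<open>T\<close> is some p^j. If \<open>Y\<close> and
  \<open>P\<close> meet in order p^c, then p^(c+j) divides the order of \<open>T\<close> and so is
  at most card P, which makes \<open>Y <#> P\<close> as large as \<open>T\<close>. This is how
  products with Sylow subgroups are recognized as subgroups.\<close>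

lemma set_mult_sylow_eq:
  assumes P: "sylow_subgroup p G P" and T: "subgroup T G" and Y: "subgroup Y G" and sub: "Y \<subseteq> T" "P \<subseteq> T"
    and *: "\<And>x. x \<in> T \<Longrightarrow> other_prime_element p x \<Longrightarrow> x \<in> Y"
  shows "Y <#> P = T"
proof -
  have p: "Factorial_Ring.prime p" using sylow_prime[OF P] .
  have Psg: "subgroup P G" using sylow_subgrp[OF P] .
  obtain j where j: "card T = card Y * p ^ j" using p_power_subgroup_index[OF p Y T sub(1) *] by blast
  have Z: "subgroup (Y \<inter> P) G" using Y Psg by (rule subgroups_Inter_pair)
  have "card (Y \<inter> P) dvd card P" using card_dvd[OF Z Psg] by simp
  then obtain c where c: "card (Y \<inter> P) = p ^ c" using sylow_card[OF P] p by (auto simp: divides_primepow_nat)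
  obtain y where y: "card Y = p ^ c * y" using card_dvd[OF Z Y] c by auto
  have "p ^ (c + j) \<le> card P"
    using sylow_multiplicity_le[OF P T, of y "c + j"] j y by (simp add: power_add)
  then have "card Y * (p ^ c * p ^ j) \<le> card Y * card P" by (simp add: power_add)
  also have "\<dots> = card (Y <#> P) * p ^ c" using card_set_mult[OF Y Psg] c by simp
  finally have "card T * p ^ c \<le> card (Y <#> P) * p ^ c" using j by (simp add: ac_simps)
  then have "card T \<le> card (Y <#> P)" using prime_gt_0_nat[OF p] by simp
  moreover have "Y <#> P \<subseteq> T" using sub T by (simp add: subgroup_set_mult_subset)
  ultimately show ?thesis using T by (intro subgroup_eq_card)
qed

end

section \<open>S-permutable subgroups\<close>

context finite_group
begin

abbreviation Sp where "Sp \<equiv> S_permutable G"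

lemma Sp_subgroup: "Sp A \<Longrightarrow> subgroup A G"
  by (simp add: S_permutable_def)

lemma Sp_sylow_commute: "Sp A \<Longrightarrow> sylow_subgroup p G P \<Longrightarrow> A <#> P = P <#> A"
  by (simp add: S_permutable_def permutable_sets_def)

lemma Sp_sylow_subgroup: "Sp A \<Longrightarrow> sylow_subgroup p G P \<Longrightarrow> subgroup (A <#> P) G"
  using subgroup_set_mult_iff[OF Sp_subgroup sylow_subgrp] Sp_sylow_commute by blast

lemma SpI:
  assumes "subgroup A G" "\<And>p P. sylow_subgroup p G P \<Longrightarrow> A <#> P = P <#> A"
  shows "Sp A"
  using assms by (simp add: S_permutable_def permutable_sets_def)

lemma Sp_sylow_Int:
  assumes A: "Sp A" and P: "sylow_subgroup p G P" and Q: "sylow_subgroup q G Q" and "p \<noteq> q"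
  shows "(A <#> P) \<inter> (A <#> Q) = A"
proof -
  let ?W = "(A <#> P) \<inter> (A <#> Q)"
  have Asg: "subgroup A G" using A by (rule Sp_subgroup)
  have W: "subgroup ?W G" using Sp_sylow_subgroup[OF A P] Sp_sylow_subgroup[OF A Q] by (rule subgroups_Inter_pair)
  have AW: "A \<subseteq> ?W"
    using subset_set_mult1[OF Asg sylow_subgrp[OF P]] subset_set_mult1[OF Asg sylow_subgrp[OF Q]] by simp
  obtain w where w: "card ?W = card A * w" "w dvd card P"
    by (rule subgroup_between_index[OF Asg sylow_subgrp[OF P] W Sp_sylow_subgroup[OF A P] AW]) auto
  obtain v where v: "card ?W = card A * v" "v dvd card Q"
    by (rule subgroup_between_index[OF Asg sylow_subgrp[OF Q] W Sp_sylow_subgroup[OF A Q] AW]) auto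
  have "v = w" using w v card_subgroup_pos[OF Asg] by simp
  then have "w = 1"
    using coprime_prime_powers[OF sylow_prime[OF P] sylow_prime[OF Q] \<open>p \<noteq> q\<close>] w v
      sylow_card[OF P] sylow_card[OF Q] by metis
  then show ?thesis using subgroup_eq_card[OF W AW] w by simp
qed

lemma Sp_sylow_other_prime:
  assumes A: "Sp A" and P: "sylow_subgroup p G P" and x: "x \<in> A <#> P" "other_prime_element p x"
  shows "x \<in> A"
proof -
  obtain q where q: "Factorial_Ring.prime q" "q \<noteq> p" "p_element q x"
    using x by (auto simp: other_prime_element_def)
  obtain Q where Q: "sylow_subgroup q G Q" "x \<in> Q" using p_element_in_sylow[OF q(1,3)] by blast
  have "Q \<subseteq> A <#> Q"
    by (rule subset_set_mult2[OF Sp_subgroup[OF A] sylow_subgrp[OF Q(1)]])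
  then have "x \<in> (A <#> P) \<inter> (A <#> Q)" using x Q by blast
  then show ?thesis using Sp_sylow_Int[OF A P Q(1)] q(2) by simp
qed

text \<open>The intersection of AP and BP is a subgroup containing \<open>A \<inter> B\<close> and
  P, and its elements of order a power of another prime lie in both \<open>A\<close> and
  \<open>B\<close>. So it equals the product of \<open>A \<inter> B\<close> with P, which is
  therefore a subgroup.\<close>

lemma Sp_Int:
  assumes A: "Sp A" and B: "Sp B" shows "Sp (A \<inter> B)"
proof (rule SpI)
  have sg: "subgroup A G" "subgroup B G" using A B by (auto intro: Sp_subgroup)
  then show I: "subgroup (A \<inter> B) G" by (rule subgroups_Inter_pair)
  fix p P assume P: "sylow_subgroup p G P"
  have Psg: "subgroup P G" using P by (rule sylow_subgrp)
  let ?T = "(A <#> P) \<inter> (B <#> P)"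
  have T: "subgroup ?T G"
    using Sp_sylow_subgroup[OF A P] Sp_sylow_subgroup[OF B P] by (rule subgroups_Inter_pair)
  have "(A \<inter> B) <#> P = ?T"
  proof (rule set_mult_sylow_eq[OF P T I])
    show "A \<inter> B \<subseteq> ?T" "P \<subseteq> ?T"
      using subset_set_mult1[OF sg(1) Psg] subset_set_mult1[OF sg(2) Psg]
        subset_set_mult2[OF sg(1) Psg] subset_set_mult2[OF sg(2) Psg] by auto
    show "x \<in> A \<inter> B" if "x \<in> ?T" "other_prime_element p x" for x
      using Sp_sylow_other_prime[OF A P] Sp_sylow_other_prime[OF B P] that by blast
  qed
  then show "(A \<inter> B) <#> P = P <#> (A \<inter> B)"
    using subgroup_set_mult_iff[OF I Psg] T by simp
qed

text \<open>An element of a Sylow subgroup P is moved past a word in the members of \<open>F\<close>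
  one letter at a time; it changes at each exchange, which is why it is kept arbitrary in the
  induction. The opposite inclusion comes by taking inverses.\<close>

lemma Sp_generate_Union:
  assumes F: "\<And>A. A \<in> F \<Longrightarrow> Sp A"
  shows "Sp (generate G (\<Union>F))"
proof (rule SpI)
  let ?J = "generate G (\<Union>F)"
  have sub: "\<Union>F \<subseteq> carrier G" using F by (auto dest!: Sp_subgroup dest: subgroup.subset)
  show J: "subgroup ?J G" using generate_is_subgroup[OF sub] .
  interpret J: subgroup ?J G by fact
  fix p P assume P: "sylow_subgroup p G P"
  interpret P: subgroup P G using P by (rule sylow_subgrp)
  have swap: "x \<otimes> a \<in> ?J <#> P" if "A \<in> F" "a \<in> A" "x \<in> P" for A a x
  proof -
    have "x \<otimes> a \<in> A <#> P" using that Sp_sylow_commute[OF F P] set_multI by blast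
    also have "A <#> P \<subseteq> ?J <#> P" using that by (intro mono_set_mult) (auto intro: generate.incl)
    finally show ?thesis .
  qed
  have "x \<otimes> y \<in> ?J <#> P" if "y \<in> ?J" "x \<in> P" for x y
    using that
  proof (induction y arbitrary: x rule: generate.induct)
    case one
    then have "\<one> \<otimes> x \<in> ?J <#> P" by (intro set_multI) (auto intro: generate.one)
    then show ?case using one by simp
  next
    case (incl h) then show ?case using swap by blast
  next
    case (inv h)
    then obtain A where A: "A \<in> F" "h \<in> A" by blast
    then have "inv h \<in> A" by (intro subgroup.m_inv_closed[OF Sp_subgroup[OF F]])
    then show ?case using swap[OF A(1)] inv.prems by blast
  next
    case (eng h1 h2)
    have h: "h1 \<in> carrier G" "h2 \<in> carrier G" using eng.hyps generate_in_carrier[OF sub] by auto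
    obtain j y where j: "j \<in> ?J" "y \<in> P" "x \<otimes> h1 = j \<otimes> y"
      using eng.IH(1)[OF eng.prems] by (auto elim: set_multE)
    obtain j' y' where j': "j' \<in> ?J" "y' \<in> P" "y \<otimes> h2 = j' \<otimes> y'"
      using eng.IH(2)[OF j(2)] by (auto elim: set_multE)
    have "x \<otimes> (h1 \<otimes> h2) = j \<otimes> (y \<otimes> h2)"
      using h j eng.prems by (simp add: m_assoc[symmetric])
    also have "\<dots> = (j \<otimes> j') \<otimes> y'" using j' j by (simp add: m_assoc)
    finally show ?case using j j' by (simp add: set_multI)
  qed
  then have 1: "P <#> ?J \<subseteq> ?J <#> P" by (auto elim!: set_multE)
  have "m_inv G ` (P <#> ?J) \<subseteq> m_inv G ` (?J <#> P)" using 1 by blast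
  then have "?J <#> P \<subseteq> P <#> ?J"
    by (simp add: inv_set_mult J P.subgroup_axioms)
  with 1 show "?J <#> P = P <#> ?J" by blast
qed

lemma Sp_generate_Un: "Sp A \<Longrightarrow> Sp B \<Longrightarrow> Sp (generate G (A \<union> B))"
  using Sp_generate_Union[of "{A, B}"] by auto

lemma generate_Un_eq_set_mult:
  assumes "subgroup A G" "subgroup B G" "A <#> B = B <#> A"
  shows "generate G (A \<union> B) = A <#> B"
proof (rule sym, rule generateI)
  show "subgroup (A <#> B) G" using assms subgroup_set_mult_iff by blast
  show "A \<union> B \<subseteq> A <#> B"
    using subset_set_mult1[OF assms(1,2)] subset_set_mult2[OF assms(1,2)] by simp
  show "\<And>K. subgroup K G \<Longrightarrow> A \<union> B \<subseteq> K \<Longrightarrow> A <#> B \<subseteq> K"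
    using subgroup_set_mult_subset by auto
qed

lemma Sp_set_mult:
  assumes "Sp A" "Sp B" "A <#> B = B <#> A" shows "Sp (A <#> B)"
  using generate_Un_eq_set_mult[OF Sp_subgroup Sp_subgroup] Sp_generate_Un assms by metis

lemma Sp_normal: "N \<lhd> G \<Longrightarrow> Sp N"
  using commut_normal by (intro SpI normal_imp_subgroup) (auto dest: sylow_subgrp)

lemma Sp_cj:
  assumes A: "Sp A" and g: "g \<in> carrier G" shows "Sp (cj g ` A)"
proof (rule SpI)
  show "subgroup (cj g ` A) G" using cj_subgroup g Sp_subgroup[OF A] by blast
  fix p P assume P: "sylow_subgroup p G P"
  define Q where "Q = cj (inv g) ` P"
  have Q: "sylow_subgroup p G Q" unfolding Q_def using sylow_cj[OF P] g by simp
  have sub: "A \<subseteq> carrier G" "Q \<subseteq> carrier G" "P \<subseteq> carrier G"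
    using subgroup.subset[OF Sp_subgroup[OF A]] subgroup.subset[OF sylow_subgrp[OF P]]
      subgroup.subset[OF sylow_subgrp[OF Q]] by auto
  have "A <#> Q = Q <#> A" using A Q by (rule Sp_sylow_commute)
  then have "cj g ` (A <#> Q) = cj g ` (Q <#> A)" by simp
  moreover have "cj g ` Q = P" unfolding Q_def using g sub by (simp add: cj_image_image)
  ultimately show "cj g ` A <#> P = P <#> cj g ` A" using cj_set_mult g sub by simp
qed

text \<open>With a Sylow p-subgroup the product is the whole group by counting, and for any other
  prime the Sylow subgroups already lie in \<open>U\<close>. Applied to a normalizer in the proof of
  Kegel's theorem.\<close>

lemma Sp_if_other_prime_elements:
  assumes p: "Factorial_Ring.prime p" and U: "subgroup U G" and *: "\<And>x. other_prime_element p x \<Longrightarrow> x \<in> U"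
  shows "Sp U"
proof (rule SpI[OF U])
  fix q Q assume Q: "sylow_subgroup q G Q"
  have Qsg: "subgroup Q G" using Q by (rule sylow_subgrp)
  show "U <#> Q = Q <#> U"
  proof (cases "q = p")
    case True
    then have "U <#> Q = carrier G"
      using Q Qsg U * by (intro set_mult_sylow_eq[OF _ subgroup_self U]) (auto dest: subgroup.subset)
    then show ?thesis using subgroup_set_mult_iff[OF U Qsg] subgroup_self by simp
  next
    case False
    then have "Q \<subseteq> U" using * sylow_p_element[OF Q] sylow_prime[OF Q] by (auto simp: other_prime_element_def)
    then show ?thesis using set_mult_absorb_left set_mult_absorb_right U Qsg by metis
  qed
qed

text \<open>A Sylow subgroup Q of \<open>T\<close> is the trace on \<open>T\<close> of a Sylow
  subgroup S of the whole group, and Dedekind's law turns the intersection of AS with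
  \<open>T\<close> into AQ.\<close>

lemma Sp_in_subgroup:
  assumes A: "Sp A" and T: "subgroup T G" and sub: "A \<subseteq> T"
  shows "S_permutable (G\<lparr>carrier := T\<rparr>) A"
proof -
  interpret T: finite_group "G\<lparr>carrier := T\<rparr>" by (rule finite_group_subgroup[OF T])
  have Asg: "subgroup A G" using A by (rule Sp_subgroup)
  show ?thesis
  proof (rule T.SpI)
    show "subgroup A (G\<lparr>carrier := T\<rparr>)" using Asg T sub by (simp add: subgroup_incl)
    fix p Q assume Q: "sylow_subgroup p (G\<lparr>carrier := T\<rparr>) Q"
    have QT: "Q \<subseteq> T" using subgroup.subset[OF T.sylow_subgrp[OF Q]] by simp
    have Qsg: "subgroup Q G" using incl_subgroup[OF T T.sylow_subgrp[OF Q]] .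
    obtain S where S: "sylow_subgroup p G S" "Q \<subseteq> S"
      using p_subgroup_in_sylow[OF T.sylow_prime[OF Q] Qsg T.sylow_card[OF Q]] by blast
    have Ssg: "subgroup S G" using S(1) by (rule sylow_subgrp)
    have STsg: "subgroup (S \<inter> T) G" using Ssg T by (rule subgroups_Inter_pair)
    have "card (S \<inter> T) dvd card S" using card_dvd[OF STsg Ssg] by simp
    then obtain k where "card (S \<inter> T) = p ^ k"
      using sylow_card[OF S(1)] sylow_prime[OF S(1)] by (auto simp: divides_primepow_nat)
    then have "S \<inter> T = Q"
      using S(2) QT STsg T by (intro T.p_subgroup_card_le_sylow[OF Q]) (auto simp: subgroup_incl)
    then have "(A <#> S) \<inter> T = A <#> Q"
      using dedekind_right[OF T sub] Asg Ssg by (simp add: subgroup.subset)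
    moreover have "subgroup ((A <#> S) \<inter> T) G"
      using Sp_sylow_subgroup[OF A S(1)] T by (rule subgroups_Inter_pair)
    ultimately have "A <#> Q = Q <#> A" using subgroup_set_mult_iff[OF Asg Qsg] by simp
    then show "A <#>\<^bsub>G\<lparr>carrier := T\<rparr>\<^esub> Q = Q <#>\<^bsub>G\<lparr>carrier := T\<rparr>\<^esub> A" by simp
  qed
qed

section \<open>The residual O^p(A) (\<open>other_prime_part\<close>), Sylow spans and hulls, Kegel's
  theorem\<close>

definition other_prime_part :: "nat \<Rightarrow> 'a set \<Rightarrow> 'a set" where
  "other_prime_part p A = generate G {x \<in> A. other_prime_element p x}"

text \<open>This is the normal closure of a Sylow p-subgroup, usually written O^{p'}(G).\<close>

definition sylow_span :: "nat \<Rightarrow> 'a set" where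
  "sylow_span p = generate G (\<Union>{P. sylow_subgroup p G P})"

text \<open>A generalization of O_p(G), which is the hull of the trivial subgroup. It contains
  \<open>A\<close> but, as AP = O^p(A)P, it depends on \<open>A\<close> only through O^p(A), and so
  it is normalized by whatever normalizes O^p(A).\<close>

definition sylow_hull :: "nat \<Rightarrow> 'a set \<Rightarrow> 'a set" where
  "sylow_hull p A = \<Inter>{A <#> P | P. sylow_subgroup p G P}"

lemma other_prime_part_subgroup: "subgroup A G \<Longrightarrow> subgroup (other_prime_part p A) G"
  unfolding other_prime_part_def by (intro generate_is_subgroup) (auto dest: subgroup.subset)

lemma other_prime_part_subset: "subgroup A G \<Longrightarrow> other_prime_part p A \<subseteq> A"
  unfolding other_prime_part_def by (intro generate_subgroup_incl) auto

lemma other_prime_part_incl: "x \<in> A \<Longrightarrow> other_prime_element p x \<Longrightarrow> x \<in> other_prime_part p A"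
  unfolding other_prime_part_def by (intro generate.incl) auto

lemma other_prime_part_cj:
  assumes A: "subgroup A G" and g: "g \<in> carrier G" "cj g ` A = A"
  shows "cj g ` other_prime_part p A = other_prime_part p A"
proof -
  let ?S = "{x \<in> A. other_prime_element p x}"
  have "cj g ` ?S = ?S"
  proof
    show "cj g ` ?S \<subseteq> ?S" using g by (auto simp: other_prime_element_cj)
    show "?S \<subseteq> cj g ` ?S"
    proof
      fix x assume x: "x \<in> ?S"
      then obtain y where y: "y \<in> A" "x = cj g y" using g(2) by blast
      then have yG: "y \<in> carrier G" using A by (simp add: subgroup.mem_carrier)
      then have "y = cj (inv g) x" using g y by simp
      then have "other_prime_element p y" using x g other_prime_element_cj inv_closed by blast
      then show "x \<in> cj g ` ?S" using y by blast
    qed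
  qed
  moreover have "?S \<subseteq> carrier G" using subgroup.subset[OF A] by blast
  ultimately show ?thesis
    unfolding other_prime_part_def using group_hom.generate_img[OF cj_hom[OF g(1)]] by metis
qed

text \<open>AP and \<open>A\<close> contain the same elements of order a power of a prime other than
  p. So O^p(A), which they generate, is invariant under conjugation by AP, in particular by every
  Sylow p-subgroup; \<open>A\<close> itself may lack this invariance.\<close>

lemma other_prime_part_set_mult_sylow:
  assumes A: "Sp A" and P: "sylow_subgroup p G P"
  shows "other_prime_part p (A <#> P) = other_prime_part p A"
proof -
  have "A \<subseteq> A <#> P"
    by (rule subset_set_mult1[OF Sp_subgroup[OF A] sylow_subgrp[OF P]])
  then have "{x \<in> A <#> P. other_prime_element p x} = {x \<in> A. other_prime_element p x}"
    using Sp_sylow_other_prime[OF A P] by blast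
  then show ?thesis unfolding other_prime_part_def by simp
qed

lemma other_prime_part_cj_sylow:
  assumes A: "Sp A" and P: "sylow_subgroup p G P" and g: "g \<in> A <#> P"
  shows "cj g ` other_prime_part p A = other_prime_part p A"
proof -
  note T = Sp_sylow_subgroup[OF A P]
  have "cj g ` other_prime_part p (A <#> P) = other_prime_part p (A <#> P)"
    using subgroup.mem_carrier[OF T g] cj_image_eq_self[OF T g] by (rule other_prime_part_cj[OF T])
  then show ?thesis by (simp only: other_prime_part_set_mult_sylow[OF A P])
qed

text \<open>The index of O^p(A) in AP is a power of p, because all elements of AP of other prime
  power orders lie in O^p(A).\<close>

lemma set_mult_sylow_other_prime_part:
  assumes A: "Sp A" and P: "sylow_subgroup p G P"
  shows "other_prime_part p A <#> P = A <#> P"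
proof (rule set_mult_sylow_eq[OF P Sp_sylow_subgroup[OF A P]])
  have Asg: "subgroup A G" using A by (rule Sp_subgroup)
  show "subgroup (other_prime_part p A) G" using Asg by (rule other_prime_part_subgroup)
  show "other_prime_part p A \<subseteq> A <#> P"
    using other_prime_part_subset[OF Asg] subset_set_mult1[OF Asg sylow_subgrp[OF P]] by (rule subset_trans)
  show "P \<subseteq> A <#> P"
    by (rule subset_set_mult2[OF Asg sylow_subgrp[OF P]])
  show "\<And>x. x \<in> A <#> P \<Longrightarrow> other_prime_element p x \<Longrightarrow> x \<in> other_prime_part p A"
    using Sp_sylow_other_prime[OF A P] other_prime_part_incl by blast
qed

lemma sylow_Union_carrier: "\<Union>{P. sylow_subgroup p G P} \<subseteq> carrier G"
  by (auto dest!: sylow_subgrp dest: subgroup.subset)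

lemma sylow_span_subset:
  assumes "subgroup N G" "\<And>P. sylow_subgroup p G P \<Longrightarrow> P \<subseteq> N"
  shows "sylow_span p \<subseteq> N"
  unfolding sylow_span_def using assms by (intro generate_subgroup_incl) auto

lemma sylow_subset_span: "sylow_subgroup p G P \<Longrightarrow> P \<subseteq> sylow_span p"
  unfolding sylow_span_def by (auto intro: generate.incl)

lemma sylow_span_normal: "sylow_span p \<lhd> G"
  unfolding sylow_span_def
proof (rule normal_generateI[OF sylow_Union_carrier])
  fix h g assume h: "h \<in> \<Union>{P. sylow_subgroup p G P}" and g: "g \<in> carrier G"
  then obtain P where "sylow_subgroup p G P" "h \<in> P" by blast
  then have "sylow_subgroup p G (cj g ` P)" "cj g h \<in> cj g ` P" using sylow_cj g by auto
  then show "g \<otimes> h \<otimes> inv g \<in> \<Union>{P. sylow_subgroup p G P}"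
    unfolding conj_by_def by blast
qed

lemma other_prime_part_cj_span:
  assumes A: "Sp A" and g: "g \<in> sylow_span p"
  shows "cj g ` other_prime_part p A = other_prime_part p A"
proof -
  let ?Y = "other_prime_part p A"
  have Y: "subgroup ?Y G" using A by (intro other_prime_part_subgroup Sp_subgroup)
  have "sylow_span p \<subseteq> {g \<in> carrier G. cj g ` ?Y = ?Y}"
  proof (rule sylow_span_subset)
    show "subgroup {g \<in> carrier G. cj g ` ?Y = ?Y} G"
      using Y subgroup_finite by (intro cj_normalizer_subgroup) (auto dest: subgroup.subset)
    fix P assume P: "sylow_subgroup p G P"
    have "P \<subseteq> A <#> P"
      by (rule subset_set_mult2[OF Sp_subgroup[OF A] sylow_subgrp[OF P]])
    then show "P \<subseteq> {g \<in> carrier G. cj g ` ?Y = ?Y}"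
      using other_prime_part_cj_sylow[OF A P] subgroup.mem_carrier[OF sylow_subgrp[OF P]] by blast
  qed
  then show ?thesis using g by blast
qed

lemma subset_sylow_hull:
  assumes "subgroup A G" shows "A \<subseteq> sylow_hull p A"
  unfolding sylow_hull_def
  using subset_set_mult1[OF assms sylow_subgrp] by blast

lemma sylow_hull_cj:
  assumes A: "Sp A" and g: "g \<in> carrier G" "cj g ` other_prime_part p A = other_prime_part p A"
    and z: "z \<in> sylow_hull p A"
  shows "cj g z \<in> sylow_hull p A"
  unfolding sylow_hull_def
proof (clarify)
  fix P assume P: "sylow_subgroup p G P"
  define Q where "Q = cj (inv g) ` P"
  have Q: "sylow_subgroup p G Q" unfolding Q_def using sylow_cj[OF P] g by simp
  have sub: "other_prime_part p A \<subseteq> carrier G" "Q \<subseteq> carrier G" "P \<subseteq> carrier G"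
    using subgroup.subset[OF other_prime_part_subgroup[OF Sp_subgroup[OF A]]] sylow_subgrp[OF P] sylow_subgrp[OF Q]
    by (auto dest: subgroup.subset)
  have "z \<in> A <#> Q" using z Q by (auto simp: sylow_hull_def)
  then have "z \<in> other_prime_part p A <#> Q" using set_mult_sylow_other_prime_part[OF A Q] by simp
  then have "cj g z \<in> cj g ` (other_prime_part p A <#> Q)" by blast
  also have "\<dots> = other_prime_part p A <#> P"
    using cj_set_mult[OF g(1) sub(1,2)] g sub by (simp add: Q_def cj_image_image)
  finally show "cj g z \<in> A <#> P" using set_mult_sylow_other_prime_part[OF A P] by simp
qed

lemma sylow_hull_subgroup:
  assumes A: "Sp A" and p: "Factorial_Ring.prime p" shows "subgroup (sylow_hull p A) G"
  unfolding sylow_hull_def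
  using sylow_exists[OF p] by (intro subgroups_Inter) (auto intro: Sp_sylow_subgroup[OF A])

text \<open>The induction climbs: a proper S-permutable subgroup strictly above \<open>A\<close> may
  replace \<open>A\<close>. If the product of \<open>A\<close> with the span of the Sylow
  p-subgroups is not such a subgroup, it is the whole group, and O^p(A), normalized by both factors,
  is normal in \<open>G\<close>. Then the hull of \<open>A\<close> is normal, and it is proper
  unless AP is the whole group. In that last case the index of O^p(A) is a power of p, so the
  normalizer of \<open>A\<close> lies strictly above \<open>A\<close>, and it is
  S-permutable.\<close>

theorem Sp_in_proper_normal:
  assumes "Sp A" "A \<noteq> carrier G"
  shows "\<exists>N. N \<lhd> G \<and> A \<subseteq> N \<and> N \<noteq> carrier G"
  using assms
proof (induction "order G - card A" arbitrary: A rule: less_induct)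
  case less
  note A = less.prems(1)
  have Asg: "subgroup A G" using A by (rule Sp_subgroup)
  have bigger: ?case if B: "Sp B" "A \<subseteq> B" "B \<noteq> A" "B \<noteq> carrier G" for B
  proof -
    have "card A < card B"
      using B Sp_subgroup[OF B(1)] subgroup_finite by (intro psubset_card_mono) auto
    moreover have "card B \<le> order G"
      using card_mono[OF fin subgroup.subset[OF Sp_subgroup[OF B(1)]]] by (simp add: order_def)
    ultimately have "order G - card B < order G - card A" by simp
    then show ?case using less.hyps B by blast
  qed
  \<comment> \<open>The prime is chosen so that some p-element lies outside \<open>A\<close>; this
    makes the product with the span strictly larger than \<open>A\<close>.\<close>
  obtain x p where xp: "x \<in> carrier G" "Factorial_Ring.prime p" "p_element p x" "x \<notin> A"
    using subgroup_eq_if_prime_power_elements[OF Asg subgroup_self] less.prems(2) subgroup.subset[OF Asg] by blast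
  let ?X = "sylow_span p" and ?Y = "other_prime_part p A"
  have X: "?X \<lhd> G" by (rule sylow_span_normal)
  have Xsg: "subgroup ?X G" using X by (rule normal_imp_subgroup)
  have "x \<in> ?X" using p_element_in_sylow[OF xp(2,3)] sylow_subset_span by blast
  then have xAX: "x \<in> A <#> ?X" using subset_set_mult2[OF Asg Xsg] by blast
  have AX: "Sp (A <#> ?X)" using A Sp_normal[OF X] commut_normal[OF Asg X] by (rule Sp_set_mult)
  show ?case
  proof (cases "A <#> ?X = carrier G")
    case False
    then show ?thesis
      using bigger[OF AX] subset_set_mult1[OF Asg Xsg] xAX xp(4) by blast
  next
    case True
    have Ysg: "subgroup ?Y G" using Asg by (rule other_prime_part_subgroup)
    let ?N = "{g \<in> carrier G. cj g ` ?Y = ?Y}"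
    have Nsg: "subgroup ?N G"
      using Ysg subgroup_finite by (intro cj_normalizer_subgroup) (auto dest: subgroup.subset)
    have "A \<subseteq> ?N"
      using other_prime_part_cj[OF Asg] cj_image_eq_self[OF Asg] subgroup.mem_carrier[OF Asg] by blast
    moreover have "?X \<subseteq> ?N" using other_prime_part_cj_span[OF A] subgroup.mem_carrier[OF Xsg] by blast
    ultimately have "A <#> ?X \<subseteq> ?N" using Nsg by (intro subgroup_set_mult_subset)
    then have stable: "cj g ` ?Y = ?Y" if "g \<in> carrier G" for g using that True by blast
    then have Y: "?Y \<lhd> G" using Ysg by (auto simp: normal_cj_iff)
    obtain P where P: "sylow_subgroup p G P" using sylow_exists[OF xp(2)] by blast
    show ?thesis
    proof (cases "A <#> P = carrier G")
      case False
      have "sylow_hull p A \<lhd> G"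
        using sylow_hull_subgroup[OF A xp(2)] sylow_hull_cj[OF A] stable by (auto simp: normal_cj_iff)
      moreover have "sylow_hull p A \<subseteq> A <#> P" using P by (auto simp: sylow_hull_def)
      moreover have "A <#> P \<subseteq> carrier G" using Sp_sylow_subgroup[OF A P] by (rule subgroup.subset)
      ultimately show ?thesis using False subset_sylow_hull[OF Asg] by blast
    next
      case True
      have op: "z \<in> A" if "other_prime_element p z" for z
        using Sp_sylow_other_prime[OF A P] True that other_prime_element_carrier by blast
      then obtain j where j: "order G = card ?Y * p ^ j"
        using p_power_subgroup_index[OF xp(2) Ysg subgroup_self] subgroup.subset[OF Ysg] other_prime_part_incl
        unfolding order_def by blast
      obtain y where y: "y \<in> carrier G" "y \<notin> A" "cj y ` A = A"
        using normalizer_growth[OF xp(2) Y Asg other_prime_part_subset[OF Asg] less.prems(2) j] by blast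
      let ?M = "{g \<in> carrier G. cj g ` A = A}"
      have M: "subgroup ?M G" using Asg subgroup_finite by (intro cj_normalizer_subgroup) (auto dest: subgroup.subset)
      have AM: "A \<subseteq> ?M" using cj_image_eq_self[OF Asg] subgroup.mem_carrier[OF Asg] by blast
      have SM: "Sp ?M" using op AM by (intro Sp_if_other_prime_elements[OF xp(2) M]) blast
      show ?thesis
      proof (cases "?M = carrier G")
        case True
        then have "A \<lhd> G" using Asg by (auto simp: normal_cj_iff)
        then show ?thesis using less.prems(2) by blast
      next
        case False
        then show ?thesis using bigger[OF SM AM] y by blast
      qed
    qed
  qed
qed

end

section \<open>Core-free S-permutable subgroups\<close>

context group
begin

lemma subgroup_Collect_cj:
  assumes A: "subgroup A G" and S: "S \<subseteq> carrier G"
  shows "subgroup {a \<in> A. \<forall>g\<in>S. cj g a \<in> A} G"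
proof (rule subgroupI)
  interpret A: subgroup A G by fact
  show "{a \<in> A. \<forall>g\<in>S. cj g a \<in> A} \<subseteq> carrier G" by auto
  show "{a \<in> A. \<forall>g\<in>S. cj g a \<in> A} \<noteq> {}" using S by (auto intro!: exI[of _ \<one>])
  show "\<And>a. a \<in> {a \<in> A. \<forall>g\<in>S. cj g a \<in> A} \<Longrightarrow> inv a \<in> {a \<in> A. \<forall>g\<in>S. cj g a \<in> A}"
    using S by (auto simp: cj_inv subset_iff)
  show "\<And>a b. a \<in> {a \<in> A. \<forall>g\<in>S. cj g a \<in> A} \<Longrightarrow> b \<in> {a \<in> A. \<forall>g\<in>S. cj g a \<in> A} \<Longrightarrow>
    a \<otimes> b \<in> {a \<in> A. \<forall>g\<in>S. cj g a \<in> A}"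
    using S by (auto simp: cj_mult subset_iff)
qed

lemma cj_image_eqI:
  assumes "g \<in> carrier G" "E \<subseteq> carrier G" "finite E" "cj g ` E \<subseteq> E"
  shows "cj g ` E = E"
  using assms inj_cj[OF assms(1)] by (meson endo_inj_surj inj_on_subset)

end

context finite_group
begin

text \<open>The p-elements of \<open>A\<close> are shown to form a subgroup V of p-power order,
  which is then found inside every Sylow p-subgroup by comparing orders. A nontrivial element of V
  of another prime power order would lie in a normal subgroup of \<open>G\<close> inside
  \<open>A\<close>, against \<open>core\<close>.\<close>

lemma core_free_Sp_p_element:
  assumes A: "Sp A"
    and core: "\<And>x. x \<in> A \<Longrightarrow> (\<And>g. g \<in> carrier G \<Longrightarrow> cj g x \<in> A) \<Longrightarrow> x = \<one>"
    and x: "p_element p x" "x \<in> A" and P: "sylow_subgroup p G P"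
  shows "x \<in> P"
proof -
  have p: "Factorial_Ring.prime p" using P by (rule sylow_prime)
  have Asg: "subgroup A G" using A by (rule Sp_subgroup)
  interpret A: subgroup A G by fact
  have span: "sylow_span r \<subseteq> carrier G" for r
    using normal_imp_subgroup[OF sylow_span_normal] by (rule subgroup.subset)
  \<comment> \<open>\<open>E\<close> is the intersection of the cores of \<open>A\<close> with respect to the normal subgroups generated by
    the Sylow subgroups for one prime; it is normal in \<open>G\<close> because the hulls of \<open>A\<close> for two
    different primes meet in \<open>A\<close>.\<close>
  define C where "C = (\<lambda>r. {a \<in> A. \<forall>g\<in>sylow_span r. cj g a \<in> A})"
  have C: "subgroup (C r) G" for r
    unfolding C_def using subgroup_Collect_cj[OF Asg span] .
  \<comment> \<open>O^r(A) is normalized by the span for r, so its generators stay in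
    \<open>A\<close> under all these conjugations.\<close>
  have other: "a \<in> C r" if "a \<in> A" "other_prime_element r a" for a r
  proof -
    have a: "a \<in> other_prime_part r A" using that by (rule other_prime_part_incl)
    then have "cj g a \<in> other_prime_part r A" if "g \<in> sylow_span r" for g
      using other_prime_part_cj_span[OF A that] by blast
    then show ?thesis using other_prime_part_subset[OF Asg] \<open>a \<in> A\<close> by (auto simp: C_def)
  qed
  define E where "E = {a \<in> A. \<forall>r. Factorial_Ring.prime r \<longrightarrow> a \<in> C r}"
  have EA: "E \<subseteq> A" and EG: "E \<subseteq> carrier G" by (auto simp: E_def)
  have Efin: "finite E" using finite_subset[OF EG fin] .
  have step: "cj u e \<in> E" if e: "e \<in> E" and s: "Factorial_Ring.prime s" "u \<in> sylow_span s" for e s u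
  proof -
    have eG: "e \<in> carrier G" and uG: "u \<in> carrier G" using e EG s span by auto
    have uA: "cj u e \<in> A" using e s by (auto simp: E_def C_def)
    have "cj y (cj u e) \<in> A" if q: "Factorial_Ring.prime q" and y: "y \<in> sylow_span q" for q y
    proof (cases "q = s")
      case True
      then have "y \<otimes> u \<in> sylow_span s"
        using y s normal_imp_subgroup[OF sylow_span_normal] by (simp add: subgroup.m_closed)
      then have "cj (y \<otimes> u) e \<in> A" using e s by (auto simp: E_def C_def)
      then show ?thesis using y span uG eG by (subst cj_cj) auto
    next
      case False
      have yG: "y \<in> carrier G" using y span by blast
      have "cj u e \<in> sylow_hull q A" using uA subset_sylow_hull[OF Asg] by blast
      then have 1: "cj y (cj u e) \<in> sylow_hull q A"
        using sylow_hull_cj[OF A yG other_prime_part_cj_span[OF A y]] by blast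
      \<comment> \<open>Since yu = uy' with y' again in the span for q, the element is the
        y-conjugate of one element of \<open>A\<close> and the u-conjugate of another; so it lies in
        the hulls of \<open>A\<close> for q and for s.\<close>
      define y' where "y' = cj (inv u) y"
      have "y' \<in> sylow_span q"
        using sylow_span_normal uG y by (auto simp: normal_cj_iff y'_def)
      then have y': "cj y' e \<in> A" "y' \<in> carrier G" using e q span by (auto simp: E_def C_def)
      then have "cj y' e \<in> sylow_hull s A" using subset_sylow_hull[OF Asg] by blast
      then have "cj u (cj y' e) \<in> sylow_hull s A"
        using sylow_hull_cj[OF A uG other_prime_part_cj_span[OF A s(2)]] by blast
      moreover have "cj u (cj y' e) = cj y (cj u e)"
        using uG eG yG y' by (simp add: cj_cj y'_def) (simp add: conj_by_def m_assoc)
      ultimately have 2: "cj y (cj u e) \<in> sylow_hull s A" by simp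
      obtain Q S where QS: "sylow_subgroup q G Q" "sylow_subgroup s G S"
        using sylow_exists q s by blast
      then have "cj y (cj u e) \<in> (A <#> Q) \<inter> (A <#> S)"
        using 1 2 unfolding sylow_hull_def by blast
      then show ?thesis using Sp_sylow_Int[OF A QS] False by simp
    qed
    then show ?thesis using uA by (auto simp: E_def C_def)
  qed
  let ?S = "{g \<in> carrier G. cj g ` E = E}"
  have "?S = carrier G"
  proof (rule subgroup_eq_if_prime_power_elements[OF _ subgroup_self])
    show "subgroup ?S G" using cj_normalizer_subgroup[OF EG Efin] .
    fix g r assume g: "g \<in> carrier G" "Factorial_Ring.prime r" "p_element r g"
    then have "g \<in> sylow_span r" using p_element_in_sylow[OF g(2,3)] sylow_subset_span by blast
    then have "cj g ` E \<subseteq> E" using step[OF _ g(2)] by blast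
    then show "g \<in> ?S" using cj_image_eqI[OF g(1) EG Efin] g(1) by simp
  qed auto
  then have E1: "e = \<one>" if "e \<in> E" for e
    using that EA by (intro core) blast+
  \<comment> \<open>Dropping the condition at p keeps all p-elements of \<open>A\<close>, by
    \<open>other\<close> for r different from p, while an element of V of another prime power order
    satisfies the condition at p as well and so lies in E.\<close>
  define V where "V = {a \<in> A. \<forall>r. Factorial_Ring.prime r \<longrightarrow> r \<noteq> p \<longrightarrow> a \<in> C r}"
  have V: "subgroup V G"
  proof (rule subgroupI)
    show "V \<subseteq> carrier G" by (auto simp: V_def)
    show "V \<noteq> {}" using C by (auto simp: V_def subgroup.one_closed intro!: exI[of _ \<one>])
    show "\<And>a. a \<in> V \<Longrightarrow> inv a \<in> V" using C by (auto simp: V_def subgroup.m_inv_closed)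
    show "\<And>a b. a \<in> V \<Longrightarrow> b \<in> V \<Longrightarrow> a \<otimes> b \<in> V" using C by (auto simp: V_def subgroup.m_closed)
  qed
  have "y = \<one>" if "y \<in> V" "other_prime_element p y" for y
    using that other[of y p] by (intro E1) (auto simp: V_def E_def)
  then obtain j where "card V = card {\<one>} * p ^ j"
    using p_power_subgroup_index[OF p triv_subgroup V] subgroup.one_closed[OF V] by blast
  then have j: "card V = p ^ j" by simp
  have pV: "a \<in> V" if "a \<in> A" "p_element p a" for a
  proof -
    have "other_prime_element r a" if "r \<noteq> p" for r
      using that \<open>p_element p a\<close> p unfolding other_prime_element_def by blast
    then show ?thesis using other \<open>a \<in> A\<close> by (simp add: V_def)
  qed
  have VA: "V \<subseteq> A" by (auto simp: V_def)
  have Psg: "subgroup P G" using P by (rule sylow_subgrp)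
  have I: "subgroup (A \<inter> P) G" using Asg Psg by (rule subgroups_Inter_pair)
  have "A \<inter> P \<subseteq> V" using pV sylow_p_element[OF P] by blast
  moreover have "card V \<le> card (A \<inter> P)"
  proof -
    obtain n where n: "card P = p ^ n" using sylow_card[OF P] by blast
    have "card (A \<inter> P) dvd p ^ n" using card_dvd[OF I Psg] n by simp
    then obtain i where i: "card (A \<inter> P) = p ^ i" using p by (auto simp: divides_primepow_nat)
    obtain m where m: "card A = p ^ j * m" using card_dvd[OF V Asg VA] j by auto
    \<comment> \<open>Otherwise the order of AP, which is card A times card P divided by p^i, would
      be divisible by a higher power of p than card P.\<close>
    have "j \<le> i"
    proof (rule ccontr)
      assume "\<not> j \<le> i"
      then have "j = i + Suc (j - Suc i)" by simp
      then have pj: "p ^ j = p ^ i * p ^ Suc (j - Suc i)" by (metis power_add)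
      have "card (A <#> P) * p ^ i = p ^ j * m * p ^ n"
        using card_set_mult[OF Asg Psg] i m n by simp
      also have "\<dots> = m * p ^ (n + Suc (j - Suc i)) * p ^ i"
        unfolding pj power_add by (simp add: ac_simps)
      finally have "card (A <#> P) = m * p ^ (n + Suc (j - Suc i))"
        using prime_gt_0_nat[OF p] by simp
      then have "p ^ (n + Suc (j - Suc i)) \<le> p ^ n"
        using sylow_multiplicity_le[OF P Sp_sylow_subgroup[OF A P]] n by metis
      then have "n + Suc (j - Suc i) \<le> n" using prime_gt_1_nat[OF p] by (rule power_le_imp_le_exp[rotated])
      then show False by simp
    qed
    then show ?thesis using i j prime_ge_1_nat[OF p] by (simp add: power_increasing)
  qed
  ultimately have "A \<inter> P = V" by (rule subgroup_eq_card[OF V])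
  then show ?thesis using pV x by blast
qed

section \<open>O_p(G) (\<open>sylow_core\<close>), O^p(G), and Schmid's description of S-permutable
  p-subgroups\<close>

definition sylow_core :: "nat \<Rightarrow> 'a set" where
  "sylow_core p = \<Inter>{P. sylow_subgroup p G P}"

lemma sylow_core_subset: "sylow_subgroup p G P \<Longrightarrow> sylow_core p \<subseteq> P"
  by (auto simp: sylow_core_def)

lemma sylow_core_subgroup: "Factorial_Ring.prime p \<Longrightarrow> subgroup (sylow_core p) G"
  unfolding sylow_core_def using sylow_exists sylow_subgrp by (intro subgroups_Inter) auto

lemma sylow_core_normal:
  assumes "Factorial_Ring.prime p" shows "sylow_core p \<lhd> G"
proof -
  have "cj g x \<in> P" if g: "g \<in> carrier G" and x: "x \<in> sylow_core p" and P: "sylow_subgroup p G P" for g x P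
  proof -
    have "x \<in> cj (inv g) ` P" using x sylow_cj[OF P inv_closed[OF g]] sylow_core_subset by blast
    then show ?thesis using g subgroup.mem_carrier[OF sylow_subgrp[OF P]] by auto
  qed
  then show ?thesis
    using sylow_core_subgroup[OF assms] unfolding normal_cj_iff by (auto simp: sylow_core_def)
qed

lemma sylow_core_p_element: "Factorial_Ring.prime p \<Longrightarrow> x \<in> sylow_core p \<Longrightarrow> p_element p x"
  using sylow_exists sylow_core_subset sylow_p_element by blast

lemma order_FactGroup:
  assumes "N \<lhd> G" shows "order G = card N * order (G Mod N)"
  using lagrange[OF normal_imp_subgroup[OF assms]] by (simp add: order_def FactGroup_def mult.commute)

lemma p_group_FactGroup_iff:
  assumes "N \<lhd> G" shows "p_group p (G Mod N) \<longleftrightarrow> (\<exists>n. order G = card N * p ^ n)"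
  using order_FactGroup[OF assms] card_subgroup_pos[OF normal_imp_subgroup[OF assms]]
    normal.factorgroup_is_group[OF assms]
  by (auto simp: p_group_def)

lemma other_prime_part_carrier_normal: "other_prime_part p (carrier G) \<lhd> G"
  unfolding other_prime_part_def
proof (rule normal_generateI)
  show "\<And>h g. h \<in> {x \<in> carrier G. other_prime_element p x} \<Longrightarrow> g \<in> carrier G \<Longrightarrow>
    g \<otimes> h \<otimes> inv g \<in> {x \<in> carrier G. other_prime_element p x}"
    using other_prime_element_cj[unfolded conj_by_def] by auto
qed auto

text \<open>Replaces the least element by generators, so that invariance under O^p(G) can be checked
  on elements of prime power order. For minimality: if G/N is a p-group and Q is a Sylow q-subgroup
  with q different from p, the index of N in NQ divides both a power of p and a power of q, so Q
  lies in N.\<close>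

lemma p_residual_eq:
  assumes p: "Factorial_Ring.prime p"
  shows "p_residual p G = other_prime_part p (carrier G)"
  unfolding p_residual_def
proof (rule Least_equality)
  let ?R = "other_prime_part p (carrier G)"
  have "\<exists>n. order G = card ?R * p ^ n"
    unfolding order_def using other_prime_part_subset[OF subgroup_self] other_prime_part_incl
    by (intro p_power_subgroup_index[OF p other_prime_part_subgroup[OF subgroup_self] subgroup_self]) auto
  then show "?R \<lhd> G \<and> p_group p (G Mod ?R)"
    using other_prime_part_carrier_normal p_group_FactGroup_iff by blast
next
  fix N assume "N \<lhd> G \<and> p_group p (G Mod N)"
  then have N: "N \<lhd> G" and "\<exists>n. order G = card N * p ^ n" using p_group_FactGroup_iff by auto
  then obtain n where n: "order G = card N * p ^ n" by blast
  have Nsg: "subgroup N G" using N by (rule normal_imp_subgroup)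
  have "x \<in> N" if x: "other_prime_element p x" for x
  proof -
    obtain q where q: "Factorial_Ring.prime q" "q \<noteq> p" "p_element q x"
      using x by (auto simp: other_prime_element_def)
    obtain Q where Q: "sylow_subgroup q G Q" "x \<in> Q" using p_element_in_sylow[OF q(1,3)] by blast
    have W: "subgroup (N <#> Q) G" using Sp_sylow_subgroup[OF Sp_normal[OF N] Q(1)] .
    have NW: "N \<subseteq> N <#> Q" using subset_set_mult1[OF Nsg sylow_subgrp[OF Q(1)]] .
    obtain w where w: "card (N <#> Q) = card N * w" "w dvd card Q"
      by (rule subgroup_between_index[OF Nsg sylow_subgrp[OF Q(1)] W W NW]) auto
    have "w dvd p ^ n"
      using card_subgroup_dvd_order[OF W] n w(1) card_subgroup_pos[OF Nsg] by simp
    then have "w = 1"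
      using coprime_prime_powers[OF p q(1) q(2)[symmetric]] w(2) sylow_card[OF Q(1)] by metis
    then have "N <#> Q = N" using subgroup_eq_card[OF W NW] w by simp
    then show ?thesis using subset_set_mult2[OF Nsg sylow_subgrp[OF Q(1)]] Q(2) by blast
  qed
  then show "other_prime_part p (carrier G) \<le> N"
    unfolding other_prime_part_def by (intro generate_subgroup_incl Nsg) auto
qed

lemma p_residual_carrier: "Factorial_Ring.prime p \<Longrightarrow> p_residual p G \<subseteq> carrier G"
  using p_residual_eq other_prime_part_subset[OF subgroup_self] by simp

lemma p_residual_subgroup: "Factorial_Ring.prime p \<Longrightarrow> subgroup (p_residual p G) G"
  using p_residual_eq other_prime_part_subgroup[OF subgroup_self] by simp

lemma Sp_p_subgroups_iff':
  "A \<in> S_permutable_p_subgroups p G \<longleftrightarrow> Sp A \<and> (\<exists>n. card A = p ^ n)"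
  using subgroup_imp_group by (auto simp: S_permutable_p_subgroups_def p_group_def order_def dest: Sp_subgroup)

text \<open>AP has order a power of p, so it is no larger than the Sylow subgroup
  \<open>P\<close>.\<close>

lemma p_subgroup_subset_sylow_core:
  assumes A: "Sp A" and n: "card A = p ^ n" and P: "sylow_subgroup p G P"
  shows "A \<subseteq> P"
proof -
  have sg: "subgroup A G" "subgroup P G" using Sp_subgroup[OF A] sylow_subgrp[OF P] by auto
  obtain m where "card P = p ^ m" using sylow_card[OF P] by blast
  then have "card (A <#> P) * card (A \<inter> P) = p ^ (n + m)"
    using card_set_mult[OF sg] n by (simp add: power_add)
  then have "card (A <#> P) dvd p ^ (n + m)" by (metis dvd_triv_left)
  then obtain k where "card (A <#> P) = p ^ k" using sylow_prime[OF P] by (auto simp: divides_primepow_nat)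
  then have "A <#> P = P"
    using p_subgroup_card_le_sylow[OF P Sp_sylow_subgroup[OF A P]] subset_set_mult2[OF sg] by blast
  then show ?thesis using subset_set_mult1[OF sg] by simp
qed

text \<open>Forward: let y have order a power of a prime q different from p and lie in a Sylow
  q-subgroup Q. Conjugating an element of \<open>A\<close> by y stays in AQ and in O_p(G), so it
  gives a p-element of AQ, hence an element of \<open>A\<close>. Backward: the Sylow p-subgroups
  contain \<open>A\<close>, and all other Sylow subgroups lie in O^p(G) and normalize
  \<open>A\<close>. Constructed subgroups are later recognized as S-permutable by this
  criterion.\<close>

lemma Sp_p_subgroups_iff:
  assumes p: "Factorial_Ring.prime p"
  shows "A \<in> S_permutable_p_subgroups p G \<longleftrightarrow>
    subgroup A G \<and> A \<subseteq> sylow_core p \<and> (\<forall>g\<in>p_residual p G. cj g ` A = A)"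
proof
  assume "A \<in> S_permutable_p_subgroups p G"
  then obtain n where A: "Sp A" "card A = p ^ n" by (auto simp: Sp_p_subgroups_iff')
  have Asg: "subgroup A G" using A(1) by (rule Sp_subgroup)
  have core: "A \<subseteq> sylow_core p" using p_subgroup_subset_sylow_core[OF A] by (auto simp: sylow_core_def)
  let ?S = "{g \<in> carrier G. cj g ` A = A}"
  have S: "subgroup ?S G"
    using Asg subgroup_finite by (intro cj_normalizer_subgroup) (auto dest: subgroup.subset)
  have "y \<in> ?S" if y: "other_prime_element p y" for y
  proof -
    have yG: "y \<in> carrier G" using y by (rule other_prime_element_carrier)
    obtain q where q: "Factorial_Ring.prime q" "q \<noteq> p" "p_element q y"
      using y by (auto simp: other_prime_element_def)
    obtain Q where Q: "sylow_subgroup q G Q" "y \<in> Q" using p_element_in_sylow[OF q(1,3)] by blast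
    have W: "subgroup (A <#> Q) G" using Sp_sylow_subgroup[OF A(1) Q(1)] .
    have yW: "y \<in> A <#> Q" using subset_set_mult2[OF Asg sylow_subgrp[OF Q(1)]] Q(2) by blast
    have "a \<in> A" if "a \<in> A <#> Q" "a \<in> sylow_core p" for a
      using that p q(2) sylow_core_p_element[OF p]
      by (intro Sp_sylow_other_prime[OF A(1) Q(1)]) (auto simp: other_prime_element_def)
    moreover have "cj y a \<in> A <#> Q" if "a \<in> A" for a
      using cj_image_eq_self[OF W yW] subset_set_mult1[OF Asg sylow_subgrp[OF Q(1)]] that by blast
    moreover have "cj y a \<in> sylow_core p" if "a \<in> A" for a
      using sylow_core_normal[OF p] yG core that unfolding normal_cj_iff by blast
    ultimately have "cj y ` A \<subseteq> A" by blast
    then show ?thesis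
      using cj_image_eqI[OF yG subgroup.subset[OF Asg] subgroup_finite[OF Asg]] yG by simp
  qed
  then have "p_residual p G \<subseteq> ?S"
    unfolding p_residual_eq[OF p] other_prime_part_def by (intro generate_subgroup_incl S) auto
  then show "subgroup A G \<and> A \<subseteq> sylow_core p \<and> (\<forall>g\<in>p_residual p G. cj g ` A = A)"
    using Asg core by blast
next
  assume "subgroup A G \<and> A \<subseteq> sylow_core p \<and> (\<forall>g\<in>p_residual p G. cj g ` A = A)"
  then have Asg: "subgroup A G" and core: "A \<subseteq> sylow_core p"
    and inv: "\<And>g. g \<in> p_residual p G \<Longrightarrow> cj g ` A = A" by auto
  have "Sp A"
  proof (rule SpI[OF Asg])
    fix q Q assume Q: "sylow_subgroup q G Q"
    have Qsg: "subgroup Q G" using Q by (rule sylow_subgrp)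
    show "A <#> Q = Q <#> A"
    proof (cases "q = p")
      case True
      then have "A \<subseteq> Q" using core sylow_core_subset Q by blast
      then show ?thesis using set_mult_absorb_left[OF Qsg Asg] set_mult_absorb_right[OF Qsg Asg] by simp
    next
      case False
      have "Q \<subseteq> p_residual p G"
        unfolding p_residual_eq[OF p]
        using False sylow_p_element[OF Q] sylow_prime[OF Q] subgroup.mem_carrier[OF Qsg]
        by (intro subsetI other_prime_part_incl) (auto simp: other_prime_element_def)
      then show ?thesis using inv by (intro set_mult_permute_cj[OF Asg Qsg]) blast
    qed
  qed
  moreover obtain P where P: "sylow_subgroup p G P" using sylow_exists[OF p] by blast
  have "card A dvd card P" using card_dvd[OF Asg sylow_subgrp[OF P]] core sylow_core_subset[OF P] by blast
  then have "\<exists>n. card A = p ^ n" using sylow_card[OF P] p by (auto simp: divides_primepow_nat)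
  ultimately show "A \<in> S_permutable_p_subgroups p G" by (simp add: Sp_p_subgroups_iff')
qed

section \<open>Maximal members and permutability of the whole lattice\<close>

lemma Sp_max_between:
  assumes "Sp K" "Sp T" "K \<subseteq> T" "K \<noteq> T"
  obtains M where "Sp M" "K \<subseteq> M" "M \<subseteq> T" "M \<noteq> T"
    "\<And>Z. Sp Z \<Longrightarrow> M \<subseteq> Z \<Longrightarrow> Z \<subseteq> T \<Longrightarrow> Z = M \<or> Z = T"
proof -
  let ?F = "{M. Sp M \<and> K \<subseteq> M \<and> M \<subseteq> T \<and> M \<noteq> T}"
  have "finite T" using subgroup_finite[OF Sp_subgroup[OF assms(2)]] .
  then have "finite ?F" by (intro finite_subset[of ?F "Pow T"]) auto
  moreover have "K \<in> ?F" using assms by simp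
  ultimately have "\<exists>M\<in>?F. K \<le> M \<and> (\<forall>Z\<in>?F. M \<le> Z \<longrightarrow> M = Z)" by (rule finite_has_maximal2)
  then obtain M where M: "M \<in> ?F" "\<forall>Z\<in>?F. M \<le> Z \<longrightarrow> M = Z" by (elim bexE conjE)
  show ?thesis
  proof (rule that)
    show "Sp M" "K \<subseteq> M" "M \<subseteq> T" "M \<noteq> T" using M(1) by auto
    fix Z assume Z: "Sp Z" "M \<subseteq> Z" "Z \<subseteq> T"
    show "Z = M \<or> Z = T"
    proof (cases "Z = T")
      case False
      then have "Z \<in> ?F" using Z M(1) by auto
      then show ?thesis using M(2) Z(2) by blast
    qed simp
  qed
qed

text \<open>Kegel's theorem inside \<open>T\<close> puts \<open>M\<close> in a proper normal
  subgroup N of \<open>T\<close>. The join of all \<open>T\<close>-conjugates of \<open>M\<close> is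
  S-permutable and stays in N, so by maximality it is \<open>M\<close> itself.\<close>

lemma Sp_maximal_cj:
  assumes M: "Sp M" and T: "Sp T" and sub: "M \<subseteq> T" "M \<noteq> T"
    and max: "\<And>Z. Sp Z \<Longrightarrow> M \<subseteq> Z \<Longrightarrow> Z \<subseteq> T \<Longrightarrow> Z = M \<or> Z = T"
    and t: "t \<in> T"
  shows "cj t ` M = M"
proof -
  have sg: "subgroup M G" "subgroup T G" using M T by (auto intro: Sp_subgroup)
  interpret T: finite_group "G\<lparr>carrier := T\<rparr>" by (rule finite_group_subgroup[OF sg(2)])
  obtain N where N: "N \<lhd> G\<lparr>carrier := T\<rparr>" "M \<subseteq> N" "N \<noteq> T"
    using T.Sp_in_proper_normal[OF Sp_in_subgroup[OF M sg(2) sub(1)]] sub(2) by auto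
  have Nsg: "subgroup N G" using incl_subgroup[OF sg(2) normal_imp_subgroup[OF N(1)]] .
  have NT: "N \<subseteq> T" using subgroup.subset[OF normal_imp_subgroup[OF N(1)]] by simp
  have Ncj: "cj u x \<in> N" if "u \<in> T" "x \<in> N" for u x
    using N(1) that m_inv_consistent[OF sg(2)] unfolding T.normal_cj_iff by (auto simp: conj_by_def)
  let ?F = "{cj u ` M | u. u \<in> T}"
  let ?U = "generate G (\<Union>?F)"
  have F: "Sp B" if "B \<in> ?F" for B
    using that Sp_cj[OF M] subgroup.mem_carrier[OF sg(2)] by auto
  have U: "Sp ?U" by (rule Sp_generate_Union) (rule F)
  have "\<Union>?F \<subseteq> N" using Ncj N(2) by auto
  then have UN: "?U \<subseteq> N" using Nsg by (rule generate_subgroup_incl)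
  have FU: "B \<subseteq> ?U" if "B \<in> ?F" for B using that by (auto intro: generate.incl)
  have "cj \<one> ` M \<in> ?F" using subgroup.one_closed[OF sg(2)] by blast
  then have "M \<subseteq> ?U" using FU[of M] subgroup.subset[OF sg(1)] by simp
  then have UM: "?U = M" using max[OF U] UN NT N(3) by blast
  have "cj t ` M \<in> ?F" using t by blast
  then have "cj t ` M \<subseteq> ?U" by (rule FU)
  then have "cj t ` M \<subseteq> M" by (simp only: UM)
  then show ?thesis
    by (rule cj_image_eqI[OF subgroup.mem_carrier[OF sg(2) t] subgroup.subset[OF sg(1)] subgroup_finite[OF sg(1)]])
qed

text \<open>With A1 maximal in \<open>A\<close> above \<open>A \<inter> B\<close>, induction gives
  that A1 permutes with \<open>B\<close>, and distributivity makes M = A1 B maximal in the join T of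
  \<open>A\<close> and \<open>B\<close>. So M is normal in T and permutes with \<open>A\<close>, and
  AM = A A1 B = AB is a subgroup.\<close>

lemma distributive_imp_permutable:
  assumes dist: "\<And>A B C. Sp A \<Longrightarrow> Sp B \<Longrightarrow> Sp C \<Longrightarrow>
      A \<inter> generate G (B \<union> C) \<subseteq> generate G ((A \<inter> B) \<union> (A \<inter> C))"
    and A: "Sp A" and B: "Sp B"
  shows "A <#> B = B <#> A"
  using A
proof (induction "card A" arbitrary: A rule: less_induct)
  case less
  note A = less.prems
  have sg: "subgroup A G" "subgroup B G" using A B by (auto intro: Sp_subgroup)
  show ?case
  proof (cases "A \<subseteq> B")
    case True
    then show ?thesis using set_mult_absorb_left[OF sg(2,1)] set_mult_absorb_right[OF sg(2,1)] by simp
  next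
    case False
    obtain A1 where A1: "Sp A1" "A \<inter> B \<subseteq> A1" "A1 \<subseteq> A" "A1 \<noteq> A"
      and max: "\<And>Z. Sp Z \<Longrightarrow> A1 \<subseteq> Z \<Longrightarrow> Z \<subseteq> A \<Longrightarrow> Z = A1 \<or> Z = A"
      using Sp_max_between[OF Sp_Int[OF A B] A] False by blast
    have A1sg: "subgroup A1 G" using A1(1) by (rule Sp_subgroup)
    have "card A1 < card A"
      using A1 subgroup_finite[OF sg(1)] by (intro psubset_card_mono) auto
    then have c: "A1 <#> B = B <#> A1" using less.hyps A1(1) by blast
    let ?M = "A1 <#> B"
    let ?T = "generate G (A \<union> B)"
    have M: "Sp ?M" using Sp_set_mult[OF A1(1) B c] .
    have Mgen: "generate G (A1 \<union> B) = ?M" using generate_Un_eq_set_mult[OF A1sg sg(2) c] .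
    have T: "Sp ?T" using Sp_generate_Un[OF A B] .
    have Tsub: "A \<subseteq> ?T" "B \<subseteq> ?T" by (auto intro: generate.incl)
    have MT: "?M \<subseteq> ?T"
      using Tsub A1(3) by (intro subgroup_set_mult_subset Sp_subgroup[OF T]) auto
    have A1M: "A1 \<subseteq> ?M" "B \<subseteq> ?M" using subset_set_mult1[OF A1sg sg(2)] subset_set_mult2[OF A1sg sg(2)] by auto
    \<comment> \<open>Choosing A1 above \<open>A \<inter> B\<close> keeps \<open>A\<close> from
      meeting M in more than A1, so that M is proper in the join.\<close>
    have "A \<inter> ?M \<subseteq> generate G ((A \<inter> A1) \<union> (A \<inter> B))" using dist[OF A A1(1) B] Mgen by simp
    also have "\<dots> \<subseteq> A1" using A1 by (intro generate_subgroup_incl A1sg) auto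
    finally have AM: "A \<inter> ?M \<subseteq> A1" .
    have "?M \<noteq> ?T" using AM Tsub A1 by blast
    moreover have "Z = ?M \<or> Z = ?T" if Z: "Sp Z" "?M \<subseteq> Z" "Z \<subseteq> ?T" for Z
    proof -
      have "Z \<inter> A = A1 \<or> Z \<inter> A = A"
        using max[OF Sp_Int[OF Z(1) A]] Z(2) A1M A1(3) by blast
      moreover have "Z \<subseteq> generate G ((Z \<inter> A) \<union> (Z \<inter> B))" using dist[OF Z(1) A B] Z(3) by blast
      moreover have "Z \<inter> B = B" using Z(2) A1M by blast
      ultimately have "Z \<subseteq> generate G (A1 \<union> B) \<or> Z \<subseteq> generate G (Z \<inter> A \<union> B) \<and> A \<subseteq> Z" by auto
      moreover have "?T \<subseteq> Z" if "A \<subseteq> Z"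
        using that Z(2) A1M by (intro generate_subgroup_incl Sp_subgroup[OF Z(1)]) auto
      ultimately show ?thesis using Z Mgen by blast
    qed
    ultimately have norm: "cj t ` ?M = ?M" if "t \<in> ?T" for t
      using Sp_maximal_cj[OF M T MT] that by blast
    have "?M <#> A = A <#> ?M"
    proof (rule set_mult_permute_cj[OF Sp_subgroup[OF M] sg(1)])
      fix b a assume "b \<in> A" "a \<in> ?M"
      then show "cj b a \<in> ?M" using norm Tsub by blast
    qed
    then have "subgroup (A <#> ?M) G"
      using subgroup_set_mult_iff[OF sg(1) Sp_subgroup[OF M]] by simp
    moreover have "A <#> ?M = A <#> B"
      using set_mult_assoc[of A A1 B] set_mult_absorb_right[OF sg(1) A1sg A1(3)] sg A1sg
      by (simp add: subgroup.subset)
    ultimately show ?thesis using subgroup_set_mult_iff[OF sg] by simp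
  qed
qed

end

section \<open>Isomorphic sections\<close>

context finite_group
begin

text \<open>Joins are written as products, which is legitimate by the permutability in the first
  conjunct. The reverse of the inclusion holds for arbitrary subgroups.\<close>

definition Sp_distributive :: bool where
  "Sp_distributive \<longleftrightarrow>
    (\<forall>A B. Sp A \<longrightarrow> Sp B \<longrightarrow> A <#> B = B <#> A) \<and>
    (\<forall>A B C. Sp A \<longrightarrow> Sp B \<longrightarrow> Sp C \<longrightarrow> A \<inter> (B <#> C) \<subseteq> (A \<inter> B) <#> (A \<inter> C))"

lemma Sp_subset_p_subgroup:
  assumes p: "Factorial_Ring.prime p" and "A \<in> S_permutable_p_subgroups p G" "Sp Z" "Z \<subseteq> A"
  shows "Z \<in> S_permutable_p_subgroups p G"
proof -
  obtain n where n: "Sp A" "card A = p ^ n" using assms(2) by (auto simp: Sp_p_subgroups_iff')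
  have "card Z dvd p ^ n"
    using card_dvd[OF Sp_subgroup[OF assms(3)] Sp_subgroup[OF n(1)] assms(4)] n by simp
  then show ?thesis using assms(3) p by (auto simp: Sp_p_subgroups_iff' divides_primepow_nat)
qed

lemma Sp_subset_sylow_core:
  assumes p: "Factorial_Ring.prime p" and Z: "Sp Z" "Z \<subseteq> sylow_core p"
  shows "Z \<in> S_permutable_p_subgroups p G"
proof -
  obtain S where S: "sylow_subgroup p G S" using sylow_exists[OF p] by blast
  have "Z \<subseteq> S" using Z(2) sylow_core_subset[OF S] by (rule subset_trans)
  then have "card Z dvd card S" using card_dvd[OF Sp_subgroup[OF Z(1)] sylow_subgrp[OF S]] by blast
  then show ?thesis using Z(1) p sylow_card[OF S] by (auto simp: Sp_p_subgroups_iff' divides_primepow_nat)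
qed

lemma cj_residual_closed:
  assumes "Factorial_Ring.prime p" "A \<in> S_permutable_p_subgroups p G" "g \<in> p_residual p G" "a \<in> A"
  shows "cj g a \<in> A"
  using assms Sp_p_subgroups_iff by blast

text \<open>Replacing an isomorphism \<open>\<phi>\<close> from \<open>H/K\<close> to \<open>L/K\<close> by the relation \<open>\<phi> (Kh) = Kl\<close> avoids
  quotients and makes the two sides symmetric.\<close>

definition section_rel :: "nat \<Rightarrow> 'a set \<Rightarrow> 'a set \<Rightarrow> 'a set \<Rightarrow> ('a \<Rightarrow> 'a \<Rightarrow> bool) \<Rightarrow> bool" where
  "section_rel p K H L r \<longleftrightarrow>
    (\<forall>h l. r h l \<longrightarrow> h \<in> H \<and> l \<in> L) \<and> (\<forall>h\<in>H. \<exists>l. r h l) \<and> (\<forall>l\<in>L. \<exists>h. r h l) \<and>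
    (\<forall>h l h' l'. r h l \<longrightarrow> r h' l' \<longrightarrow> r (h \<otimes> h') (l \<otimes> l')) \<and>
    (\<forall>h l. r h l \<longrightarrow> r (inv h) (inv l)) \<and>
    (\<forall>k\<in>K. \<forall>k'\<in>K. r k k') \<and> (\<forall>h l. r h l \<longrightarrow> (h \<in> K \<longleftrightarrow> l \<in> K)) \<and>
    (\<forall>g\<in>p_residual p G. \<forall>h l. r h l \<longrightarrow> r (cj g h) (cj g l))"

lemma section_relD:
  assumes "section_rel p K H L r"
  shows section_rel_dom: "r h l \<Longrightarrow> h \<in> H" "r h l \<Longrightarrow> l \<in> L"
    and section_rel_ex1: "h \<in> H \<Longrightarrow> \<exists>l. r h l"
    and section_rel_ex2: "l \<in> L \<Longrightarrow> \<exists>h. r h l"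
    and section_rel_mult: "r h l \<Longrightarrow> r h' l' \<Longrightarrow> r (h \<otimes> h') (l \<otimes> l')"
    and section_rel_inv: "r h l \<Longrightarrow> r (inv h) (inv l)"
    and section_rel_ker: "k \<in> K \<Longrightarrow> k' \<in> K \<Longrightarrow> r k k'"
    and section_rel_iff: "r h l \<Longrightarrow> h \<in> K \<longleftrightarrow> l \<in> K"
    and section_rel_cj: "g \<in> p_residual p G \<Longrightarrow> r h l \<Longrightarrow> r (cj g h) (cj g l)"
  using assms by (simp_all add: section_rel_def)

definition rel_image :: "('a \<Rightarrow> 'a \<Rightarrow> bool) \<Rightarrow> 'a set \<Rightarrow> 'a set" where
  "rel_image r S = {l. \<exists>h\<in>S. r h l}"

lemma section_rel_converse: "section_rel p K H L r \<Longrightarrow> section_rel p K L H (\<lambda>l h. r h l)"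
  by (simp add: section_rel_def)

lemma section_rel_restrict:
  assumes p: "Factorial_Ring.prime p" and r: "section_rel p K H L r" and S: "S \<in> S_permutable_p_subgroups p G" "K \<subseteq> S" "S \<subseteq> H"
  shows "section_rel p K S (rel_image r S) (\<lambda>h l. r h l \<and> h \<in> S)"
proof -
  have Ssg: "subgroup S G" using S(1) by (simp add: Sp_p_subgroups_iff' Sp_subgroup)
  show ?thesis
    unfolding section_rel_def rel_image_def
  proof (intro conjI)
    show "\<forall>h l. r h l \<and> h \<in> S \<longrightarrow> h \<in> S \<and> l \<in> {l. \<exists>h\<in>S. r h l}"
      "\<forall>l\<in>{l. \<exists>h\<in>S. r h l}. \<exists>h. r h l \<and> h \<in> S" by auto
    show "\<forall>h\<in>S. \<exists>l. r h l \<and> h \<in> S"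
      using section_rel_ex1[OF r] S(3) by blast
    show "\<forall>h l. r h l \<and> h \<in> S \<longrightarrow> (h \<in> K) = (l \<in> K)"
      using section_rel_iff[OF r] by blast
    show "\<forall>k\<in>K. \<forall>k'\<in>K. r k k' \<and> k \<in> S"
      using section_rel_ker[OF r] S(2) by blast
    show "\<forall>h l h' l'. r h l \<and> h \<in> S \<longrightarrow> r h' l' \<and> h' \<in> S \<longrightarrow> r (h \<otimes> h') (l \<otimes> l') \<and> h \<otimes> h' \<in> S"
      using section_rel_mult[OF r] subgroup.m_closed[OF Ssg] by simp
    show "\<forall>h l. r h l \<and> h \<in> S \<longrightarrow> r (inv h) (inv l) \<and> inv h \<in> S"
      using section_rel_inv[OF r] subgroup.m_inv_closed[OF Ssg] by simp
    show "\<forall>g\<in>p_residual p G. \<forall>h l. r h l \<and> h \<in> S \<longrightarrow> r (cj g h) (cj g l) \<and> cj g h \<in> S"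
      using section_rel_cj[OF r] cj_residual_closed[OF p S(1)] by simp
  qed
qed

text \<open>By Schmid's criterion it suffices that the image is a subgroup of O_p(G) stable under
  O^p(G), and \<open>r\<close> respects products, inverses and conjugation by O^p(G).\<close>

lemma rel_image_p_subgroup:
  assumes p: "Factorial_Ring.prime p" and r: "section_rel p K H L r"
    and K: "subgroup K G" and L: "L \<in> S_permutable_p_subgroups p G"
    and S: "S \<in> S_permutable_p_subgroups p G" "K \<subseteq> S"
  shows "rel_image r S \<in> S_permutable_p_subgroups p G" "K \<subseteq> rel_image r S" "rel_image r S \<subseteq> L"
proof -
  have Ssg: "subgroup S G" using S(1) by (simp add: Sp_p_subgroups_iff' Sp_subgroup)
  have Lsg: "subgroup L G" using L by (simp add: Sp_p_subgroups_iff' Sp_subgroup)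
  have one: "\<one> \<in> K" using subgroup.one_closed[OF K] .
  show sub: "rel_image r S \<subseteq> L" using section_rel_dom[OF r] unfolding rel_image_def by blast
  show KS: "K \<subseteq> rel_image r S" using section_rel_ker[OF r one] one S(2) unfolding rel_image_def by blast
  have car: "rel_image r S \<subseteq> carrier G" using sub subgroup.subset[OF Lsg] by (rule subset_trans)
  have "subgroup (rel_image r S) G"
  proof (rule subgroupI[OF car])
    show "rel_image r S \<noteq> {}" using KS one by blast
    show "inv a \<in> rel_image r S" if "a \<in> rel_image r S" for a
      using that section_rel_inv[OF r] subgroup.m_inv_closed[OF Ssg] unfolding rel_image_def by blast
    show "a \<otimes> b \<in> rel_image r S" if "a \<in> rel_image r S" "b \<in> rel_image r S" for a b
      using that section_rel_mult[OF r] subgroup.m_closed[OF Ssg] unfolding rel_image_def by blast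
  qed
  moreover have "rel_image r S \<subseteq> sylow_core p" using sub L Sp_p_subgroups_iff[OF p] by blast
  moreover have "cj g ` rel_image r S = rel_image r S" if g: "g \<in> p_residual p G" for g
  proof (rule cj_image_eqI[OF _ car])
    show "g \<in> carrier G" using g p_residual_carrier[OF p] by blast
    show "finite (rel_image r S)" using finite_subset[OF car fin] .
    show "cj g ` rel_image r S \<subseteq> rel_image r S"
      using section_rel_cj[OF r g] cj_residual_closed[OF p S(1) g] unfolding rel_image_def by blast
  qed
  ultimately show "rel_image r S \<in> S_permutable_p_subgroups p G"
    by (simp add: Sp_p_subgroups_iff[OF p])
qed

lemma section_rel_cong:
  assumes r: "section_rel p K H L r" and K: "subgroup K G" and L: "subgroup L G" and "r h l" "r h' l"
  shows "inv h' \<otimes> h \<in> K"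
proof -
  have "r (inv h' \<otimes> h) (inv l \<otimes> l)" 
    using section_rel_mult[OF r section_rel_inv[OF r assms(5)] assms(4)] .
  moreover have "l \<in> L" using section_rel_dom(2)[OF r assms(4)] .
  then have "inv l \<otimes> l \<in> K" using subgroup.mem_carrier[OF L] subgroup.one_closed[OF K] by simp
  ultimately show ?thesis using section_rel_iff[OF r] by blast
qed

lemma rel_image_mem:
  assumes r: "section_rel p K H L r" and sg: "subgroup K G" "subgroup H G" "subgroup L G" "subgroup S G"
    and "K \<subseteq> S" "r h l" "l \<in> rel_image r S"
  shows "h \<in> S"
proof -
  obtain h' where h': "h' \<in> S" "r h' l" using assms(8) by (auto simp: rel_image_def)
  have "inv h' \<otimes> h \<in> S" using section_rel_cong[OF r sg(1,3) assms(7) h'(2)] assms(6) by blast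
  then have "h' \<otimes> (inv h' \<otimes> h) \<in> S" using h'(1) sg(4) by (simp add: subgroup.m_closed)
  moreover have "h \<in> carrier G" using subgroup.mem_carrier[OF sg(2) section_rel_dom(1)[OF r assms(7)]] .
  ultimately show ?thesis using subgroup.mem_carrier[OF sg(4) h'(1)] by simp
qed

text \<open>Were \<open>L\<close> proper in \<open>H\<close>, minimality would make it its own image
  under \<open>r\<close>. But the image of all of \<open>H\<close> is already \<open>L\<close>, and
  \<open>r\<close> is injective modulo \<open>K\<close>, so \<open>H\<close> would lie in
  \<open>L\<close>.\<close>

lemma rel_subset_imp_eq:
  assumes p: "Factorial_Ring.prime p" and r: "section_rel p K H L r" and K: "K \<in> S_permutable_p_subgroups p G"
    and H: "H \<in> S_permutable_p_subgroups p G" and L: "L \<in> S_permutable_p_subgroups p G"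
    and KL: "K \<subseteq> L" and sub: "L \<subseteq> H"
    and IH: "\<And>S. S \<in> S_permutable_p_subgroups p G \<Longrightarrow> K \<subseteq> S \<Longrightarrow> S \<subseteq> H \<Longrightarrow> S \<noteq> H \<Longrightarrow> rel_image r S = S"
  shows "H = L"
proof (rule ccontr)
  assume neq: "H \<noteq> L"
  have sg: "subgroup K G" "subgroup H G" "subgroup L G"
    using K H L by (simp_all add: Sp_p_subgroups_iff' Sp_subgroup)
  have im: "rel_image r L = L" using IH[OF L KL sub] neq by blast
  have "H \<subseteq> L"
  proof
    fix h assume "h \<in> H"
    then obtain l where l: "r h l" using section_rel_ex1[OF r] by blast
    then have "l \<in> rel_image r L" using im section_rel_dom(2)[OF r] by blast
    then show "h \<in> L" using rel_image_mem[OF r sg(1,2,3,3) KL l] by blast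
  qed
  then show False using sub neq by blast
qed

text \<open>\<open>L'\<close> stands for the largest proper member of an interval below
  \<open>L\<close>. If it were not inside \<open>M\<close>, then ML' would be all of
  \<open>P\<close>, and Dedekind's law would write \<open>L\<close> as the product of
  \<open>M \<inter> L\<close> and \<open>L'\<close>, which lies in \<open>L'\<close>.\<close>

lemma maximal_Int_eq:
  assumes SD: Sp_distributive and M: "Sp M" "M \<subseteq> P" and P: "Sp P"
    and max: "\<And>Z. Sp Z \<Longrightarrow> M \<subseteq> Z \<Longrightarrow> Z \<subseteq> P \<Longrightarrow> Z = M \<or> Z = P"
    and L: "Sp L" "L \<subseteq> P" "\<not> L \<subseteq> M" and L': "Sp L'" "L' \<subseteq> L" "L' \<noteq> L"
    and great: "L \<inter> M \<noteq> L \<Longrightarrow> L \<inter> M \<subseteq> L'"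
  shows "L \<inter> M = L'"
proof
  show LM: "L \<inter> M \<subseteq> L'" using great L(3) by blast
  show "L' \<subseteq> L \<inter> M"
  proof (rule ccontr)
    assume "\<not> L' \<subseteq> L \<inter> M"
    then have no: "\<not> L' \<subseteq> M" using L'(2) by blast
    have sg: "subgroup M G" "subgroup L' G" "subgroup L G" "subgroup P G"
      using M L L' P by (simp_all add: Sp_subgroup)
    have "M <#> L' = L' <#> M" using SD M L' unfolding Sp_distributive_def by blast
    then have "Sp (M <#> L')" using Sp_set_mult M(1) L'(1) by blast
    moreover have "M \<subseteq> M <#> L'" "L' \<subseteq> M <#> L'"
      using subset_set_mult1[OF sg(1,2)] subset_set_mult2[OF sg(1,2)] .
    moreover have "M <#> L' \<subseteq> P" using M(2) L' L by (intro subgroup_set_mult_subset sg) auto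
    ultimately have "M <#> L' = P" using max no by blast
    then have "L = (M <#> L') \<inter> L" using L(2) by blast
    also have "\<dots> = (M \<inter> L) <#> L'"
      using dedekind_left[OF sg(3) L'(2)] sg by (simp add: subgroup.subset)
    also have "\<dots> \<subseteq> L'" using LM by (intro subgroup_set_mult_subset sg) auto
    finally show False using L' by blast
  qed
qed

text \<open>With I the intersection of \<open>M\<close> and \<open>N\<close>, the quotient P/I is
  the direct product of M/I and N/I, and the products hl with \<open>r h l\<close> form modulo I the
  graph of an isomorphism between subgroups of the two factors. By \<open>LM\<close> and
  \<open>HN\<close> the graph meets each factor trivially, so distributivity forces it to be
  trivial, and then every l lies in \<open>M\<close>.\<close>

lemma section_rel_diagonal:
  assumes SD: Sp_distributive and p: "Factorial_Ring.prime p" and r: "section_rel p K H L r"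
    and K: "subgroup K G" and P: "P \<in> S_permutable_p_subgroups p G"
    and M: "Sp M" "H \<subseteq> M" "M \<subseteq> P" and N: "Sp N" "L \<subseteq> N" "N \<subseteq> P" and PMN: "P = M <#> N"
    and Mcj: "\<And>t. t \<in> P \<Longrightarrow> cj t ` M = M" and Ncj: "\<And>t. t \<in> P \<Longrightarrow> cj t ` N = N"
    and LM: "\<And>h l. r h l \<Longrightarrow> l \<in> M \<Longrightarrow> h \<in> N" and HN: "\<And>h l. r h l \<Longrightarrow> h \<in> N \<Longrightarrow> l \<in> M"
  shows "L \<subseteq> M"
proof -
  have sg: "subgroup M G" "subgroup N G" "subgroup P G"
    using M N P by (simp_all add: Sp_p_subgroups_iff' Sp_subgroup)
  interpret M: subgroup M G by fact
  interpret N: subgroup N G by fact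
  interpret P: subgroup P G by fact
  define I where "I = M \<inter> N"
  have I: "subgroup I G" unfolding I_def using sg(1,2) by (rule subgroups_Inter_pair)
  interpret I: subgroup I G by fact
  have ISp: "Sp I" unfolding I_def using M(1) N(1) by (rule Sp_Int)
  have Icj: "cj t x \<in> I" if "t \<in> P" "x \<in> I" for t x
    using that Mcj[OF that(1)] Ncj[OF that(1)] unfolding I_def by blast
  have rHL: "h \<in> H" "l \<in> L" if "r h l" for h l using section_rel_dom[OF r that] .
  have rP: "h \<in> M" "l \<in> N" "h \<in> P" "l \<in> P" "h \<in> carrier G" "l \<in> carrier G" if "r h l" for h l
    using rHL[OF that] M N by auto
  \<comment> \<open>\<open>M\<close> and \<open>N\<close> are normal in \<open>P\<close>, so they
    commute modulo I; this is what lets the products hl be regrouped below.\<close>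
  have comm: "inv l \<otimes> inv h \<otimes> l \<otimes> h \<in> I" if hl: "h \<in> M" "l \<in> N" for h l
  proof -
    have hlP: "h \<in> P" "l \<in> P" "h \<in> carrier G" "l \<in> carrier G" using hl M(3) N(3) by auto
    have "cj (inv l) (inv h) \<in> M" using Mcj[of "inv l"] hl hlP by (metis M.m_inv_closed P.m_inv_closed imageI)
    then have "cj (inv l) (inv h) \<otimes> h \<in> M" using hl by simp
    moreover have "cj (inv h) l \<in> N" using Ncj[of "inv h"] hl hlP by (metis P.m_inv_closed imageI)
    then have "inv l \<otimes> cj (inv h) l \<in> N" using hl by simp
    ultimately show ?thesis using hlP by (simp add: I_def conj_by_def m_assoc)
  qed
  define Q where "Q = {h \<otimes> l \<otimes> x | h l x. r h l \<and> x \<in> I}"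
  have QP: "Q \<subseteq> P" using rP M by (auto simp: Q_def I_def)
  have QG: "Q \<subseteq> carrier G" using QP P.subset by (rule subset_trans)
  have r1: "r \<one> \<one>" using section_rel_ker[OF r] subgroup.one_closed[OF K] by blast
  have Qsg: "subgroup Q G"
  proof (rule subgroupI[OF QG])
    have "\<one> \<otimes> \<one> \<otimes> \<one> \<in> Q" using r1 I.one_closed unfolding Q_def by blast
    then show "Q \<noteq> {}" by blast
  next
    fix z assume "z \<in> Q"
    then obtain h l x where z: "z = h \<otimes> l \<otimes> x" "r h l" "x \<in> I" by (auto simp: Q_def)
    note C = rP[OF z(2)]
    have "cj (l \<otimes> h) (inv x) \<in> I" using C z(3) by (intro Icj) auto
    moreover have "inv (inv l) \<otimes> inv (inv h) \<otimes> inv l \<otimes> inv h \<in> I" using C by (intro comm) auto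
    ultimately have "cj (l \<otimes> h) (inv x) \<otimes> (l \<otimes> h \<otimes> inv l \<otimes> inv h) \<in> I" using C by simp
    moreover have "inv z = inv h \<otimes> inv l \<otimes> (cj (l \<otimes> h) (inv x) \<otimes> (l \<otimes> h \<otimes> inv l \<otimes> inv h))"
      using C z(1,3) by (simp add: conj_by_def m_assoc inv_mult_group)
    moreover have "r (inv h) (inv l)" using section_rel_inv[OF r z(2)] .
    ultimately show "inv z \<in> Q" unfolding Q_def by blast
  next
    fix z z' assume "z \<in> Q" "z' \<in> Q"
    then obtain h l x h' l' x' where z: "z = h \<otimes> l \<otimes> x" "r h l" "x \<in> I"
      and z': "z' = h' \<otimes> l' \<otimes> x'" "r h' l'" "x' \<in> I" by (auto simp: Q_def)
    note C = rP[OF z(2)] rP[OF z'(2)]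
    let ?u = "inv l \<otimes> inv h' \<otimes> l \<otimes> h'" and ?v = "cj (inv h') x"
    have u: "?u \<in> I" using C by (intro comm)
    have v: "?v \<in> I" using C z(3) by (intro Icj) auto
    have "cj (inv l') (?u \<otimes> ?v) \<in> I" using C u v by (intro Icj) auto
    then have "cj (inv l') (?u \<otimes> ?v) \<otimes> x' \<in> I" using z'(3) by simp
    moreover have "z \<otimes> z' = (h \<otimes> h') \<otimes> (l \<otimes> l') \<otimes> (cj (inv l') (?u \<otimes> ?v) \<otimes> x')"
      using C z(1,3) z'(1,3) by (simp add: conj_by_def m_assoc)
    moreover have "r (h \<otimes> h') (l \<otimes> l')" using section_rel_mult[OF r z(2) z'(2)] .
    ultimately show "z \<otimes> z' \<in> Q" unfolding Q_def by blast
  qed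
  have Ip: "I \<in> S_permutable_p_subgroups p G"
    using Sp_subset_p_subgroup[OF p P ISp] M(3) by (auto simp: I_def)
  have "cj g ` Q = Q" if g: "g \<in> p_residual p G" for g
  proof (rule cj_image_eqI[OF _ QG finite_subset[OF QG fin]])
    show gG: "g \<in> carrier G" using g p_residual_carrier[OF p] by blast
    show "cj g ` Q \<subseteq> Q"
    proof
      fix w assume "w \<in> cj g ` Q"
      then obtain h l x where z: "w = cj g (h \<otimes> l \<otimes> x)" "r h l" "x \<in> I" by (auto simp: Q_def)
      then have "w = cj g h \<otimes> cj g l \<otimes> cj g x" using gG rP[OF z(2)] by (simp add: cj_mult)
      moreover have "r (cj g h) (cj g l)" using section_rel_cj[OF r g z(2)] .
      moreover have "cj g x \<in> I" using cj_residual_closed[OF p Ip g z(3)] .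
      ultimately show "w \<in> Q" unfolding Q_def by blast
    qed
  qed
  moreover have "Q \<subseteq> sylow_core p" using QP P Sp_p_subgroups_iff[OF p] by blast
  ultimately have "Q \<in> S_permutable_p_subgroups p G" using Qsg by (simp add: Sp_p_subgroups_iff[OF p])
  then have Q: "Sp Q" by (simp add: Sp_p_subgroups_iff')
  have QM: "Q \<inter> M \<subseteq> I"
  proof
    fix z assume zz: "z \<in> Q \<inter> M"
    then obtain h l x where z: "z = h \<otimes> l \<otimes> x" "r h l" "x \<in> I" by (auto simp: Q_def)
    note C = rP[OF z(2)]
    have "inv h \<otimes> z \<otimes> inv x \<in> M" using zz C z(3) by (simp add: I_def)
    moreover have "inv h \<otimes> z \<otimes> inv x = l" using z C by (simp add: m_assoc)
    ultimately have "h \<in> N" using LM z(2) by simp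
    then have "z \<in> N" using z C by (simp add: I_def)
    then show "z \<in> I" using zz by (simp add: I_def)
  qed
  have QN: "Q \<inter> N \<subseteq> I"
  proof
    fix z assume zz: "z \<in> Q \<inter> N"
    then obtain h l x where z: "z = h \<otimes> l \<otimes> x" "r h l" "x \<in> I" by (auto simp: Q_def)
    note C = rP[OF z(2)]
    have "z \<otimes> inv x \<otimes> inv l \<in> N" using zz C z(3) by (simp add: I_def)
    moreover have "z \<otimes> inv x \<otimes> inv l = h" using z C by (simp add: m_assoc)
    ultimately have "l \<in> M" using HN z(2) by simp
    then have "z \<in> M" using z C by (simp add: I_def)
    then show "z \<in> I" using zz by (simp add: I_def)
  qed
  have "Q \<inter> (M <#> N) \<subseteq> (Q \<inter> M) <#> (Q \<inter> N)"
    using SD Q M(1) N(1) unfolding Sp_distributive_def by blast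
  also have "\<dots> \<subseteq> I" using QM QN by (intro subgroup_set_mult_subset I)
  finally have "Q \<subseteq> M" using QP PMN by (auto simp: I_def)
  show "L \<subseteq> M"
  proof
    fix l assume "l \<in> L"
    then obtain h where h: "r h l" using section_rel_ex2[OF r] by blast
    note C = rP[OF h]
    have "h \<otimes> l \<otimes> \<one> \<in> Q" unfolding Q_def using h I.one_closed by blast
    then have "h \<otimes> l \<in> M" using \<open>Q \<subseteq> M\<close> C by auto
    then have "inv h \<otimes> (h \<otimes> l) \<in> M" by (rule M.m_closed[OF M.m_inv_closed[OF C(1)]])
    moreover have "inv h \<otimes> (h \<otimes> l) = l" using C by simp
    ultimately show "l \<in> M" by simp
  qed
qed

theorem section_rel_imp_eq:
  assumes SD: Sp_distributive and p: "Factorial_Ring.prime p" and K: "K \<in> S_permutable_p_subgroups p G"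
    and "H \<in> S_permutable_p_subgroups p G" "L \<in> S_permutable_p_subgroups p G"
    and "K \<subseteq> H" "K \<subseteq> L" "section_rel p K H L r"
  shows "H = L"
  using assms(4-)
proof (induction "card H + card L" arbitrary: H L r rule: less_induct)
  case less
  note H = less.prems(1) and L = less.prems(2) and KH = less.prems(3) and KL = less.prems(4) and r = less.prems(5)
  note r' = section_rel_converse[OF r]
  let ?r' = "\<lambda>l h. r h l"
  have Sp: "Sp K" "Sp H" "Sp L" using K H L by (simp_all add: Sp_p_subgroups_iff')
  then have sg: "subgroup K G" "subgroup H G" "subgroup L G" by (simp_all add: Sp_subgroup)
  have IH: "rel_image r S = S" if S: "S \<in> S_permutable_p_subgroups p G" "K \<subseteq> S" "S \<subseteq> H" "S \<noteq> H" for S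
  proof -
    note im = rel_image_p_subgroup[OF p r sg(1) L S(1,2)]
    have "card S < card H" using S subgroup_finite[OF sg(2)] by (intro psubset_card_mono) auto
    moreover have "card (rel_image r S) \<le> card L" using im(3) subgroup_finite[OF sg(3)] by (intro card_mono)
    ultimately have "card S + card (rel_image r S) < card H + card L" by simp
    from less.hyps[OF this S(1) im(1) S(2) im(2) section_rel_restrict[OF p r S(1-3)]] show ?thesis by simp
  qed
  have IH': "rel_image ?r' S = S" if S: "S \<in> S_permutable_p_subgroups p G" "K \<subseteq> S" "S \<subseteq> L" "S \<noteq> L" for S
  proof -
    note im = rel_image_p_subgroup[OF p r' sg(1) H S(1,2)]
    have "card S < card L" using S subgroup_finite[OF sg(3)] by (intro psubset_card_mono) auto
    moreover have "card (rel_image ?r' S) \<le> card H" using im(3) subgroup_finite[OF sg(2)] by (intro card_mono)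
    ultimately have "card S + card (rel_image ?r' S) < card H + card L" by simp
    from less.hyps[OF this S(1) im(1) S(2) im(2) section_rel_restrict[OF p r' S(1-3)]] show ?thesis by simp
  qed
  have sub1: ?case if "L \<subseteq> H" using rel_subset_imp_eq[OF p r K H L KL that IH] .
  have sub2: ?case if "H \<subseteq> L" using rel_subset_imp_eq[OF p r' K L H KH that IH'] by simp
  have comm: "A <#> B = B <#> A" if "Sp A" "Sp B" for A B
    using SD that unfolding Sp_distributive_def by blast
  show ?case
  proof (cases "H = K")
    case True
    then have "L \<subseteq> H" using section_rel_ex2[OF r] section_rel_dom(1)[OF r] section_rel_iff[OF r] by blast
    then show ?thesis by (rule sub1)
  next
    case False
    obtain H' where H': "Sp H'" "K \<subseteq> H'" "H' \<subseteq> H" "H' \<noteq> H"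
      and maxH: "\<And>Z. Sp Z \<Longrightarrow> H' \<subseteq> Z \<Longrightarrow> Z \<subseteq> H \<Longrightarrow> Z = H' \<or> Z = H"
      using Sp_max_between[OF Sp(1,2) KH] False by blast
    have H'p: "H' \<in> S_permutable_p_subgroups p G" using Sp_subset_p_subgroup[OF p H H'(1,3)] .
    have H'sg: "subgroup H' G" using H'(1) by (rule Sp_subgroup)
    show ?thesis
    proof (cases "\<exists>Z. Sp Z \<and> K \<subseteq> Z \<and> Z \<subseteq> H \<and> Z \<noteq> H \<and> \<not> Z \<subseteq> H'")
      case True
      \<comment> \<open>Two proper members generate \<open>H\<close>, and each is its own image by
        induction; so the image \<open>L\<close> of their product stays in \<open>H\<close>.\<close>
      then obtain Z where Z: "Sp Z" "K \<subseteq> Z" "Z \<subseteq> H" "Z \<noteq> H" "\<not> Z \<subseteq> H'" by blast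
      have Zp: "Z \<in> S_permutable_p_subgroups p G" using Sp_subset_p_subgroup[OF p H Z(1,3)] .
      have Zsg: "subgroup Z G" using Z(1) by (rule Sp_subgroup)
      have "Sp (H' <#> Z)" using Sp_set_mult[OF H'(1) Z(1) comm[OF H'(1) Z(1)]] .
      moreover have "H' \<subseteq> H' <#> Z" "Z \<subseteq> H' <#> Z"
        using subset_set_mult1[OF H'sg Zsg] subset_set_mult2[OF H'sg Zsg] .
      moreover have "H' <#> Z \<subseteq> H" using H'(3) Z(3) by (rule subgroup_set_mult_subset[OF sg(2)])
      ultimately have HZ: "H' <#> Z = H" using maxH Z(5) by blast
      have "L \<subseteq> H"
      proof
        fix l assume lL: "l \<in> L"
        then obtain h where h: "r h l" using section_rel_ex2[OF r] by blast
        then have "h \<in> H" using section_rel_dom(1)[OF r] by blast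
        then obtain a b where ab: "a \<in> H'" "b \<in> Z" "h = a \<otimes> b" using HZ by (auto elim!: set_multE)
        obtain a' where a': "r a a'" using section_rel_ex1[OF r] ab(1) H'(3) by blast
        obtain b' where b': "r b b'" using section_rel_ex1[OF r] ab(2) Z(3) by blast
        have "a' \<in> rel_image r H'" "b' \<in> rel_image r Z" using ab a' b' by (auto simp: rel_image_def)
        then have mem: "a' \<in> H" "b' \<in> H" using IH[OF H'p H'(2-4)] IH[OF Zp Z(2-4)] H'(3) Z(3) by auto
        have "r h (a' \<otimes> b')" unfolding ab(3) by (rule section_rel_mult[OF r a' b'])
        then have "inv (a' \<otimes> b') \<otimes> l \<in> K" using section_rel_cong[OF r' sg(1,2) h] by blast
        then have "(a' \<otimes> b') \<otimes> (inv (a' \<otimes> b') \<otimes> l) \<in> H"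
          using mem KH by (intro subgroup.m_closed[OF sg(2) subgroup.m_closed[OF sg(2)]]) auto
        moreover have "l \<in> carrier G" "a' \<otimes> b' \<in> carrier G"
          using lL mem subgroup.mem_carrier[OF sg(3)] subgroup.mem_carrier[OF sg(2)] by auto
        ultimately show "l \<in> H" by simp
      qed
      then show ?thesis by (rule sub1)
    next
      case False
      then have great: "Z \<subseteq> H'" if "Sp Z" "K \<subseteq> Z" "Z \<subseteq> H" "Z \<noteq> H" for Z using that by blast
      let ?L' = "rel_image r H'"
      note L' = rel_image_p_subgroup[OF p r sg(1) L H'p H'(2)]
      have L'Sp: "Sp ?L'" using L'(1) by (simp add: Sp_p_subgroups_iff')
      have relH': "h \<in> H'" if "r h l" "l \<in> ?L'" for h l
        using rel_image_mem[OF r sg H'sg H'(2) that] .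
      have relL': "l \<in> ?L'" if "r h l" "h \<in> H'" for h l using that by (auto simp: rel_image_def)
      have L'neq: "?L' \<noteq> L"
      proof
        assume eq: "?L' = L"
        have "h \<in> H'" if h: "h \<in> H" for h
        proof -
          obtain l where l: "r h l" using section_rel_ex1[OF r h] by blast
          then have "l \<in> ?L'" using eq section_rel_dom(2)[OF r] by blast
          then show ?thesis using relH' l by blast
        qed
        then show False using H' by blast
      qed
      \<comment> \<open>The relation carries the largest proper member of \<open>H\<close> to that
        of \<open>L\<close>: the preimage of a proper Z is proper, hence inside H'.\<close>
      have great': "Z \<subseteq> ?L'" if Z: "Sp Z" "K \<subseteq> Z" "Z \<subseteq> L" "Z \<noteq> L" for Z
      proof -
        have Zp: "Z \<in> S_permutable_p_subgroups p G" using Sp_subset_p_subgroup[OF p L Z(1,3)] .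
        note im = rel_image_p_subgroup[OF p r' sg(1) H Zp Z(2)]
        have "rel_image ?r' Z \<noteq> H"
        proof
          assume eq: "rel_image ?r' Z = H"
          have "l \<in> Z" if l: "l \<in> L" for l
          proof -
            obtain h where h: "r h l" using section_rel_ex2[OF r l] by blast
            then have "h \<in> rel_image ?r' Z" using eq section_rel_dom(1)[OF r] by blast
            then show ?thesis using rel_image_mem[OF r' sg(1,3,2) Sp_subgroup[OF Z(1)] Z(2) h] by blast
          qed
          then show False using Z by blast
        qed
        then have sub: "rel_image ?r' Z \<subseteq> H'" using great[OF _ im(2,3)] im(1) by (simp add: Sp_p_subgroups_iff')
        show ?thesis
        proof
          fix l assume l: "l \<in> Z"
          then obtain h where h: "r h l" using section_rel_ex2[OF r] Z(3) by blast
          then have "h \<in> H'" using l sub by (auto simp: rel_image_def)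
          then show "l \<in> ?L'" using relL' h by blast
        qed
      qed
      show ?thesis
      proof (rule ccontr)
        assume "H \<noteq> L"
        then have nsub: "\<not> L \<subseteq> H" "\<not> H \<subseteq> L" using sub1 sub2 by blast+
        let ?P = "H <#> L"
        have P: "Sp ?P" using Sp_set_mult[OF Sp(2,3) comm[OF Sp(2,3)]] .
        have PHL: "H \<subseteq> ?P" "L \<subseteq> ?P" using subset_set_mult1[OF sg(2,3)] subset_set_mult2[OF sg(2,3)] .
        have "?P \<subseteq> sylow_core p"
          using H L Sp_p_subgroups_iff[OF p] by (intro subgroup_set_mult_subset sylow_core_subgroup[OF p]) blast+
        then have Pp: "?P \<in> S_permutable_p_subgroups p G" by (rule Sp_subset_sylow_core[OF p P])
        obtain M where M: "Sp M" "H \<subseteq> M" "M \<subseteq> ?P" "M \<noteq> ?P"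
          and maxM: "\<And>Z. Sp Z \<Longrightarrow> M \<subseteq> Z \<Longrightarrow> Z \<subseteq> ?P \<Longrightarrow> Z = M \<or> Z = ?P"
          using Sp_max_between[OF Sp(2) P PHL(1)] PHL nsub by blast
        obtain N where N: "Sp N" "L \<subseteq> N" "N \<subseteq> ?P" "N \<noteq> ?P"
          and maxN: "\<And>Z. Sp Z \<Longrightarrow> N \<subseteq> Z \<Longrightarrow> Z \<subseteq> ?P \<Longrightarrow> Z = N \<or> Z = ?P"
          using Sp_max_between[OF Sp(3) P PHL(2)] PHL nsub by blast
        have MNsg: "subgroup M G" "subgroup N G" using M(1) N(1) by (simp_all add: Sp_subgroup)
        have LnM: "\<not> L \<subseteq> M" using M subgroup_set_mult_subset[OF MNsg(1) M(2)] by blast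
        have HnN: "\<not> H \<subseteq> N" using N subgroup_set_mult_subset[OF MNsg(2) _ N(2)] by blast
        \<comment> \<open>Meeting \<open>L\<close> with M and \<open>H\<close> with N yields the
          largest proper members, which correspond under \<open>r\<close>. These are the two
          compatibility conditions that the diagonal needs.\<close>
        have LM: "L \<inter> M = ?L'"
        proof (rule maximal_Int_eq[OF SD M(1,3) P maxM Sp(3) PHL(2) LnM L'Sp L'(3) L'neq])
          show "L \<inter> M \<subseteq> ?L'" if "L \<inter> M \<noteq> L"
            using that KL KH M(2) by (intro great' Sp_Int Sp(3) M(1)) auto
        qed
        have HN: "H \<inter> N = H'"
        proof (rule maximal_Int_eq[OF SD N(1,3) P maxN Sp(2) PHL(1) HnN H'(1,3,4)])
          show "H \<inter> N \<subseteq> H'" if "H \<inter> N \<noteq> H"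
            using that KL KH N(2) by (intro great Sp_Int Sp(2) N(1)) auto
        qed
        have "Sp (M <#> N)" using Sp_set_mult[OF M(1) N(1) comm[OF M(1) N(1)]] .
        moreover have "M \<subseteq> M <#> N" "N \<subseteq> M <#> N"
          using subset_set_mult1[OF MNsg] subset_set_mult2[OF MNsg] .
        moreover have "M <#> N \<subseteq> ?P" using M(3) N(3) by (rule subgroup_set_mult_subset[OF Sp_subgroup[OF P]])
        ultimately have PMN: "?P = M <#> N" using maxM N(2) LnM by blast
        have "L \<subseteq> M"
        proof (rule section_rel_diagonal[OF SD p r sg(1) Pp M(1-3) N(1-3) PMN])
          show "cj t ` M = M" if "t \<in> ?P" for t using Sp_maximal_cj[OF M(1) P M(3,4) maxM that] .
          show "cj t ` N = N" if "t \<in> ?P" for t using Sp_maximal_cj[OF N(1) P N(3,4) maxN that] .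
          fix h l assume hl: "r h l"
          have HL: "h \<in> H" "l \<in> L" using section_rel_dom[OF r hl] .
          show "h \<in> N" if "l \<in> M" using relH'[OF hl] that HL LM HN by blast
          show "l \<in> M" if "h \<in> N" using relL'[OF hl] that HL LM HN by blast
        qed
        then show False using LnM by blast
      qed
    qed
  qed
qed

theorem Sp_distributive_imp_sections_coincide:
  assumes SD: Sp_distributive and p: "Factorial_Ring.prime p"
  shows "isomorphic_sections_coincide p G"
  unfolding isomorphic_sections_coincide_def
proof (intro ballI impI, elim conjE)
  fix K H L assume K: "K \<in> S_permutable_p_subgroups p G" and H: "H \<in> S_permutable_p_subgroups p G"
    and L: "L \<in> S_permutable_p_subgroups p G"
    and KH: "K \<lhd> G\<lparr>carrier := H\<rparr>" and KL: "K \<lhd> G\<lparr>carrier := L\<rparr>"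
    and "operator_isomorphic_sections G (p_residual p G) H K L K"
  then obtain \<phi> where \<phi>: "\<phi> \<in> iso (G\<lparr>carrier := H\<rparr> Mod K) (G\<lparr>carrier := L\<rparr> Mod K)"
    and op: "\<And>a h l. a \<in> p_residual p G \<Longrightarrow> h \<in> H \<Longrightarrow> l \<in> L \<Longrightarrow> \<phi> (K #> h) = K #> l \<Longrightarrow>
          \<phi> (K #> conjugate_by G h a) = K #> conjugate_by G l a"
    unfolding operator_isomorphic_sections_def by blast
  have sg: "subgroup K G" "subgroup H G" "subgroup L G"
    using K H L by (simp_all add: Sp_p_subgroups_iff' Sp_subgroup)
  interpret KH: normal K "G\<lparr>carrier := H\<rparr>" by fact
  interpret KL: normal K "G\<lparr>carrier := L\<rparr>" by fact
  interpret hom: group_hom "G\<lparr>carrier := H\<rparr> Mod K" "G\<lparr>carrier := L\<rparr> Mod K" \<phi>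
    using \<phi> KH.factorgroup_is_group KL.factorgroup_is_group
    by (simp add: group_hom_def group_hom_axioms_def iso_def)
  have cosH: "carrier (G\<lparr>carrier := H\<rparr> Mod K) = (\<lambda>h. K #> h) ` H"
    and cosL: "carrier (G\<lparr>carrier := L\<rparr> Mod K) = (\<lambda>h. K #> h) ` L"
    by (simp_all add: carrier_FactGroup)
  have bij: "bij_betw \<phi> ((\<lambda>h. K #> h) ` H) ((\<lambda>h. K #> h) ` L)"
    using \<phi> cosH cosL by (simp add: iso_def)
  have sub: "K \<subseteq> H" "K \<subseteq> L" using KH.subset KL.subset by auto
  have coset1: "K #> k = K" if "k \<in> K" for k
    using that sg(1) by (simp add: coset_join2 subgroup.mem_carrier)
  have coset_iff: "K #> k = K \<longleftrightarrow> k \<in> K" if "k \<in> carrier G" for k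
    using that sg(1) coset_join1 coset1 subgroup.subset by metis
  have mulH: "(K #> h) <#> (K #> h') = K #> (h \<otimes> h')" if "h \<in> H" "h' \<in> H" for h h'
    using KH.rcos_sum[of h h'] that by simp
  have mulL: "(K #> h) <#> (K #> h') = K #> (h \<otimes> h')" if "h \<in> L" "h' \<in> L" for h h'
    using KL.rcos_sum[of h h'] that by simp
  have phi_one: "\<phi> K = K" using hom.hom_one by simp
  have phi_mult: "\<phi> (K #> (h \<otimes> h')) = \<phi> (K #> h) <#> \<phi> (K #> h')" if "h \<in> H" "h' \<in> H" for h h'
    using hom.hom_mult[of "K #> h" "K #> h'"] that cosH mulH by simp
  define r where "r = (\<lambda>h l. h \<in> H \<and> l \<in> L \<and> \<phi> (K #> h) = K #> l)"
  have mult: "r (h \<otimes> h') (l \<otimes> l')" if "r h l" "r h' l'" for h l h' l'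
    using that phi_mult mulL sg by (simp add: r_def subgroup.m_closed)
  have tot: "\<exists>l. r h l" if "h \<in> H" for h
  proof -
    have "\<phi> (K #> h) \<in> (\<lambda>h. K #> h) ` L" using bij that by (meson bij_betw_apply imageI)
    then show ?thesis using that by (auto simp: r_def)
  qed
  have ker: "h \<in> K \<longleftrightarrow> l \<in> K" if "r h l" for h l
  proof -
    have C: "h \<in> carrier G" "l \<in> carrier G"
      using that sg by (auto simp: r_def subgroup.mem_carrier)
    have "h \<in> K \<longleftrightarrow> K #> h = K #> \<one>"
      using C coset_iff sg(1) by (simp add: subgroup.subset)
    also have "\<dots> \<longleftrightarrow> \<phi> (K #> h) = \<phi> (K #> \<one>)"
    proof -
      have inj: "inj_on \<phi> ((\<lambda>h. K #> h) ` H)" using bij by (rule bij_betw_imp_inj_on)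
      have "K #> h \<in> (\<lambda>h. K #> h) ` H" "K #> \<one> \<in> (\<lambda>h. K #> h) ` H"
        using that subgroup.one_closed[OF sg(2)] by (auto simp: r_def)
      then show ?thesis using inj_on_eq_iff[OF inj] by blast
    qed
    also have "\<dots> \<longleftrightarrow> l \<in> K"
      using C coset_iff that phi_one sg(1) by (simp add: r_def subgroup.subset)
    finally show ?thesis .
  qed
  have inv: "r (inv h) (inv l)" if hl: "r h l" for h l
  proof -
    have hH: "h \<in> H" "l \<in> L" using hl by (auto simp: r_def)
    have C: "h \<in> carrier G" "l \<in> carrier G" using hH sg by (auto simp: subgroup.mem_carrier)
    obtain l' where l': "r (inv h) l'" using tot[of "inv h"] hH sg(2) by (auto simp: subgroup.m_inv_closed)
    have l'L: "l' \<in> L" "l' \<in> carrier G" using l' sg(3) by (auto simp: r_def subgroup.mem_carrier)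
    have "r (inv h \<otimes> h) (l' \<otimes> l)" using mult[OF l' hl] .
    then have "l' \<otimes> l \<in> K" using ker C subgroup.one_closed[OF sg(1)] by fastforce
    then have "K #> (l' \<otimes> l \<otimes> inv l) = K #> inv l"
      using C l'L coset_mult_assoc[of K "l' \<otimes> l" "inv l"] coset1[of "l' \<otimes> l"] sg(1) by (simp add: subgroup.subset)
    then have "K #> l' = K #> inv l" using C l'L by (simp add: m_assoc)
    then show ?thesis using l' hH sg(3) by (simp add: r_def subgroup.m_inv_closed)
  qed
  have "section_rel p K H L r"
    unfolding section_rel_def
  proof (intro conjI)
    show "\<forall>h l. r h l \<longrightarrow> h \<in> H \<and> l \<in> L" by (simp add: r_def)
    show "\<forall>h\<in>H. \<exists>l. r h l" using tot by blast
    show "\<forall>l\<in>L. \<exists>h. r h l"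
    proof
      fix l assume l: "l \<in> L"
      then have "K #> l \<in> \<phi> ` (\<lambda>h. K #> h) ` H" using bij by (simp add: bij_betw_def)
      then show "\<exists>h. r h l" using l by (auto simp: r_def)
    qed
    show "\<forall>h l h' l'. r h l \<longrightarrow> r h' l' \<longrightarrow> r (h \<otimes> h') (l \<otimes> l')" using mult by blast
    show "\<forall>h l. r h l \<longrightarrow> r (inv h) (inv l)" using inv by blast
    show "\<forall>k\<in>K. \<forall>k'\<in>K. r k k'" using sub coset1 phi_one by (auto simp: r_def)
    show "\<forall>h l. r h l \<longrightarrow> (h \<in> K) = (l \<in> K)" using ker by blast
    show "\<forall>g\<in>p_residual p G. \<forall>h l. r h l \<longrightarrow> r (cj g h) (cj g l)"
    proof (intro ballI allI impI)
      fix g h l assume g: "g \<in> p_residual p G" and hl: "r h l"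
      have gG: "g \<in> carrier G" using g p_residual_carrier[OF p] by blast
      have "inv g \<in> p_residual p G" using g p_residual_subgroup[OF p] by (simp add: subgroup.m_inv_closed)
      then have "\<phi> (K #> cj g h) = K #> cj g l"
        using op[of "inv g" h l] hl gG by (simp add: r_def conjugate_by_def conj_by_def)
      then show "r (cj g h) (cj g l)"
        using hl cj_residual_closed[OF p H g] cj_residual_closed[OF p L g] by (simp add: r_def)
    qed
  qed
  then show "H = L" using section_rel_imp_eq[OF SD p K H L sub] by blast
qed

end

section \<open>Quotients and the nilpotent residual\<close>

text \<open>Transfer to quotients is done for arbitrary surjections, which keeps cosets out of the
  arguments; the instance used is the natural map onto a factor group.\<close>

locale finite_epimorphism = group_hom + fG: finite_group G + fH: finite_group H +
  assumes surj: "h ` carrier G = carrier H"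
begin

definition preimage :: "'c set \<Rightarrow> 'a set" where
  "preimage Z = {x \<in> carrier G. h x \<in> Z}"

lemma image_preimage: "Z \<subseteq> carrier H \<Longrightarrow> h ` preimage Z = Z"
  using surj by (auto simp: preimage_def)

lemma preimage_subgroup:
  assumes "subgroup Z H" shows "subgroup (preimage Z) G"
proof -
  interpret Z: subgroup Z H by fact
  show ?thesis
    by (rule G.subgroupI) (auto simp: preimage_def)
qed

lemma card_image_subgroup:
  assumes S: "subgroup S G"
  shows "card (h ` S) * card (S \<inter> kernel G H h) = card S"
proof -
  interpret S: subgroup S G by fact
  have fib: "card {x \<in> S. h x = y} = card (S \<inter> kernel G H h)" if "y \<in> h ` S" for y
  proof -
    obtain s where s: "s \<in> S" "y = h s" using \<open>y \<in> h ` S\<close> by blast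
    have "bij_betw (\<lambda>x. s \<otimes> x) (S \<inter> kernel G H h) {x \<in> S. h x = y}"
    proof (rule bij_betw_byWitness[where f' = "\<lambda>x. inv s \<otimes> x"])
      show "\<forall>a\<in>S \<inter> kernel G H h. inv s \<otimes> (s \<otimes> a) = a" using s by simp
      show "\<forall>a\<in>{x \<in> S. h x = y}. s \<otimes> (inv s \<otimes> a) = a" using s by simp
      show "(\<lambda>x. s \<otimes> x) ` (S \<inter> kernel G H h) \<subseteq> {x \<in> S. h x = y}" using s by (auto simp: kernel_def)
      show "(\<lambda>x. inv s \<otimes> x) ` {x \<in> S. h x = y} \<subseteq> S \<inter> kernel G H h" using s by (auto simp: kernel_def)
    qed
    then show ?thesis using bij_betw_same_card[symmetric] by blast
  qed
  have "card S = (\<Sum>y\<in>h ` S. card {x \<in> S. h x = y})"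
    unfolding card_eq_sum by (rule sum.image_gen[OF fG.subgroup_finite[OF S]])
  then show ?thesis using fib by simp
qed

text \<open>If the order of \<open>H\<close> had one more factor p than the image of
  \<open>P\<close>, multiplying by the order of the kernel would make p times card P divide the
  order of \<open>G\<close>.\<close>

lemma sylow_image:
  assumes P: "sylow_subgroup p G P" shows "sylow_subgroup p H (h ` P)"
proof -
  have p: "Factorial_Ring.prime p" using P by (rule fG.sylow_prime)
  have Psg: "subgroup P G" using P by (rule fG.sylow_subgrp)
  have ker: "subgroup (kernel G H h) G" by (rule subgroup_kernel)
  have hP: "subgroup (h ` P) H" using Psg by (rule subgroup_img_is_subgroup)
  note c1 = card_image_subgroup[OF Psg] and c2 = card_image_subgroup[OF G.subgroup_self]
  have kc: "carrier G \<inter> kernel G H h = kernel G H h" using subgroup.subset[OF ker] by blast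
  have oG: "order G = order H * card (kernel G H h)" using c2 kc surj by (simp add: order_def)
  have "card (h ` P) dvd p ^ multiplicity p (order G)" using c1 fG.sylow_card[OF P] by (metis dvd_triv_left)
  then obtain a where a: "card (h ` P) = p ^ a" using p by (auto simp: divides_primepow_nat)
  have "a = multiplicity p (order H)"
  proof (rule antisym)
    show "a \<le> multiplicity p (order H)"
      using fH.card_subgroup_dvd_order[OF hP] a fH.order_pos p
      by (metis multiplicity_geI not_prime_unit less_irrefl)
    show "multiplicity p (order H) \<le> a"
    proof (rule ccontr)
      assume "\<not> multiplicity p (order H) \<le> a"
      then have "p ^ Suc a dvd order H" by (intro multiplicity_dvd') simp
      moreover have "card (P \<inter> kernel G H h) dvd card (kernel G H h)"
        using fG.card_dvd[OF _ ker] G.subgroups_Inter_pair[OF Psg ker] by simp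
      ultimately have "p ^ Suc a * card (P \<inter> kernel G H h) dvd order G"
        unfolding oG by (rule mult_dvd_mono)
      then have "card P * p dvd order G" using c1 a by (simp add: ac_simps)
      then show False using fG.sylow_index_not_dvd[OF P] by blast
    qed
  qed
  then show ?thesis using p hP a by (simp add: sylow_subgroup_def)
qed

lemma h_cj: "g \<in> carrier G \<Longrightarrow> x \<in> carrier G \<Longrightarrow> h (conj_by G g x) = conj_by H (h g) (h x)"
  by (simp add: conj_by_def)

text \<open>Images of Sylow subgroups are Sylow, and the element conjugating one such image to
  \<open>Q\<close> lifts along the surjection.\<close>

lemma sylow_lift:
  assumes Q: "sylow_subgroup p H Q"
  shows "\<exists>P. sylow_subgroup p G P \<and> h ` P = Q"
proof -
  obtain P where P: "sylow_subgroup p G P" using fG.sylow_exists[OF fH.sylow_prime[OF Q]] by blast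
  obtain u where u: "u \<in> carrier H" "Q = conj_by H u ` h ` P"
    using fH.sylow_conjugate[OF sylow_image[OF P] Q] by blast
  obtain g where g: "g \<in> carrier G" "u = h g" using u surj by blast
  have "h ` conj_by G g ` P = Q"
    unfolding u(2) g(2) image_image
    using g h_cj subgroup.mem_carrier[OF fG.sylow_subgrp[OF P]] by (intro image_cong) auto
  then show ?thesis using fG.sylow_cj[OF P g(1)] by blast
qed

lemma Sp_image:
  assumes A: "S_permutable G A" shows "S_permutable H (h ` A)"
proof (rule fH.SpI)
  have Asg: "subgroup A G" using A by (rule fG.Sp_subgroup)
  then show "subgroup (h ` A) H" by (rule subgroup_img_is_subgroup)
  fix p Q assume "sylow_subgroup p H Q"
  then obtain P where P: "sylow_subgroup p G P" "h ` P = Q" using sylow_lift by blast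
  have sub: "A \<subseteq> carrier G" "P \<subseteq> carrier G"
    using Asg fG.sylow_subgrp[OF P(1)] by (simp_all add: subgroup.subset)
  show "h ` A <#>\<^bsub>H\<^esub> Q = Q <#>\<^bsub>H\<^esub> h ` A"
    using fG.Sp_sylow_commute[OF A P(1)] set_mult_hom[OF homh sub] set_mult_hom[OF homh sub(2,1)] P(2) by simp
qed

text \<open>A factorization of h(w) with one factor h(y'), y' in a Sylow subgroup, lifts without
  adjusting y': the remaining factor of w maps into \<open>Z\<close> and so lies in the
  preimage.\<close>

lemma Sp_preimage:
  assumes Z: "S_permutable H Z" shows "S_permutable G (preimage Z)"
proof (rule fG.SpI)
  interpret Z: subgroup Z H using Z by (rule fH.Sp_subgroup)
  show pre: "subgroup (preimage Z) G" using Z.subgroup_axioms by (rule preimage_subgroup)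
  fix p P assume P: "sylow_subgroup p G P"
  interpret P: subgroup P G using P by (rule fG.sylow_subgrp)
  have comm: "Z <#>\<^bsub>H\<^esub> h ` P = h ` P <#>\<^bsub>H\<^esub> Z"
    using fH.Sp_sylow_commute[OF Z sylow_image[OF P]] .
  show "preimage Z <#> P = P <#> preimage Z"
  proof
    show "preimage Z <#> P \<subseteq> P <#> preimage Z"
    proof
      fix w assume "w \<in> preimage Z <#> P"
      then obtain x y where xy: "x \<in> carrier G" "h x \<in> Z" "y \<in> P" "w = x \<otimes> y"
        by (auto simp: preimage_def elim!: G.set_multE)
      then have "h x \<otimes>\<^bsub>H\<^esub> h y \<in> h ` P <#>\<^bsub>H\<^esub> Z" using H.set_multI[of "h x" Z "h y" "h ` P"] comm by blast
      then obtain y' z where y': "y' \<in> P" "z \<in> Z" "h x \<otimes>\<^bsub>H\<^esub> h y = h y' \<otimes>\<^bsub>H\<^esub> z"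
        by (auto elim!: H.set_multE)
      have "h (inv y' \<otimes> w) = inv\<^bsub>H\<^esub> (h y') \<otimes>\<^bsub>H\<^esub> (h y' \<otimes>\<^bsub>H\<^esub> z)" using xy y' by simp
      also have "\<dots> = z" using y' by simp
      finally have "inv y' \<otimes> w \<in> preimage Z" using xy y' by (simp add: preimage_def)
      then have "y' \<otimes> (inv y' \<otimes> w) \<in> P <#> preimage Z" using y' by (intro G.set_multI)
      then show "w \<in> P <#> preimage Z" using xy y' by simp
    qed
    show "P <#> preimage Z \<subseteq> preimage Z <#> P"
    proof
      fix w assume "w \<in> P <#> preimage Z"
      then obtain x y where xy: "x \<in> carrier G" "h x \<in> Z" "y \<in> P" "w = y \<otimes> x"
        by (auto simp: preimage_def elim!: G.set_multE)
      then have "h y \<otimes>\<^bsub>H\<^esub> h x \<in> Z <#>\<^bsub>H\<^esub> h ` P" using H.set_multI[of "h y" "h ` P" "h x" Z] comm by blast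
      then obtain y' z where y': "y' \<in> P" "z \<in> Z" "h y \<otimes>\<^bsub>H\<^esub> h x = z \<otimes>\<^bsub>H\<^esub> h y'"
        by (auto elim!: H.set_multE)
      have "h (w \<otimes> inv y') = (z \<otimes>\<^bsub>H\<^esub> h y') \<otimes>\<^bsub>H\<^esub> inv\<^bsub>H\<^esub> (h y')" using xy y' by simp
      also have "\<dots> = z" using y' by (simp add: H.m_assoc)
      finally have "w \<otimes> inv y' \<in> preimage Z" using xy y' by (simp add: preimage_def)
      then have "(w \<otimes> inv y') \<otimes> y' \<in> preimage Z <#> P" using y' by (intro G.set_multI)
      then show "w \<in> preimage Z <#> P" using xy y' by (simp add: G.m_assoc)
    qed
  qed
qed

lemma Sp_distributive_image:
  assumes SD: "fG.Sp_distributive" shows "fH.Sp_distributive"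
  unfolding fH.Sp_distributive_def
proof (intro conjI allI impI)
  fix A B assume A: "S_permutable H A" and B: "S_permutable H B"
  have sub: "preimage A \<subseteq> carrier G" "preimage B \<subseteq> carrier G" by (auto simp: preimage_def)
  have im: "h ` preimage A = A" "h ` preimage B = B"
    using fH.Sp_subgroup[OF A] fH.Sp_subgroup[OF B] by (simp_all add: image_preimage subgroup.subset)
  have "preimage A <#> preimage B = preimage B <#> preimage A"
    using SD Sp_preimage[OF A] Sp_preimage[OF B] unfolding fG.Sp_distributive_def by blast
  then show "A <#>\<^bsub>H\<^esub> B = B <#>\<^bsub>H\<^esub> A"
    using set_mult_hom[OF homh sub] set_mult_hom[OF homh sub(2,1)] im by simp
next
  fix A B C assume A: "S_permutable H A" and B: "S_permutable H B" and C: "S_permutable H C"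
  have dist: "preimage A \<inter> (preimage B <#> preimage C)
      \<subseteq> (preimage A \<inter> preimage B) <#> (preimage A \<inter> preimage C)"
    using SD Sp_preimage[OF A] Sp_preimage[OF B] Sp_preimage[OF C] unfolding fG.Sp_distributive_def by blast
  show "A \<inter> (B <#>\<^bsub>H\<^esub> C) \<subseteq> (A \<inter> B) <#>\<^bsub>H\<^esub> (A \<inter> C)"
  proof
    fix x assume x: "x \<in> A \<inter> (B <#>\<^bsub>H\<^esub> C)"
    then obtain b c where bc: "b \<in> B" "c \<in> C" "x = b \<otimes>\<^bsub>H\<^esub> c" by (auto elim: H.set_multE)
    then have "b \<in> carrier H" "c \<in> carrier H"
      using subgroup.mem_carrier[OF fH.Sp_subgroup[OF B]] subgroup.mem_carrier[OF fH.Sp_subgroup[OF C]] by auto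
    then obtain b' c' where b': "b' \<in> carrier G" "b = h b'" and c': "c' \<in> carrier G" "c = h c'"
      using surj by blast
    have "b' \<otimes> c' \<in> preimage A \<inter> (preimage B <#> preimage C)"
      using x bc b' c' by (auto simp: preimage_def intro!: G.set_multI)
    then have "b' \<otimes> c' \<in> (preimage A \<inter> preimage B) <#> (preimage A \<inter> preimage C)" using dist by blast
    then obtain y z where yz: "y \<in> preimage A \<inter> preimage B" "z \<in> preimage A \<inter> preimage C" "b' \<otimes> c' = y \<otimes> z"
      by (auto elim: G.set_multE)
    have "x = h (b' \<otimes> c')" using bc b' c' by simp
    also have "\<dots> = h y \<otimes>\<^bsub>H\<^esub> h z" using yz by (auto simp: preimage_def)
    finally show "x \<in> (A \<inter> B) <#>\<^bsub>H\<^esub> (A \<inter> C)"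
      using yz by (auto simp: preimage_def intro!: H.set_multI)
  qed
qed

end

context finite_group
begin

lemma finite_epimorphism_FactGroup:
  assumes N: "N \<lhd> G" shows "finite_epimorphism G (G Mod N) (\<lambda>x. N #> x)"
proof -
  interpret N: normal N G by fact
  interpret Q: group "G Mod N" by (rule N.factorgroup_is_group)
  show ?thesis
  proof
    show "(\<lambda>x. N #> x) \<in> hom G (G Mod N)" by (rule N.r_coset_hom_Mod)
    show "(\<lambda>x. N #> x) ` carrier G = carrier (G Mod N)" by (simp add: carrier_FactGroup)
    then show "finite (carrier (G Mod N))" by (metis fin finite_imageI)
  qed
qed

lemma finite_group_FactGroup: "N \<lhd> G \<Longrightarrow> finite_group (G Mod N)"
  using finite_epimorphism_FactGroup by (simp add: finite_epimorphism_def)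

section \<open>The lower central series, the nilpotent residual, and nilpotent groups\<close>

lemma lower_central_normal: "lower_central G n \<lhd> G"
proof (induction n)
  case 0 then show ?case using normal_self by simp
next
  case (Suc n)
  have sub: "lower_central G n \<subseteq> carrier G"
    using normal_imp_subgroup[OF Suc] by (rule subgroup.subset)
  show ?case
    unfolding lower_central.simps
  proof (rule normal_generateI)
    show "{x \<otimes> y \<otimes> inv x \<otimes> inv y | x y. x \<in> lower_central G n \<and> y \<in> carrier G} \<subseteq> carrier G"
      using sub by auto
    fix k g assume "k \<in> {x \<otimes> y \<otimes> inv x \<otimes> inv y | x y. x \<in> lower_central G n \<and> y \<in> carrier G}" and g: "g \<in> carrier G"
    then obtain x y where xy: "k = x \<otimes> y \<otimes> inv x \<otimes> inv y" "x \<in> lower_central G n" "y \<in> carrier G" by blast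
    then have "g \<otimes> k \<otimes> inv g = cj g x \<otimes> cj g y \<otimes> inv (cj g x) \<otimes> inv (cj g y)"
      using g sub by (auto simp: conj_by_def m_assoc inv_mult_group subset_iff)
    moreover have "cj g x \<in> lower_central G n" using Suc xy g by (simp add: normal_cj_iff)
    ultimately show "g \<otimes> k \<otimes> inv g \<in> {x \<otimes> y \<otimes> inv x \<otimes> inv y | x y. x \<in> lower_central G n \<and> y \<in> carrier G}"
      using xy(3) g by (intro CollectI exI[of _ "cj g x"] exI[of _ "cj g y"]) simp
  qed
qed

lemma lower_central_subset_carrier: "lower_central G n \<subseteq> carrier G"
  using normal_imp_subgroup[OF lower_central_normal] by (rule subgroup.subset)

lemma lower_central_commutator:
  "x \<in> lower_central G n \<Longrightarrow> y \<in> carrier G \<Longrightarrow> x \<otimes> y \<otimes> inv x \<otimes> inv y \<in> lower_central G (Suc n)"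
  unfolding lower_central.simps by (rule generate.incl) blast

lemma lower_central_Suc_subset: "lower_central G (Suc n) \<subseteq> lower_central G n"
  unfolding lower_central.simps
proof (rule generate_subgroup_incl)
  show sg: "subgroup (lower_central G n) G" using lower_central_normal by (rule normal_imp_subgroup)
  show "{x \<otimes> y \<otimes> inv x \<otimes> inv y | x y. x \<in> lower_central G n \<and> y \<in> carrier G} \<subseteq> lower_central G n"
  proof
    fix k assume "k \<in> {x \<otimes> y \<otimes> inv x \<otimes> inv y | x y. x \<in> lower_central G n \<and> y \<in> carrier G}"
    then obtain x y where xy: "k = x \<otimes> y \<otimes> inv x \<otimes> inv y" "x \<in> lower_central G n" "y \<in> carrier G" by blast
    have xG: "x \<in> carrier G" using xy lower_central_subset_carrier by blast
    have "cj y (inv x) \<in> lower_central G n"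
      using lower_central_normal xy sg by (simp add: normal_cj_iff subgroup.m_inv_closed)
    then have "x \<otimes> cj y (inv x) \<in> lower_central G n" using xy sg by (simp add: subgroup.m_closed)
    then show "k \<in> lower_central G n" using xy xG by (simp add: conj_by_def m_assoc)
  qed
qed

lemma lower_central_antimono: "m \<le> n \<Longrightarrow> lower_central G n \<subseteq> lower_central G m"
  using lift_Suc_antimono_le[of "lower_central G"] lower_central_Suc_subset by blast

end

lemma (in finite_epimorphism) lower_central_image: "h ` lower_central G n = lower_central H n"
proof (induction n)
  case 0 then show ?case using surj by simp
next
  case (Suc n)
  let ?S = "{x \<otimes> y \<otimes> inv x \<otimes> inv y | x y. x \<in> lower_central G n \<and> y \<in> carrier G}"
  let ?T = "{x \<otimes>\<^bsub>H\<^esub> y \<otimes>\<^bsub>H\<^esub> inv\<^bsub>H\<^esub> x \<otimes>\<^bsub>H\<^esub> inv\<^bsub>H\<^esub> y | x y. x \<in> lower_central H n \<and> y \<in> carrier H}"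
  have sub: "lower_central G n \<subseteq> carrier G" by (rule fG.lower_central_subset_carrier)
  have hc: "h (x \<otimes> y \<otimes> inv x \<otimes> inv y) = h x \<otimes>\<^bsub>H\<^esub> h y \<otimes>\<^bsub>H\<^esub> inv\<^bsub>H\<^esub> (h x) \<otimes>\<^bsub>H\<^esub> inv\<^bsub>H\<^esub> (h y)"
    if "x \<in> carrier G" "y \<in> carrier G" for x y using that by simp
  have "h ` ?S = ?T"
  proof
    show "h ` ?S \<subseteq> ?T"
    proof
      fix k assume "k \<in> h ` ?S"
      then obtain x y where "k = h (x \<otimes> y \<otimes> inv x \<otimes> inv y)" "x \<in> lower_central G n" "y \<in> carrier G" by blast
      moreover from this have "h x \<in> lower_central H n" "h y \<in> carrier H" using Suc by auto
      ultimately show "k \<in> ?T" using hc sub by blast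
    qed
    show "?T \<subseteq> h ` ?S"
    proof
      fix k assume "k \<in> ?T"
      then obtain x y where k: "k = x \<otimes>\<^bsub>H\<^esub> y \<otimes>\<^bsub>H\<^esub> inv\<^bsub>H\<^esub> x \<otimes>\<^bsub>H\<^esub> inv\<^bsub>H\<^esub> y" "x \<in> lower_central H n" "y \<in> carrier H" by blast
      obtain x' where x': "x' \<in> lower_central G n" "x = h x'" using k(2) Suc by blast
      obtain y' where y': "y' \<in> carrier G" "y = h y'" using k(3) surj by blast
      have "k = h (x' \<otimes> y' \<otimes> inv x' \<otimes> inv y')" using k(1) x' y' hc sub by auto
      then show "k \<in> h ` ?S" using x'(1) y'(1) by blast
    qed
  qed
  moreover have "?S \<subseteq> carrier G" using sub by auto
  ultimately show ?case using generate_img[of ?S] by simp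
qed

context finite_group
begin

lemma lower_central_subset_iff:
  assumes N: "N \<lhd> G"
  shows "lower_central (G Mod N) n = {\<one>\<^bsub>G Mod N\<^esub>} \<longleftrightarrow> lower_central G n \<subseteq> N"
proof -
  interpret e: finite_epimorphism G "G Mod N" "\<lambda>x. N #> x" by (rule finite_epimorphism_FactGroup[OF N])
  have sg: "subgroup (lower_central G n) G" "subgroup N G"
    using lower_central_normal N by (simp_all add: normal_imp_subgroup)
  have im: "lower_central (G Mod N) n = (\<lambda>x. N #> x) ` lower_central G n"
    by (rule e.lower_central_image[symmetric])
  have "N #> x = N \<longleftrightarrow> x \<in> N" if "x \<in> lower_central G n" for x
  proof -
    have "x \<in> carrier G" using subgroup.mem_carrier[OF sg(1) that] .
    then show ?thesis using coset_join1[OF _ _ sg(2)] coset_join2[OF _ sg(2)] by blast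
  qed
  then have "((\<lambda>x. N #> x) ` lower_central G n \<subseteq> {N}) = (lower_central G n \<subseteq> N)" by auto
  moreover have "lower_central G n \<noteq> {}" using subgroup.one_closed[OF sg(1)] by blast
  ultimately show ?thesis unfolding im one_FactGroup by (simp add: subset_singleton_iff)
qed

lemma nilpotent_group_FactGroup_iff:
  assumes "N \<lhd> G"
  shows "nilpotent_group (G Mod N) \<longleftrightarrow> (\<exists>n. lower_central G n \<subseteq> N)"
  using lower_central_subset_iff[OF assms] normal.factorgroup_is_group[OF assms]
  by (simp add: nilpotent_group_def)

lemma nilpotent_residual_normal: "nilpotent_residual G \<lhd> G"
proof -
  let ?F = "{N. N \<lhd> G \<and> nilpotent_group (G Mod N)}"
  have "carrier G \<in> ?F"
    using nilpotent_group_FactGroup_iff[OF normal_self] normal_self lower_central_subset_carrier by auto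
  then have "subgroup (\<Inter>?F) G" by (intro subgroups_Inter) (auto dest: normal_imp_subgroup)
  then show ?thesis unfolding nilpotent_residual_def by (auto simp: normal_cj_iff)
qed

text \<open>There are finitely many admissible N, each containing some term of the decreasing
  series, so the term with the largest of these indices lies in all of them. Thus the factor group
  by the residual is itself nilpotent.\<close>

lemma lower_central_subset_residual: "\<exists>n. lower_central G n \<subseteq> nilpotent_residual G"
proof -
  let ?F = "{N. N \<lhd> G \<and> nilpotent_group (G Mod N)}"
  have "?F \<subseteq> Pow (carrier G)" by (auto dest!: normal_imp_subgroup dest: subgroup.subset)
  then have fF: "finite ?F" using finite_subset[of ?F "Pow (carrier G)"] by simp
  have "\<forall>N\<in>?F. \<exists>n. lower_central G n \<subseteq> N" using nilpotent_group_FactGroup_iff by blast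
  then obtain n where n: "\<And>N. N \<in> ?F \<Longrightarrow> lower_central G (n N) \<subseteq> N" by metis
  have "lower_central G (Max (n ` ?F)) \<subseteq> N" if N: "N \<in> ?F" for N
  proof -
    have "n N \<le> Max (n ` ?F)" using fF N by (intro Max_ge) auto
    then show ?thesis using lower_central_antimono n[OF N] by blast
  qed
  then have "lower_central G (Max (n ` ?F)) \<subseteq> nilpotent_residual G"
    unfolding nilpotent_residual_def by (rule Inter_greatest)
  then show ?thesis by blast
qed

text \<open>Take the least k whose term lies in \<open>N\<close> and an x in the preceding term but
  outside \<open>N\<close>: commutators of x with elements of \<open>N\<close> fall into the k-th
  term, hence into \<open>N\<close>.\<close>

lemma nilpotent_normalizer_growth:
  assumes n: "lower_central G n = {\<one>}" and N: "subgroup N G" "N \<noteq> carrier G"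
  shows "\<exists>x\<in>carrier G - N. cj x ` N = N"
proof -
  let ?P = "\<lambda>k. lower_central G k \<subseteq> N"
  have Pn: "?P n" using n subgroup.one_closed[OF N(1)] by simp
  define k where "k = (LEAST k. ?P k)"
  have k: "?P k" unfolding k_def using Pn by (rule LeastI)
  have "k \<noteq> 0" using k N subgroup.subset[OF N(1)] by (cases k) auto
  then obtain j where j: "k = Suc j" using not0_implies_Suc by blast
  have "\<not> ?P j" using not_less_Least[of j ?P] j k_def by simp
  then obtain x where x: "x \<in> lower_central G j" "x \<notin> N" by blast
  have xG: "x \<in> carrier G" using x lower_central_subset_carrier by blast
  have "cj x y \<in> N" if y: "y \<in> N" for y
  proof -
    have yG: "y \<in> carrier G" using subgroup.mem_carrier[OF N(1) y] .
    have "x \<otimes> y \<otimes> inv x \<otimes> inv y \<in> N" using lower_central_commutator[OF x(1) yG] k j by blast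
    then have "x \<otimes> y \<otimes> inv x \<otimes> inv y \<otimes> y \<in> N" using y N(1) by (simp add: subgroup.m_closed)
    then show ?thesis using xG yG by (simp add: conj_by_def m_assoc)
  qed
  then have "cj x ` N = N"
    using xG N(1) by (intro cj_image_eqI subgroup_finite) (auto dest: subgroup.subset)
  then show ?thesis using x xG by blast
qed

text \<open>Otherwise the normalizer of \<open>P\<close> would be normalized by some x outside it.
  Then xPx^-1 normalizes \<open>P\<close>, its product with \<open>P\<close> has order a power of p,
  so it equals \<open>P\<close>, and x does normalize \<open>P\<close>.\<close>

lemma nilpotent_sylow_normal:
  assumes n: "lower_central G n = {\<one>}" and P: "sylow_subgroup p G P"
  shows "P \<lhd> G"
proof -
  have Psg: "subgroup P G" using P by (rule sylow_subgrp)
  let ?N = "{g \<in> carrier G. cj g ` P = P}"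
  have Nsg: "subgroup ?N G" using Psg by (intro cj_normalizer_subgroup subgroup_finite) (auto dest: subgroup.subset)
  have "?N = carrier G"
  proof (rule ccontr)
    assume "?N \<noteq> carrier G"
    from nilpotent_normalizer_growth[OF n Nsg this]
    obtain x where x: "x \<in> carrier G" "x \<notin> ?N" "cj x ` ?N = ?N" by (elim bexE DiffE)
    let ?Q = "cj x ` P"
    have Q: "sylow_subgroup p G ?Q" using sylow_cj[OF P x(1)] .
    have Qsg: "subgroup ?Q G" using Q by (rule sylow_subgrp)
    have "P \<subseteq> ?N" using cj_image_eq_self[OF Psg] subgroup.mem_carrier[OF Psg] by blast
    then have "?Q \<subseteq> cj x ` ?N" by (rule image_mono)
    then have QN: "?Q \<subseteq> ?N" by (simp only: x(3))
    have "P <#> ?Q = ?Q <#> P"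
    proof (rule set_mult_permute_cj[OF Psg Qsg])
      fix b a assume "b \<in> ?Q" "a \<in> P"
      then have "cj b ` P = P" using QN by blast
      then show "cj b a \<in> P" using \<open>a \<in> P\<close> by blast
    qed
    then have PQ: "subgroup (P <#> ?Q) G" using subgroup_set_mult_iff[OF Psg Qsg] by simp
    have "card (P <#> ?Q) dvd card P * card ?Q" using card_set_mult[OF Psg Qsg] by (metis dvd_triv_left)
    also have "\<dots> = p ^ (multiplicity p (order G) + multiplicity p (order G))"
      using sylow_card[OF P] sylow_card[OF Q] by (simp add: power_add)
    finally obtain k where "card (P <#> ?Q) = p ^ k"
      using sylow_prime[OF P] by (auto simp: divides_primepow_nat)
    then have "P <#> ?Q = P" using p_subgroup_card_le_sylow[OF P PQ] subset_set_mult1[OF Psg Qsg] by blast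
    then have "?Q \<subseteq> P" using subset_set_mult2[OF Psg Qsg] by simp
    then have "?Q = P" using cj_image_eqI[OF x(1) subgroup.subset[OF Psg] subgroup_finite[OF Psg]] by blast
    then show False using x by blast
  qed
  then show ?thesis using Psg by (auto simp: normal_cj_iff)
qed

lemma p_element_both_primes:
  assumes "Factorial_Ring.prime p" "Factorial_Ring.prime q" "p \<noteq> q" "p_element p x" "p_element q x"
  shows "x = \<one>"
proof -
  obtain i where i: "ord x = p ^ i" using assms(4) unfolding p_element_def by blast
  obtain j where j: "ord x = q ^ j" using assms(5) unfolding p_element_def by blast
  have "ord x dvd p ^ i" using i by simp
  moreover have "ord x dvd q ^ j" using j by simp
  ultimately have "ord x = 1" by (rule coprime_prime_powers[OF assms(1-3)])
  then show ?thesis using ord_eq_1 assms(4) by (simp add: p_element_def)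
qed

lemma int_pow_in_generate: "x \<in> carrier G \<Longrightarrow> y \<in> generate G {x} \<Longrightarrow> \<exists>k::int. y = x [^] k"
  using generate_pow by auto

text \<open>Distributivity for the cyclic subgroups of z = xy, x and y writes z = uv, where u = z^i
  is also a power of x and v = z^j a power of y. As i + j is 1 modulo the p-power ord z, one of i
  and j is prime to p (for z nontrivial), so u or v generates all powers of z. Hence z lies in the
  cyclic subgroup of x or of y, and the other factor with it.\<close>

lemma p_elements_comparable:
  assumes SD: Sp_distributive and all: "\<And>A. subgroup A G \<Longrightarrow> Sp A"
    and p: "Factorial_Ring.prime p" and x: "x \<in> carrier G" and y: "y \<in> carrier G" and xy: "p_element p (x \<otimes> y)"
  shows "x \<in> generate G {y} \<or> y \<in> generate G {x}"
proof -
  define z where "z = x \<otimes> y"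
  have z: "z \<in> carrier G" using x y by (simp add: z_def)
  let ?A = "generate G {z}" and ?B = "generate G {x}" and ?C = "generate G {y}"
  have sg: "subgroup ?A G" "subgroup ?B G" "subgroup ?C G" using x y z by (simp_all add: generate_is_subgroup)
  have mem: "z \<in> ?A" "x \<in> ?B" "y \<in> ?C" by (auto intro: generate.incl)
  have "z \<in> ?A \<inter> (?B <#> ?C)" using mem by (auto simp: z_def intro: set_multI)
  then have "z \<in> (?A \<inter> ?B) <#> (?A \<inter> ?C)"
    using SD all[OF sg(1)] all[OF sg(2)] all[OF sg(3)] unfolding Sp_distributive_def by blast
  then obtain u v where uv: "u \<in> ?A" "u \<in> ?B" "v \<in> ?A" "v \<in> ?C" "z = u \<otimes> v" by (auto elim: set_multE)
  obtain i j :: int where ij: "u = z [^] i" "v = z [^] j" using int_pow_in_generate[OF z] uv by blast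
  have "z [^] (1::int) = z [^] (i + j)" using uv(5) ij z by (simp add: int_pow_mult)
  then have dvd: "int (ord z) dvd i + j - 1" using int_pow_eq[OF z] by blast
  obtain k where k: "ord z = p ^ k" using xy by (auto simp: z_def p_element_def)
  have key: "z \<in> generate G {z [^] m}" if m: "\<not> int p dvd m" for m :: int
  proof -
    have "Factorial_Ring.prime (int p)" using p by simp
    then have "coprime (int p) m" using m by (rule prime_imp_coprime)
    then have "coprime m (int p)" by (simp add: coprime_commute)
    then have "coprime m (int (ord z))" by (simp add: k)
    then obtain s t where st: "s * m + t * int (ord z) = 1" using bezout_int[of m "int (ord z)"] by auto
    then have "m * s - 1 = int (ord z) * (- t)" by (simp add: algebra_simps)
    then have "int (ord z) dvd m * s - 1" by simp
    then have "z [^] (1::int) = z [^] (m * s)" using int_pow_eq[OF z] by blast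
    then have eq: "(z [^] m) [^] s = z" using z by (simp add: int_pow_pow)
    have "(z [^] m) [^] s \<in> generate G {z [^] m}"
      using z by (intro subgroup_int_pow_closed[OF generate_is_subgroup generate.incl]) auto
    then show ?thesis unfolding eq .
  qed
  have inB: "y \<in> ?B" if "z \<in> ?B"
  proof -
    have "inv x \<otimes> z \<in> ?B" using that mem(2) sg(2) by (simp add: subgroup.m_closed subgroup.m_inv_closed)
    then show ?thesis using x y by (simp add: z_def)
  qed
  have inC: "x \<in> ?C" if "z \<in> ?C"
  proof -
    have "z \<otimes> inv y \<in> ?C" using that mem(3) sg(3) by (simp add: subgroup.m_closed subgroup.m_inv_closed)
    then show ?thesis using x y by (simp add: z_def m_assoc)
  qed
  show ?thesis
  proof (cases "k = 0")
    \<comment> \<open>Here p does not divide ord z, but z is trivial and y is the inverse of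
      x.\<close>
    case True
    then have "z = \<one>" using k z ord_eq_1 by simp
    then show ?thesis using inB generate.one by metis
  next
    case False
    then have "int p dvd int (ord z)" unfolding k by simp
    then have "int p dvd i + j - 1" using dvd by (rule dvd_trans)
    moreover have "\<not> int p dvd 1" using prime_gt_1_nat[OF p] by simp
    moreover have "int p dvd 1" if "int p dvd i" "int p dvd j" "int p dvd i + j - 1"
      using dvd_diff[OF dvd_add[OF that(1,2)] that(3)] by simp
    ultimately have "\<not> int p dvd i \<or> \<not> int p dvd j" by blast
    then show ?thesis
    proof
      assume "\<not> int p dvd i"
      then have "z \<in> generate G {u}" using key ij by simp
      moreover have "generate G {u} \<subseteq> ?B" using uv sg(2) by (intro generate_subgroup_incl) auto
      ultimately show ?thesis using inB by blast
    next
      assume "\<not> int p dvd j"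
      then have "z \<in> generate G {v}" using key ij by simp
      moreover have "generate G {v} \<subseteq> ?C" using uv sg(3) by (intro generate_subgroup_incl) auto
      ultimately show ?thesis using inC by blast
    qed
  qed
qed

text \<open>Raised to the exponent ord (xy), the elements x and y become inverse to each other;
  their common order divides both ord x and ord y and is 1.\<close>

lemma ord_mult_coprime:
  assumes x: "x \<in> carrier G" and y: "y \<in> carrier G" and comm: "x \<otimes> y = y \<otimes> x" and cop: "coprime (ord x) (ord y)"
  shows "ord x * ord y dvd ord (x \<otimes> y)"
proof -
  let ?N = "ord (x \<otimes> y)"
  have "x [^] ?N \<otimes> y [^] ?N = \<one>" using pow_mult_distrib[OF comm x y, of ?N] x y pow_ord_eq_1[of "x \<otimes> y"] by simp
  then have eq: "x [^] ?N = inv (y [^] ?N)" using x y by (metis inv_equality nat_pow_closed)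
  define w where "w = x [^] ?N"
  have w: "w \<in> carrier G" using x by (simp add: w_def)
  have "w [^] ord x = \<one>" unfolding w_def using x by (metis nat_pow_pow mult.commute pow_ord_eq_1 nat_pow_one)
  then have 1: "ord w dvd ord x" using w by (simp add: pow_eq_id)
  have "(y [^] ?N) [^] ord y = \<one>" using y by (metis nat_pow_pow mult.commute pow_ord_eq_1 nat_pow_one)
  then have "ord (y [^] ?N) dvd ord y" using y by (simp add: pow_eq_id)
  then have 2: "ord w dvd ord y" using y eq by (simp add: w_def)
  have "ord w = 1" using 1 2 cop by (metis coprime_common_divisor nat_dvd_1_iff_1)
  then have w1: "w = \<one>" using w ord_eq_1 by blast
  then have "ord x dvd ?N" using x by (simp add: w_def pow_eq_id)
  moreover have "y [^] ?N = \<one>" using w1 eq y by (metis w_def inv_inv inv_one nat_pow_closed)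
  then have "ord y dvd ?N" using y by (simp add: pow_eq_id)
  ultimately show ?thesis using cop by (simp add: divides_mult)
qed

text \<open>An element \<open>x\<close> of maximal order generates: its \<open>q\<close>-part is comparable with every \<open>q\<close>-element \<open>y\<close>,
  and if \<open>y\<close> were not a power of it, multiplying \<open>y\<close> by the \<open>q'\<close>-part of \<open>x\<close> would increase the order.\<close>

theorem nilpotent_distributive_cyclic:
  assumes SD: Sp_distributive and n: "lower_central G n = {\<one>}"
  shows "cyclic_group G"
proof -
  have all: "Sp A" if A: "subgroup A G" for A
    using commut_normal[OF A nilpotent_sylow_normal[OF n]] by (intro SpI A) 
  \<comment> \<open>The commutator of elements of two normal Sylow subgroups lies in both, and only
    the identity has order a power of two different primes.\<close>
  have comm: "x \<otimes> y = y \<otimes> x" if pq: "Factorial_Ring.prime p" "Factorial_Ring.prime q" "p \<noteq> q"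
    and xy: "p_element p x" "p_element q y" for p q x y
  proof -
    obtain P where P: "sylow_subgroup p G P" "x \<in> P" using p_element_in_sylow[OF pq(1) xy(1)] by blast
    obtain Q where Q: "sylow_subgroup q G Q" "y \<in> Q" using p_element_in_sylow[OF pq(2) xy(2)] by blast
    have C: "x \<in> carrier G" "y \<in> carrier G" using xy by (simp_all add: p_element_def)
    have N: "P \<lhd> G" "Q \<lhd> G" using nilpotent_sylow_normal[OF n] P Q by blast+
    have sg: "subgroup P G" "subgroup Q G" using N by (simp_all add: normal_imp_subgroup)
    let ?c = "x \<otimes> y \<otimes> inv x \<otimes> inv y"
    have "x \<otimes> cj y (inv x) \<in> P" using N(1) P(2) C(2) sg(1) by (simp add: normal_cj_iff subgroup.m_closed subgroup.m_inv_closed)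
    then have "?c \<in> P" using C by (simp add: conj_by_def m_assoc)
    moreover have "cj x y \<otimes> inv y \<in> Q" using N(2) Q(2) C(1) sg(2) by (simp add: normal_cj_iff subgroup.m_closed subgroup.m_inv_closed)
    then have "?c \<in> Q" using C by (simp add: conj_by_def m_assoc)
    ultimately have "?c = \<one>"
      using p_element_both_primes[OF pq] sylow_p_element[OF P(1)] sylow_p_element[OF Q(1)] by blast
    then have "?c \<otimes> (y \<otimes> x) = y \<otimes> x" using C by simp
    then show ?thesis using C by (simp add: m_assoc)
  qed
  have comm': "y \<otimes> x = x \<otimes> y" if q: "Factorial_Ring.prime q" and y: "p_element q y" and x: "x \<in> carrier G" and cop: "coprime (ord x) q" for q x y
  proof -
    have yG: "y \<in> carrier G" using y by (simp add: p_element_def)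
    let ?T = "generate G {x}"
    have T: "subgroup ?T G" using x by (simp add: generate_is_subgroup)
    \<comment> \<open>Commuting with y is reduced to the elements of prime power order in the cyclic
      group of x, since these detect equality of subgroups; none of them except the identity has
      order a power of q.\<close>
    let ?Z = "{g \<in> ?T. y \<otimes> g = g \<otimes> y}"
    have TG: "g \<in> carrier G" if "g \<in> ?T" for g using subgroup.mem_carrier[OF T that] .
    have Z: "subgroup ?Z G"
    proof (rule subgroupI)
      show "?Z \<subseteq> carrier G" using TG by blast
      show "?Z \<noteq> {}" using generate.one[of G "{x}"] yG by fastforce
      show "inv a \<in> ?Z" if "a \<in> ?Z" for a
      proof -
        have a: "a \<in> ?T" "a \<in> carrier G" "y \<otimes> a = a \<otimes> y" using that TG by auto
        have "inv a \<otimes> (y \<otimes> a) \<otimes> inv a = inv a \<otimes> (a \<otimes> y) \<otimes> inv a" using a by simp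
        then have "inv a \<otimes> y = y \<otimes> inv a" using a(2) yG by (simp add: m_assoc)
        then show ?thesis using a subgroup.m_inv_closed[OF T] by simp
      qed
      show "a \<otimes> b \<in> ?Z" if "a \<in> ?Z" "b \<in> ?Z" for a b
      proof -
        have ab: "a \<in> ?T" "a \<in> carrier G" "y \<otimes> a = a \<otimes> y" "b \<in> ?T" "b \<in> carrier G" "y \<otimes> b = b \<otimes> y" using that TG by auto
        have "y \<otimes> (a \<otimes> b) = (y \<otimes> a) \<otimes> b" by (rule m_assoc[OF yG ab(2,5), symmetric])
        also have "\<dots> = a \<otimes> (y \<otimes> b)" unfolding ab(3) by (rule m_assoc[OF ab(2) yG ab(5)])
        also have "\<dots> = a \<otimes> b \<otimes> y" unfolding ab(6) by (rule m_assoc[OF ab(2,5) yG, symmetric])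
        finally show ?thesis using ab subgroup.m_closed[OF T] by simp
      qed
    qed
    have "?Z = ?T"
    proof (rule subgroup_eq_if_prime_power_elements[OF Z T])
      fix g r assume g: "g \<in> ?T" "Factorial_Ring.prime r" "p_element r g"
      show "g \<in> ?Z"
      proof (cases "r = q")
        case True
        then obtain k where k: "ord g = q ^ k" using g by (auto simp: p_element_def)
        have "ord g dvd ord x" using ord_dvd_card[OF T g(1)] by (simp add: generate_pow_card[OF x])
        then have "coprime (ord g) q" using cop by (metis coprime_divisors dvd_refl)
        then have "k = 0" using k q by (metis coprime_power_left_iff coprime_self not_prime_unit neq0_conv)
        then have "g = \<one>" using k ord_eq_1 g(3) by (simp add: p_element_def)
        then show ?thesis using g(1) yG by simp
      next
        case False
        then show ?thesis using comm[OF q g(2) _ y g(3)] g(1) by simp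
      qed
    qed auto
    then show ?thesis using generate.incl[of x "{x}" G] by blast
  qed
  have "Max (ord ` carrier G) \<in> ord ` carrier G" by (rule Max_in) auto
  then obtain x where x: "x \<in> carrier G" "ord x = Max (ord ` carrier G)" by auto
  have max: "ord g \<le> ord x" if "g \<in> carrier G" for g using that x(2) by (simp add: Max_ge)
  let ?T = "generate G {x}"
  have T: "subgroup ?T G" using x by (simp add: generate_is_subgroup)
  have "?T = carrier G"
  proof (rule subgroup_eq_if_prime_power_elements[OF T subgroup_self])
    show "?T \<subseteq> carrier G" using T by (rule subgroup.subset)
    fix y q assume y: "y \<in> carrier G" "Factorial_Ring.prime q" "p_element q y"
    show "y \<in> ?T"
    proof (rule ccontr)
      assume notin: "y \<notin> ?T"
      have ordx: "ord x > 0" using x(1) ord_ge_1 fin by (metis less_eq_Suc_le One_nat_def)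
      have "\<not> is_unit q" using y(2) by (metis not_prime_unit)
      then obtain m where m: "ord x = q ^ multiplicity q (ord x) * m" "\<not> q dvd m"
        using multiplicity_decompose'[of "ord x" q] ordx by auto
      define a where "a = multiplicity q (ord x)"
      have ox: "ord x = q ^ a * m" unfolding a_def by (rule m(1))
      have m0: "m > 0" using m ordx by (metis mult_0_right gr0I less_irrefl)
      \<comment> \<open>x1 is the q-part of x, and x2, of order m prime to q, is the complementary
        part.\<close>
      define x1 where "x1 = x [^] m"
      define x2 where "x2 = x [^] (q ^ a)"
      have C: "x1 \<in> carrier G" "x2 \<in> carrier G" using x by (simp_all add: x1_def x2_def)
      have o1: "ord x1 = q ^ a" unfolding x1_def using ord_pow[OF x(1), of m] ox m0 by simp
      have o2: "ord x2 = m" unfolding x2_def using ord_pow[OF x(1), of "q ^ a"] ox prime_gt_0_nat[OF y(2)] by simp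
      have x1T: "x1 \<in> ?T" unfolding x1_def using x(1) T generate.incl[of x "{x}" G]
        by (metis int_pow_int singletonI subgroup_int_pow_closed)
      obtain b where b: "ord y = q ^ b" using y by (auto simp: p_element_def)
      obtain Q where Q: "sylow_subgroup q G Q" "y \<in> Q" using p_element_in_sylow[OF y(2,3)] by blast
      obtain Q' where Q': "sylow_subgroup q G Q'" "x1 \<in> Q'"
        using p_element_in_sylow[OF y(2), of x1] C o1 by (auto simp: p_element_def)
      \<comment> \<open>A normal Sylow subgroup is the only one for its prime, so x1 and y lie in a
        common q-group and their product is a q-element, as comparability requires.\<close>
      have "Q' = Q"
      proof -
        obtain g where "g \<in> carrier G" "Q' = cj g ` Q" using sylow_conjugate[OF Q(1) Q'(1)] by blast
        then have "Q' \<subseteq> Q" using nilpotent_sylow_normal[OF n Q(1)] by (auto simp: normal_cj_iff)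
        then show ?thesis using subgroup_eq_card[OF sylow_subgrp[OF Q(1)]] sylow_card[OF Q(1)] sylow_card[OF Q'(1)] by simp
      qed
      then have "p_element q (x1 \<otimes> y)"
        using Q Q' sylow_p_element[OF Q(1)] subgroup.m_closed[OF sylow_subgrp[OF Q(1)]] by simp
      then have "x1 \<in> generate G {y} \<or> y \<in> generate G {x1}"
        using p_elements_comparable[OF SD all y(2) C(1) y(1)] by blast
      moreover have "generate G {x1} \<subseteq> ?T" using x1T T by (intro generate_subgroup_incl) auto
      ultimately have x1y: "x1 \<in> generate G {y}" using notin by blast
      have gy: "subgroup (generate G {y}) G" using y by (simp add: generate_is_subgroup)
      have "q ^ a dvd q ^ b" using ord_dvd_card[OF gy x1y] o1 b by (simp add: generate_pow_card[OF y(1), symmetric])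
      then have "a \<le> b" using prime_gt_1_nat[OF y(2)] power_dvd_imp_le by blast
      moreover have "a \<noteq> b"
      proof
        assume "a = b"
        have "generate G {x1} \<subseteq> generate G {y}" using x1y gy by (intro generate_subgroup_incl) auto
        moreover have "card (generate G {y}) \<le> card (generate G {x1})"
          using o1 b \<open>a = b\<close> generate_pow_card[OF y(1)] generate_pow_card[OF C(1)] by simp
        ultimately have "generate G {x1} = generate G {y}" using gy by (intro subgroup_eq_card)
        then have "y \<in> generate G {x1}" using generate.incl[of y "{y}" G] by simp
        then show False using \<open>generate G {x1} \<subseteq> ?T\<close> notin by blast
      qed
      ultimately have "a < b" by simp
      have cop: "coprime m q" using m(2) y(2) by (metis prime_imp_coprime coprime_commute)
      have "coprime (ord y) (ord x2)" using cop by (simp add: b o2 coprime_commute)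
      then have "ord y * ord x2 dvd ord (y \<otimes> x2)"
        using comm'[OF y(2,3) C(2)] cop o2 by (intro ord_mult_coprime y C) auto
      moreover have "ord (y \<otimes> x2) > 0" using ord_ge_1[OF fin, of "y \<otimes> x2"] y C by simp
      ultimately have "ord y * ord x2 \<le> ord (y \<otimes> x2)" by (intro dvd_imp_le)
      also have "\<dots> \<le> ord x" using y C by (intro max) auto
      finally have "q ^ b * m \<le> q ^ a * m" using b o2 ox by simp
      then have "q ^ b \<le> q ^ a" using m0 by simp
      then show False using \<open>a < b\<close> prime_gt_1_nat[OF y(2)] by simp
    qed
  qed
  then have "carrier G = range (\<lambda>k::int. x [^] k)"
    unfolding generate_pow[OF x(1)] full_SetCompr_eq[symmetric] by simp
  then show ?thesis using cyclic_group x(1) by blast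
qed

end

section \<open>The lattices\<close>

lemma inclusion_partial_order: "partial_order \<lparr>carrier = S, eq = (=), le = (\<subseteq>)\<rparr>"
  by unfold_locales auto

lemma inclusion_least_iff:
  "least \<lparr>carrier = S, eq = (=), le = (\<subseteq>)\<rparr> J (Upper \<lparr>carrier = S, eq = (=), le = (\<subseteq>)\<rparr> {A, B}) \<longleftrightarrow>
    J \<in> S \<and> A \<subseteq> J \<and> B \<subseteq> J \<and> (\<forall>Z\<in>S. A \<subseteq> Z \<longrightarrow> B \<subseteq> Z \<longrightarrow> J \<subseteq> Z)"
  if "A \<in> S" "B \<in> S"
proof -
  have "Upper \<lparr>carrier = S, eq = (=), le = (\<subseteq>)\<rparr> {A, B} = {u \<in> S. A \<subseteq> u \<and> B \<subseteq> u}"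
    unfolding Upper_def using that by (simp add: Int_insert_left) blast
  then show ?thesis unfolding least_def by simp blast
qed

lemma inclusion_greatest_iff:
  "greatest \<lparr>carrier = S, eq = (=), le = (\<subseteq>)\<rparr> J (Lower \<lparr>carrier = S, eq = (=), le = (\<subseteq>)\<rparr> {A, B}) \<longleftrightarrow>
    J \<in> S \<and> J \<subseteq> A \<and> J \<subseteq> B \<and> (\<forall>Z\<in>S. Z \<subseteq> A \<longrightarrow> Z \<subseteq> B \<longrightarrow> Z \<subseteq> J)"
  if "A \<in> S" "B \<in> S"
proof -
  have "Lower \<lparr>carrier = S, eq = (=), le = (\<subseteq>)\<rparr> {A, B} = {u \<in> S. u \<subseteq> A \<and> u \<subseteq> B}"
    unfolding Lower_def using that by (simp add: Int_insert_left) blast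
  then show ?thesis unfolding greatest_def by simp blast
qed

lemma inclusion_join:
  assumes "A \<in> S" "B \<in> S" "J \<in> S" "A \<subseteq> J" "B \<subseteq> J" "\<And>Z. Z \<in> S \<Longrightarrow> A \<subseteq> Z \<Longrightarrow> B \<subseteq> Z \<Longrightarrow> J \<subseteq> Z"
  shows "A \<squnion>\<^bsub>\<lparr>carrier = S, eq = (=), le = (\<subseteq>)\<rparr>\<^esub> B = J"
  unfolding join_def sup_def inclusion_least_iff[OF assms(1,2)]
  using assms by (intro some_equality) auto

lemma inclusion_meet:
  assumes "A \<in> S" "B \<in> S" "A \<inter> B \<in> S"
  shows "A \<sqinter>\<^bsub>\<lparr>carrier = S, eq = (=), le = (\<subseteq>)\<rparr>\<^esub> B = A \<inter> B"
  unfolding meet_def inf_def inclusion_greatest_iff[OF assms(1,2)]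
  using assms by (intro some_equality) auto

lemma inclusion_lattice:
  assumes Int: "\<And>A B. A \<in> S \<Longrightarrow> B \<in> S \<Longrightarrow> A \<inter> B \<in> S"
    and join: "\<And>A B. A \<in> S \<Longrightarrow> B \<in> S \<Longrightarrow>
      \<exists>J\<in>S. A \<subseteq> J \<and> B \<subseteq> J \<and> (\<forall>Z\<in>S. A \<subseteq> Z \<longrightarrow> B \<subseteq> Z \<longrightarrow> J \<subseteq> Z)"
  shows "lattice \<lparr>carrier = S, eq = (=), le = (\<subseteq>)\<rparr>"
proof -
  let ?L = "\<lparr>carrier = S, eq = (=), le = (\<subseteq>)\<rparr>"
  interpret partial_order ?L by (rule inclusion_partial_order)
  show ?thesis
  proof
    fix A B assume "A \<in> carrier ?L" "B \<in> carrier ?L"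
    then have AB: "A \<in> S" "B \<in> S" by auto
    show "\<exists>s. least ?L s (Upper ?L {A, B})"
      unfolding inclusion_least_iff[OF AB] using join[OF AB] by blast
    show "\<exists>s. greatest ?L s (Lower ?L {A, B})"
      unfolding inclusion_greatest_iff[OF AB] using Int[OF AB] by blast
  qed
qed

context finite_group
begin

lemma normal_generate_Un:
  assumes "A \<lhd> G" "B \<lhd> G" shows "generate G (A \<union> B) \<lhd> G"
proof (rule normal_generateI)
  show "A \<union> B \<subseteq> carrier G" using assms[THEN normal_imp_subgroup, THEN subgroup.subset] by simp
  show "\<And>h g. h \<in> A \<union> B \<Longrightarrow> g \<in> carrier G \<Longrightarrow> g \<otimes> h \<otimes> inv g \<in> A \<union> B"
    using assms by (auto simp: normal_inv_iff)
qed

lemma normal_Int: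
  assumes "A \<lhd> G" "B \<lhd> G" shows "A \<inter> B \<lhd> G"
  using assms by (auto simp: normal_cj_iff intro: subgroups_Inter_pair)

lemma Sp_lattice:
  shows S_permutable_lattice_lattice: "lattice (S_permutable_lattice G)"
    and S_permutable_join: "Sp A \<Longrightarrow> Sp B \<Longrightarrow> A \<squnion>\<^bsub>S_permutable_lattice G\<^esub> B = generate G (A \<union> B)"
    and S_permutable_meet: "Sp A \<Longrightarrow> Sp B \<Longrightarrow> A \<sqinter>\<^bsub>S_permutable_lattice G\<^esub> B = A \<inter> B"
proof -
  have gen: "A \<subseteq> generate G (A \<union> B)" "B \<subseteq> generate G (A \<union> B)" for A B
    by (auto intro: generate.incl)
  have least: "generate G (A \<union> B) \<subseteq> Z" if "Sp Z" "A \<subseteq> Z" "B \<subseteq> Z" for A B Z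
    using that Sp_subgroup by (intro generate_subgroup_incl) auto
  show "lattice (S_permutable_lattice G)"
    unfolding S_permutable_lattice_def
  proof (rule inclusion_lattice)
    fix A B assume "A \<in> {A. Sp A}" "B \<in> {A. Sp A}"
    then have AB: "Sp A" "Sp B" by auto
    show "A \<inter> B \<in> {A. Sp A}" using Sp_Int[OF AB] by simp
    show "\<exists>J\<in>{A. Sp A}. A \<subseteq> J \<and> B \<subseteq> J \<and> (\<forall>Z\<in>{A. Sp A}. A \<subseteq> Z \<longrightarrow> B \<subseteq> Z \<longrightarrow> J \<subseteq> Z)"
      using Sp_generate_Un[OF AB] gen[of A B] gen[of B A] least by (intro bexI[of _ "generate G (A \<union> B)"]) auto
  qed
  show "A \<squnion>\<^bsub>S_permutable_lattice G\<^esub> B = generate G (A \<union> B)" if "Sp A" "Sp B"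
    unfolding S_permutable_lattice_def using that Sp_generate_Un gen least by (intro inclusion_join) auto
  show "A \<sqinter>\<^bsub>S_permutable_lattice G\<^esub> B = A \<inter> B" if "Sp A" "Sp B"
    unfolding S_permutable_lattice_def using that Sp_Int by (intro inclusion_meet) auto
qed

lemma normal_lattice:
  shows normal_lattice_lattice: "lattice (normal_lattice G)"
    and normal_join: "A \<lhd> G \<Longrightarrow> B \<lhd> G \<Longrightarrow> A \<squnion>\<^bsub>normal_lattice G\<^esub> B = generate G (A \<union> B)"
    and normal_meet: "A \<lhd> G \<Longrightarrow> B \<lhd> G \<Longrightarrow> A \<sqinter>\<^bsub>normal_lattice G\<^esub> B = A \<inter> B"
proof -
  have gen: "A \<subseteq> generate G (A \<union> B)" "B \<subseteq> generate G (A \<union> B)" for A B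
    by (auto intro: generate.incl)
  have least: "generate G (A \<union> B) \<subseteq> Z" if "Z \<lhd> G" "A \<subseteq> Z" "B \<subseteq> Z" for A B Z
    using that normal_imp_subgroup by (intro generate_subgroup_incl) auto
  show "lattice (normal_lattice G)"
    unfolding normal_lattice_def
  proof (rule inclusion_lattice)
    fix A B assume "A \<in> {A. A \<lhd> G}" "B \<in> {A. A \<lhd> G}"
    then have AB: "A \<lhd> G" "B \<lhd> G" by auto
    show "A \<inter> B \<in> {A. A \<lhd> G}" using normal_Int[OF AB] by simp
    show "\<exists>J\<in>{A. A \<lhd> G}. A \<subseteq> J \<and> B \<subseteq> J \<and> (\<forall>Z\<in>{A. A \<lhd> G}. A \<subseteq> Z \<longrightarrow> B \<subseteq> Z \<longrightarrow> J \<subseteq> Z)"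
      using normal_generate_Un[OF AB] gen[of A B] gen[of B A] least by (intro bexI[of _ "generate G (A \<union> B)"]) auto
  qed
  show "A \<squnion>\<^bsub>normal_lattice G\<^esub> B = generate G (A \<union> B)" if "A \<lhd> G" "B \<lhd> G"
    unfolding normal_lattice_def using that normal_generate_Un gen least by (intro inclusion_join) auto
  show "A \<sqinter>\<^bsub>normal_lattice G\<^esub> B = A \<inter> B" if "A \<lhd> G" "B \<lhd> G"
    unfolding normal_lattice_def using that normal_Int by (intro inclusion_meet) auto
qed

lemma meet_distributive_Sp_iff:
  "meet_distributive (S_permutable_lattice G) A \<longleftrightarrow> Sp A \<and>
    (\<forall>B C. Sp B \<longrightarrow> Sp C \<longrightarrow> A \<inter> generate G (B \<union> C) = generate G ((A \<inter> B) \<union> (A \<inter> C)))"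
proof -
  have "carrier (S_permutable_lattice G) = {A. Sp A}" by (simp add: S_permutable_lattice_def)
  then show ?thesis
    unfolding meet_distributive_def
    by (simp add: S_permutable_join S_permutable_meet Sp_generate_Un Sp_Int Ball_def cong: conj_cong)
qed

lemma distributive_lattice_Sp_iff:
  "distributive_lattice (S_permutable_lattice G) \<longleftrightarrow>
    (\<forall>A B C. Sp A \<longrightarrow> Sp B \<longrightarrow> Sp C \<longrightarrow> A \<inter> generate G (B \<union> C) = generate G ((A \<inter> B) \<union> (A \<inter> C)))"
  unfolding distributive_lattice_def meet_distributive_Sp_iff
  using S_permutable_lattice_lattice by (auto simp: S_permutable_lattice_def)

lemma distributive_lattice_normal_iff:
  "distributive_lattice (normal_lattice G) \<longleftrightarrow>
    (\<forall>A B C. A \<lhd> G \<longrightarrow> B \<lhd> G \<longrightarrow> C \<lhd> G \<longrightarrow> A \<inter> generate G (B \<union> C) = generate G ((A \<inter> B) \<union> (A \<inter> C)))"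
proof -
  have "carrier (normal_lattice G) = {A. A \<lhd> G}" by (simp add: normal_lattice_def)
  then show ?thesis
    unfolding distributive_lattice_def meet_distributive_def
    using normal_lattice_lattice
    by (simp add: normal_join normal_meet normal_generate_Un normal_Int Ball_def)
qed

text \<open>From left to right, permutability is derived first, and then joins become products; from
  right to left, it is part of the definition.\<close>

lemma distributive_lattice_Sp_iff_Sp_distributive:
  "distributive_lattice (S_permutable_lattice G) \<longleftrightarrow> Sp_distributive"
proof
  assume "distributive_lattice (S_permutable_lattice G)"
  then have dist: "A \<inter> generate G (B \<union> C) = generate G ((A \<inter> B) \<union> (A \<inter> C))" if "Sp A" "Sp B" "Sp C" for A B C
    using that unfolding distributive_lattice_Sp_iff by blast
  have perm: "A <#> B = B <#> A" if "Sp A" "Sp B" for A B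
    using that dist by (intro distributive_imp_permutable) auto
  have gen: "generate G (A \<union> B) = A <#> B" if "Sp A" "Sp B" for A B
    using that perm by (intro generate_Un_eq_set_mult Sp_subgroup) auto
  have "A \<inter> (B <#> C) \<subseteq> (A \<inter> B) <#> (A \<inter> C)" if "Sp A" "Sp B" "Sp C" for A B C
    using dist[OF that] gen[OF that(2,3)] gen[OF Sp_Int[OF that(1,2)] Sp_Int[OF that(1,3)]] by simp
  then show Sp_distributive using perm unfolding Sp_distributive_def by blast
next
  assume SD: Sp_distributive
  have gen: "generate G (A \<union> B) = A <#> B" if "Sp A" "Sp B" for A B
    using SD that unfolding Sp_distributive_def by (intro generate_Un_eq_set_mult Sp_subgroup) auto
  show "distributive_lattice (S_permutable_lattice G)"
    unfolding distributive_lattice_Sp_iff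
  proof (intro allI impI)
    fix A B C assume A: "Sp A" and B: "Sp B" and C: "Sp C"
    have "A \<inter> (B <#> C) \<subseteq> (A \<inter> B) <#> (A \<inter> C)"
      using SD A B C unfolding Sp_distributive_def by blast
    then have 1: "A \<inter> generate G (B \<union> C) \<subseteq> generate G ((A \<inter> B) \<union> (A \<inter> C))"
      by (simp only: gen[OF B C] gen[OF Sp_Int[OF A B] Sp_Int[OF A C]])
    have "subgroup (A \<inter> generate G (B \<union> C)) G"
      using A Sp_generate_Un[OF B C] by (intro subgroups_Inter_pair Sp_subgroup)
    then have "generate G ((A \<inter> B) \<union> (A \<inter> C)) \<subseteq> A \<inter> generate G (B \<union> C)"
      by (intro generate_subgroup_incl) (auto intro: generate.incl)
    with 1 show "A \<inter> generate G (B \<union> C) = generate G ((A \<inter> B) \<union> (A \<inter> C))" by blast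
  qed
qed

text \<open>Normal subgroups have the same meets and joins in both lattices, so the normal lattice
  inherits distributivity. Cyclicity and the coincidence of sections come from carrying
  \<open>Sp_distributive\<close> to factor groups, the one by the residual being nilpotent.\<close>

theorem Sp_distributive_imp_conditions:
  assumes SD: Sp_distributive
  shows "\<forall>A \<in> carrier (S_permutable_lattice G). \<forall>B \<in> carrier (S_permutable_lattice G). permutable_sets G A B"
    and "distributive_lattice (normal_lattice G)"
    and "cyclic_group (G Mod nilpotent_residual G)"
    and "meet_distributive (S_permutable_lattice G) (nilpotent_residual G)"
    and "R \<lhd> G \<Longrightarrow> Factorial_Ring.prime p \<Longrightarrow> isomorphic_sections_coincide p (G Mod R)"
proof -
  have dist: "distributive_lattice (S_permutable_lattice G)"
    using SD distributive_lattice_Sp_iff_Sp_distributive by blast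
  show "\<forall>A \<in> carrier (S_permutable_lattice G). \<forall>B \<in> carrier (S_permutable_lattice G). permutable_sets G A B"
    using SD unfolding Sp_distributive_def by (simp add: S_permutable_lattice_def permutable_sets_def)
  show "distributive_lattice (normal_lattice G)"
    using dist Sp_normal unfolding distributive_lattice_normal_iff distributive_lattice_Sp_iff by simp
  have D: "nilpotent_residual G \<lhd> G" by (rule nilpotent_residual_normal)
  show "meet_distributive (S_permutable_lattice G) (nilpotent_residual G)"
    using dist Sp_normal[OF D] unfolding meet_distributive_Sp_iff distributive_lattice_Sp_iff by simp
  have quot: "finite_group.Sp_distributive (G Mod N)" if N: "N \<lhd> G" for N
  proof -
    interpret e: finite_epimorphism G "G Mod N" "\<lambda>x. N #> x" by (rule finite_epimorphism_FactGroup[OF N])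
    show ?thesis using e.Sp_distributive_image[OF SD] .
  qed
  show "cyclic_group (G Mod nilpotent_residual G)"
  proof -
    interpret Q: finite_group "G Mod nilpotent_residual G" by (rule finite_group_FactGroup[OF D])
    obtain n where "lower_central G n \<subseteq> nilpotent_residual G" using lower_central_subset_residual by blast
    then have "lower_central (G Mod nilpotent_residual G) n = {\<one>\<^bsub>G Mod nilpotent_residual G\<^esub>}"
      using lower_central_subset_iff[OF D] by blast
    then show ?thesis using Q.nilpotent_distributive_cyclic[OF quot[OF D]] by blast
  qed
  show "isomorphic_sections_coincide p (G Mod R)" if R: "R \<lhd> G" and p: "Factorial_Ring.prime p"
    using finite_group.Sp_distributive_imp_sections_coincide[OF finite_group_FactGroup[OF R] quot[OF R] p] .
qed

end

section \<open>Covering diamonds\<close>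

context finite_group
begin

definition Sp_covers :: "'a set \<Rightarrow> 'a set \<Rightarrow> bool" where
  "Sp_covers K A \<longleftrightarrow> Sp K \<and> Sp A \<and> K \<subseteq> A \<and> K \<noteq> A \<and>
    (\<forall>Z. Sp Z \<longrightarrow> K \<subseteq> Z \<longrightarrow> Z \<subseteq> A \<longrightarrow> Z = K \<or> Z = A)"

text \<open>The five-element modular nondistributive lattice with top \<open>A <#> B\<close>, all of
  whose edges are covers. Products are listed in both orders, so that rewriting and taking images
  need no separate permutability.\<close>

definition covering_diamond :: "'a set \<Rightarrow> 'a set \<Rightarrow> 'a set \<Rightarrow> 'a set \<Rightarrow> bool" where
  "covering_diamond K A B C \<longleftrightarrow> Sp_covers K A \<and> Sp_covers K B \<and> Sp_covers K C \<and>
    A \<inter> B = K \<and> A \<inter> C = K \<and> B \<inter> C = K \<and>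
    A <#> B = B <#> A \<and> A <#> C = A <#> B \<and> B <#> C = A <#> B \<and> C <#> A = A <#> B \<and> C <#> B = A <#> B \<and>
    Sp_covers A (A <#> B) \<and> Sp_covers B (A <#> B) \<and> Sp_covers C (A <#> B)"

lemma Sp_coversD:
  assumes "Sp_covers K A"
  shows "Sp K" "Sp A" "K \<subseteq> A" "K \<noteq> A" "Sp Z \<Longrightarrow> K \<subseteq> Z \<Longrightarrow> Z \<subseteq> A \<Longrightarrow> Z = K \<or> Z = A"
  using assms by (simp_all add: Sp_covers_def)

lemma Sp_covers_cj:
  assumes "Sp_covers K A" "t \<in> A" shows "cj t ` K = K"
  using Sp_maximal_cj[OF Sp_coversD[OF assms(1)] assms(2)] .

section \<open>Modular lattice arguments under permutability\<close>

context
  assumes perm: "\<And>A B. Sp A \<Longrightarrow> Sp B \<Longrightarrow> A <#> B = B <#> A"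
begin

lemma perm_Sp: "Sp A \<Longrightarrow> Sp B \<Longrightarrow> Sp (A <#> B)"
  by (intro Sp_set_mult perm)

lemma perm_upper: "Sp A \<Longrightarrow> Sp B \<Longrightarrow> A \<subseteq> A <#> B" "Sp A \<Longrightarrow> Sp B \<Longrightarrow> B \<subseteq> A <#> B"
  by (intro subset_set_mult1 subset_set_mult2 Sp_subgroup; assumption)+

lemma perm_least: "Sp C \<Longrightarrow> A \<subseteq> C \<Longrightarrow> B \<subseteq> C \<Longrightarrow> A <#> B \<subseteq> C"
  by (intro subgroup_set_mult_subset Sp_subgroup)

lemma perm_assoc: "Sp A \<Longrightarrow> Sp B \<Longrightarrow> Sp C \<Longrightarrow> (A <#> B) <#> C = A <#> (B <#> C)"
  by (simp add: set_mult_assoc Sp_subgroup subgroup.subset)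

lemma perm_modular: "Sp A \<Longrightarrow> Sp B \<Longrightarrow> Sp C \<Longrightarrow> A \<subseteq> C \<Longrightarrow> (A <#> B) \<inter> C = A <#> (B \<inter> C)"
  by (simp add: dedekind_right Sp_subgroup subgroup.subset)

lemma perm_absorb: "Sp A \<Longrightarrow> Sp B \<Longrightarrow> B \<subseteq> A \<Longrightarrow> A <#> B = A"
  by (simp add: set_mult_absorb_right Sp_subgroup)

text \<open>\<open>A\<close> and \<open>B\<close> are perspective through \<open>C\<close>. A member
  Z between \<open>m\<close> and \<open>B\<close> is recovered as the intersection of ZC with
  \<open>B\<close>, and ZC is in turn determined by its trace on \<open>A\<close>, which is
  \<open>m\<close> or \<open>A\<close>.\<close>

lemma Sp_covers_perspective:
  assumes cov: "Sp_covers m A" and B: "Sp B" "m \<subseteq> B" and C: "Sp C"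
    and eq: "A \<inter> C = m" "B \<inter> C = m" "C <#> A = C <#> B"
  shows "Sp_covers m B"
proof -
  have Sp: "Sp m" "Sp A" and mA: "m \<subseteq> A" "m \<noteq> A" using cov by (auto simp: Sp_covers_def)
  have mC: "m \<subseteq> C" using eq by blast
  have "m \<noteq> B"
  proof
    assume "m = B"
    then have "C <#> A = C" using eq(3) perm_absorb[OF C Sp(1) mC] by simp
    then have "A \<subseteq> C" using perm_upper(2)[OF C Sp(2)] by simp
    then show False using eq mA by blast
  qed
  moreover have "Z = m \<or> Z = B" if Z: "Sp Z" "m \<subseteq> Z" "Z \<subseteq> B" for Z
  proof -
    let ?Y = "A \<inter> (Z <#> C)"
    have ZC: "Sp (Z <#> C)" using perm_Sp[OF Z(1) C] .
    have up: "Z \<subseteq> Z <#> C" "C \<subseteq> Z <#> C" using perm_upper[OF Z(1) C] .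
    have "?Y = m \<or> ?Y = A"
      using cov Sp_Int[OF Sp(2) ZC] up mA Z(2) unfolding Sp_covers_def by blast
    moreover have "Z = (Z <#> C) \<inter> B"
    proof -
      have "(Z <#> C) \<inter> B = Z <#> (C \<inter> B)" using perm_modular[OF Z(1) C B(1) Z(3)] .
      also have "C \<inter> B = m" using eq by blast
      also have "Z <#> m = Z" using perm_absorb[OF Z(1) Sp(1) Z(2)] .
      finally show ?thesis by simp
    qed
    moreover have "Z <#> C = C <#> ?Y"
    proof -
      have "C <#> ?Y = (C <#> A) \<inter> (Z <#> C)" using perm_modular[OF C Sp(2) ZC up(2)] by simp
      also have "\<dots> = Z <#> C"
      proof -
        have "Z <#> C \<subseteq> C <#> B"
          using Z(3) perm_upper[OF C B(1)] by (intro perm_least perm_Sp C B) auto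
        then show ?thesis using eq(3) by blast
      qed
      finally show ?thesis by simp
    qed
    ultimately have "Z = (C <#> m) \<inter> B \<or> Z = (C <#> A) \<inter> B" by metis
    moreover have "(C <#> m) \<inter> B = m" using perm_absorb[OF C Sp(1) mC] eq(2) by blast
    moreover have "(C <#> A) \<inter> B = B" using eq(3) perm_upper(2)[OF C B(1)] by auto
    ultimately show ?thesis by simp
  qed
  ultimately show ?thesis using Sp(1) B unfolding Sp_covers_def by blast
qed

text \<open>By Dedekind's law a member Z between \<open>A\<close> and AB is the product of
  \<open>A\<close> with \<open>B \<inter> Z\<close>, and the latter is \<open>m\<close> or
  \<open>B\<close>.\<close>

lemma Sp_covers_join:
  assumes cov: "Sp_covers m B" and A: "Sp A" and eq: "A \<inter> B = m"
  shows "Sp_covers A (A <#> B)"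
proof -
  have Sp: "Sp m" "Sp B" and mB: "m \<subseteq> B" "m \<noteq> B" using cov by (auto simp: Sp_covers_def)
  have mA: "m \<subseteq> A" using eq by blast
  have up: "A \<subseteq> A <#> B" "B \<subseteq> A <#> B" using perm_upper[OF A Sp(2)] .
  have "A \<noteq> A <#> B" using up(2) eq mB by blast
  moreover have "Z = A \<or> Z = A <#> B" if Z: "Sp Z" "A \<subseteq> Z" "Z \<subseteq> A <#> B" for Z
  proof -
    have "Z = (A <#> B) \<inter> Z" using Z(3) by blast
    also have "\<dots> = A <#> (B \<inter> Z)" using perm_modular[OF A Sp(2) Z(1,2)] .
    finally have "Z = A <#> (B \<inter> Z)" .
    moreover have "B \<inter> Z = m \<or> B \<inter> Z = B"
      using cov Sp_Int[OF Sp(2) Z(1)] mA mB Z(2) unfolding Sp_covers_def by blast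
    ultimately show ?thesis using perm_absorb[OF A Sp(1) mA] by metis
  qed
  ultimately show ?thesis using A perm_Sp[OF A Sp(2)] up unfolding Sp_covers_def by blast
qed

lemma covering_diamond_exists:
  assumes "\<not> Sp_distributive"
  shows "\<exists>K A B C. covering_diamond K A B C"
proof -
  \<comment> \<open>Replacing a by its intersection with bc changes neither its meet with b nor that
    with c, so failures may be sought among members J below bc, and minimality can be measured by J
    alone.\<close>
  define bad where "bad = (\<lambda>J. Sp J \<and> (\<exists>b c. Sp b \<and> Sp c \<and> J \<subseteq> b <#> c \<and> \<not> J \<subseteq> (J \<inter> b) <#> (J \<inter> c)))"
  obtain a b c where abc: "Sp a" "Sp b" "Sp c" "\<not> a \<inter> (b <#> c) \<subseteq> (a \<inter> b) <#> (a \<inter> c)"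
    using assms perm unfolding Sp_distributive_def by blast
  have "bad (a \<inter> (b <#> c))"
  proof -
    let ?J = "a \<inter> (b <#> c)"
    have "?J \<inter> b = a \<inter> b" "?J \<inter> c = a \<inter> c" using perm_upper[OF abc(2,3)] by auto
    then have "\<not> ?J \<subseteq> (?J \<inter> b) <#> (?J \<inter> c)" using abc(4) by simp
    moreover have "Sp ?J" using Sp_Int[OF abc(1) perm_Sp[OF abc(2,3)]] .
    ultimately show ?thesis unfolding bad_def using abc by blast
  qed
  \<comment> \<open>A minimal \<open>J\<close> for which distributivity fails has a largest proper member \<open>J0\<close>. Shrinking
    \<open>b\<close> and \<open>c\<close> until all pairs of \<open>J\<close>, \<open>b\<close>, \<open>c\<close> have the same product, the usual median
    construction gives a diamond, and \<open>m\<close> is covered by \<open>A\<close> because \<open>J\<close> covers \<open>J0\<close>.\<close>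
  then obtain J where J: "bad J" "\<And>J'. bad J' \<Longrightarrow> card J \<le> card J'"
    using ex_has_least_nat[of bad _ card] by blast
  obtain b0 c0 where bc0: "Sp b0" "Sp c0" "J \<subseteq> b0 <#> c0" "\<not> J \<subseteq> (J \<inter> b0) <#> (J \<inter> c0)" and SJ: "Sp J"
    using J(1) unfolding bad_def by blast
  define b where "b = b0 \<inter> (J <#> c0)"
  have Sb: "Sp b" unfolding b_def using bc0 SJ by (intro Sp_Int perm_Sp)
  define c where "c = c0 \<inter> (J <#> b)"
  have Sc: "Sp c" unfolding c_def using bc0 SJ Sb by (intro Sp_Int perm_Sp)
  have Jc0: "J <#> c0 = c0 <#> b"
  proof -
    have "c0 <#> b = (c0 <#> b0) \<inter> (J <#> c0)"
      unfolding b_def using perm_modular[OF bc0(2,1) perm_Sp[OF SJ bc0(2)] perm_upper(2)[OF SJ bc0(2)]] by simp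
    moreover have "J <#> c0 \<subseteq> c0 <#> b0"
      using bc0(3) perm[OF bc0(1,2)] perm_upper[OF bc0(2,1)] by (intro perm_least perm_Sp bc0) auto
    ultimately show ?thesis by blast
  qed
  have Jb_le: "J <#> b \<subseteq> J <#> c0"
    using perm_upper[OF SJ bc0(2)] by (intro perm_least perm_Sp SJ bc0) (auto simp: b_def)
  have Jb: "J <#> b = b <#> c"
  proof -
    have "b <#> c = (b <#> c0) \<inter> (J <#> b)"
      unfolding c_def using perm_modular[OF Sb bc0(2) perm_Sp[OF SJ Sb] perm_upper(2)[OF SJ Sb]] by simp
    then show ?thesis using Jb_le Jc0 perm[OF bc0(2) Sb] by blast
  qed
  have Jc: "J <#> c = b <#> c"
  proof -
    have "J <#> c = (J <#> c0) \<inter> (J <#> b)"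
      unfolding c_def using perm_modular[OF SJ bc0(2) perm_Sp[OF SJ Sb] perm_upper(1)[OF SJ Sb]] by simp
    then show ?thesis using Jb_le Jb by blast
  qed
  \<comment> \<open>The shrinking is invisible to J, which lies below Jc0 and Jb; so the failure
    survives it.\<close>
  have Jb0: "J \<inter> b = J \<inter> b0" using perm_upper(1)[OF SJ bc0(2)] by (auto simp: b_def)
  have Jc0': "J \<inter> c = J \<inter> c0" using perm_upper(1)[OF SJ Sb] by (auto simp: c_def)
  define J0 where "J0 = (J \<inter> b) <#> (J \<inter> c)"
  have SJb: "Sp (J \<inter> b)" and SJc: "Sp (J \<inter> c)" and Sbc: "Sp (b \<inter> c)" using SJ Sb Sc by (auto intro: Sp_Int)
  have SJ0: "Sp J0" unfolding J0_def using SJb SJc by (rule perm_Sp)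
  have J0J: "J0 \<subseteq> J" unfolding J0_def by (intro perm_least SJ) auto
  have J0ne: "\<not> J \<subseteq> J0" using bc0(4) Jb0 Jc0' by (simp add: J0_def)
  have small: "Z \<subseteq> J0" if Z: "Sp Z" "Z \<subseteq> J" "Z \<noteq> J" for Z
  proof -
    have "card Z < card J" using Z subgroup_finite[OF Sp_subgroup[OF SJ]] by (intro psubset_card_mono) auto
    then have "\<not> bad Z" using J(2) by (meson not_le)
    moreover have "Z \<subseteq> b0 <#> c0" using Z(2) bc0(3) by (rule subset_trans)
    ultimately have "Z \<subseteq> (Z \<inter> b0) <#> (Z \<inter> c0)" using Z(1) bc0 unfolding bad_def by blast
    also have "\<dots> \<subseteq> J0" unfolding J0_def Jb0 Jc0' using Z(2) by (intro mono_set_mult) auto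
    finally show ?thesis .
  qed
  let ?bc = "b \<inter> c"
  \<comment> \<open>m is the join of the three pairwise meets. The meet of the three pairwise joins
    is bc, as these joins coincide, so the middle elements are just J, b and c joined with m,
    simplified by absorption.\<close>
  define m where "m = J0 <#> ?bc"
  define A where "A = ?bc <#> J"
  define B where "B = (J \<inter> c) <#> b"
  define C where "C = (J \<inter> b) <#> c"
  have S: "Sp m" "Sp A" "Sp B" "Sp C"
    unfolding m_def A_def B_def C_def by (intro perm_Sp SJ0 Sbc SJ SJc SJb Sb Sc)+
  have A_up: "?bc \<subseteq> A" "J \<subseteq> A" unfolding A_def using perm_upper[OF Sbc SJ] .
  have B_up: "J \<inter> c \<subseteq> B" "b \<subseteq> B" unfolding B_def using perm_upper[OF SJc Sb] .
  have C_up: "J \<inter> b \<subseteq> C" "c \<subseteq> C" unfolding C_def using perm_upper[OF SJb Sc] .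
  have m_eq: "?bc <#> J0 = m" unfolding m_def using perm[OF Sbc SJ0] .
  have JB: "J \<inter> B = J0"
  proof -
    have "B \<inter> J = (J \<inter> c) <#> (b \<inter> J)" unfolding B_def using perm_modular[OF SJc Sb SJ] by simp
    also have "b \<inter> J = J \<inter> b" by blast
    also have "(J \<inter> c) <#> (J \<inter> b) = J0" unfolding J0_def using perm[OF SJc SJb] .
    finally show ?thesis by blast
  qed
  have JC: "J \<inter> C = J0"
  proof -
    have "C \<inter> J = (J \<inter> b) <#> (c \<inter> J)" unfolding C_def using perm_modular[OF SJb Sc SJ] by simp
    also have "c \<inter> J = J \<inter> c" by blast
    finally show ?thesis unfolding J0_def by blast
  qed
  have AB: "A \<inter> B = m"
    using perm_modular[OF Sbc SJ S(3)] B_up JB m_eq by (simp add: A_def le_infI1)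
  have AC: "A \<inter> C = m"
    using perm_modular[OF Sbc SJ S(4)] C_up JC m_eq by (simp add: A_def le_infI2)
  have BC: "B \<inter> C = m"
  proof -
    have "C \<inter> b = (J \<inter> b) <#> (c \<inter> b)" unfolding C_def using perm_modular[OF SJb Sc Sb] by simp
    then have bC: "b \<inter> C = (J \<inter> b) <#> ?bc" by (simp add: Int_commute)
    have "B \<inter> C = (J \<inter> c) <#> (b \<inter> C)"
      unfolding B_def using perm_modular[OF SJc Sb S(4)] C_up by (simp add: le_infI2)
    also have "\<dots> = ((J \<inter> c) <#> (J \<inter> b)) <#> ?bc" unfolding bC using perm_assoc[OF SJc SJb Sbc] by simp
    also have "\<dots> = m" unfolding m_def J0_def using perm[OF SJc SJb] by simp
    finally show ?thesis .
  qed
  let ?M = "b <#> c"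
  have SM: "Sp ?M" using perm_Sp[OF Sb Sc] .
  have M_up: "b \<subseteq> ?M" "c \<subseteq> ?M" "J \<subseteq> ?M"
    using perm_upper[OF Sb Sc] perm_upper(1)[OF SJ Sb] Jb by auto
  have le: "A \<subseteq> ?M" "B \<subseteq> ?M" "C \<subseteq> ?M"
    unfolding A_def B_def C_def by (rule perm_least[OF SM]; use M_up in blast)+
  have joinI: "U <#> V = ?M" if "Sp U" "Sp V" "U \<subseteq> ?M" "V \<subseteq> ?M" "u \<subseteq> U" "v \<subseteq> V" "u <#> v = ?M" for U V u v
  proof
    show "U <#> V \<subseteq> ?M" using that by (intro perm_least[OF SM])
    show "?M \<subseteq> U <#> V" using mono_set_mult[OF that(5,6), of G] that(7) by simp
  qed
  have joins: "A <#> B = ?M" "B <#> A = ?M" "A <#> C = ?M" "C <#> A = ?M" "B <#> C = ?M" "C <#> B = ?M"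
    using joinI[OF S(2,3) le(1,2) A_up(2) B_up(2) Jb] joinI[OF S(2,4) le(1,3) A_up(2) C_up(2) Jc]
      joinI[OF S(3,4) le(2,3) B_up(2) C_up(2) refl] perm[OF S(2,3)] perm[OF S(2,4)] perm[OF S(3,4)] by auto
  have covA: "Sp_covers m A"
  proof -
    have "m \<noteq> A"
    proof
      assume "m = A"
      then have "J = (J0 <#> ?bc) \<inter> J" using A_up(2) m_def by blast
      also have "\<dots> = J0 <#> (?bc \<inter> J)" using perm_modular[OF SJ0 Sbc SJ J0J] .
      also have "\<dots> \<subseteq> J0"
      proof (rule perm_least[OF SJ0 order_refl])
        show "?bc \<inter> J \<subseteq> J0" unfolding J0_def using perm_upper(1)[OF SJb SJc] by blast
      qed
      finally show False using J0ne by blast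
    qed
    moreover have "m \<subseteq> A" using AB by blast
    moreover have "Z = m \<or> Z = A" if Z: "Sp Z" "m \<subseteq> Z" "Z \<subseteq> A" for Z
    proof -
      have bcm: "?bc \<subseteq> m" "J0 \<subseteq> m" unfolding m_def using perm_upper[OF SJ0 Sbc] by auto
      have "Z = A \<inter> Z" using Z(3) by blast
      also have "\<dots> = ?bc <#> (J \<inter> Z)" unfolding A_def
        using perm_modular[OF Sbc SJ Z(1)] bcm Z(2) by blast
      finally have Zeq: "Z = ?bc <#> (J \<inter> Z)" .
      show ?thesis
      proof (cases "J \<inter> Z = J")
        case True
        then show ?thesis using Zeq by (simp add: A_def)
      next
        case False
        then have "J \<inter> Z \<subseteq> m" using small[OF Sp_Int[OF SJ Z(1)]] bcm by blast
        then have "?bc <#> (J \<inter> Z) \<subseteq> m" using bcm by (intro perm_least[OF S(1)])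
        then show ?thesis using Zeq Z(2) by blast
      qed
    qed
    ultimately show ?thesis using S unfolding Sp_covers_def by blast
  qed
  \<comment> \<open>B and C inherit the cover from A by perspectivity through the remaining middle
    element.\<close>
  have covB: "Sp_covers m B"
    using AC BC joins by (intro Sp_covers_perspective[OF covA S(3) _ S(4)]) auto
  have covC: "Sp_covers m C"
    using AB BC joins by (intro Sp_covers_perspective[OF covA S(4) _ S(3)]) auto
  have "Sp_covers A ?M" using Sp_covers_join[OF covB S(2) AB] joins by simp
  moreover have "Sp_covers B ?M" using Sp_covers_join[OF covC S(3) BC] joins by simp
  moreover have "Sp_covers C ?M"
    using Sp_covers_join[OF covA S(4)] AC joins by (simp add: Int_commute)
  ultimately have "covering_diamond m A B C"
    unfolding covering_diamond_def using covA covB covC AB AC BC joins by simp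
  then show ?thesis by blast
qed

end

text \<open>Commutators of \<open>A\<close> with \<open>B\<close> and with \<open>C\<close> lie in
  \<open>A \<inter> B\<close> and \<open>A \<inter> C\<close>, hence in \<open>K\<close>, because
  all these subgroups are normal in \<open>M\<close>. As \<open>A\<close> lies in BC, the identity
  [x, bc] = [x, b] b[x, c]b^-1 makes A/K abelian. This is where having three complements rather than
  two matters.\<close>

lemma diamond_commutator:
  assumes sg: "subgroup K G" "subgroup A G" "subgroup B G" "subgroup C G" "subgroup M G"
    and sub: "A \<subseteq> M" "B \<subseteq> M" "C \<subseteq> M" "A \<subseteq> B <#> C"
    and eq: "A \<inter> B \<subseteq> K" "A \<inter> C \<subseteq> K"
    and inv: "\<And>t. t \<in> M \<Longrightarrow> cj t ` K = K" "\<And>t. t \<in> M \<Longrightarrow> cj t ` A = A"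
      "\<And>t. t \<in> M \<Longrightarrow> cj t ` B = B" "\<And>t. t \<in> M \<Longrightarrow> cj t ` C = C"
    and xy: "x \<in> A" "y \<in> A"
  shows "x \<otimes> y \<otimes> inv x \<otimes> inv y \<in> K"
proof -
  interpret A: subgroup A G by fact
  interpret B: subgroup B G by fact
  interpret C: subgroup C G by fact
  interpret M: subgroup M G by fact
  have comm: "x \<otimes> z \<otimes> inv x \<otimes> inv z \<in> A \<inter> S"
    if S: "subgroup S G" "S \<subseteq> M" "\<And>t. t \<in> M \<Longrightarrow> cj t ` S = S" and z: "z \<in> S" for z S
  proof -
    interpret S: subgroup S G by fact
    have M: "x \<in> M" "z \<in> M" using subsetD[OF sub(1) xy(1)] subsetD[OF S(2) z] .
    have "cj z (inv x) \<in> A" using inv(2)[OF M(2)] A.m_inv_closed[OF xy(1)] by blast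
    then have "x \<otimes> cj z (inv x) \<in> A" using xy by simp
    moreover have "cj x z \<in> S" using S(3)[OF M(1)] z by blast
    then have "cj x z \<otimes> inv z \<in> S" using z by simp
    ultimately show ?thesis using M by (simp add: conj_by_def m_assoc)
  qed
  have "y \<in> B <#> C" using xy(2) sub(4) by blast
  then obtain b c where bc: "b \<in> B" "c \<in> C" "y = b \<otimes> c" by (rule set_multE)
  have 1: "x \<otimes> b \<otimes> inv x \<otimes> inv b \<in> K" using comm[OF sg(3) sub(2) inv(3) bc(1)] eq by blast
  have "x \<otimes> c \<otimes> inv x \<otimes> inv c \<in> K" using comm[OF sg(4) sub(3) inv(4) bc(2)] eq by blast
  then have 2: "cj b (x \<otimes> c \<otimes> inv x \<otimes> inv c) \<in> K" using inv(1)[of b] bc(1) sub by blast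
  have "x \<otimes> y \<otimes> inv x \<otimes> inv y = (x \<otimes> b \<otimes> inv x \<otimes> inv b) \<otimes> cj b (x \<otimes> c \<otimes> inv x \<otimes> inv c)"
    using xy(1) bc by (simp add: conj_by_def m_assoc inv_mult_group)
  then show ?thesis using 1 2 sg(1) by (simp add: subgroup.m_closed)
qed

text \<open>The p-elements of an abelian normal subgroup form a normal subgroup of p-power order,
  and such a subgroup lies in every Sylow p-subgroup.\<close>

lemma normal_abelian_p_element:
  assumes p: "Factorial_Ring.prime p" and N: "N \<lhd> G" and ab: "\<And>x y. x \<in> N \<Longrightarrow> y \<in> N \<Longrightarrow> x \<otimes> y = y \<otimes> x"
    and x: "x \<in> N" "p_element p x"
  shows "x \<in> sylow_core p"
proof -
  interpret N: normal N G by fact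
  let ?V = "{y \<in> N. p_element p y}"
  have V: "subgroup ?V G"
  proof (rule subgroupI)
    show "?V \<subseteq> carrier G" by auto
    show "?V \<noteq> {}" using x by blast
    show "inv a \<in> ?V" if "a \<in> ?V" for a using that by (simp add: p_element_def)
    show "a \<otimes> b \<in> ?V" if V: "a \<in> ?V" "b \<in> ?V" for a b
    proof -
      have C: "a \<in> N" "b \<in> N" "a \<in> carrier G" "b \<in> carrier G" using V by auto
      obtain i where i: "ord a = p ^ i" using V(1) by (auto simp: p_element_def)
      obtain j where j: "ord b = p ^ j" using V(2) by (auto simp: p_element_def)
      have "ord (a \<otimes> b) dvd p ^ (i + j)" using ord_mul_divides[OF ab C(3,4)] C i j by (simp add: power_add)
      then have "\<exists>k. ord (a \<otimes> b) = p ^ k" using p by (auto simp: divides_primepow_nat)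
      then show ?thesis using C by (simp add: p_element_def)
    qed
  qed
  have "?V \<lhd> G" using V N by (auto simp: normal_cj_iff p_element_cj)
  then have SV: "Sp ?V" by (rule Sp_normal)
  have "y = \<one>" if "y \<in> ?V" "other_prime_element p y" for y
    using that p_element_both_primes[OF p] by (auto simp: other_prime_element_def)
  then obtain j where "card ?V = card {\<one>} * p ^ j"
    using p_power_subgroup_index[OF p triv_subgroup V] subgroup.one_closed[OF V] by blast
  then have "card ?V = p ^ j" by simp
  then have "?V \<subseteq> sylow_core p" using p_subgroup_subset_sylow_core[OF SV] by (auto simp: sylow_core_def)
  then show ?thesis using x by blast
qed

lemma core_normal:
  assumes "subgroup A G" shows "{x \<in> A. \<forall>g\<in>carrier G. cj g x \<in> A} \<lhd> G"
proof -
  have "cj h (cj g x) \<in> A" if "x \<in> A" "\<forall>g\<in>carrier G. cj g x \<in> A" "g \<in> carrier G" "h \<in> carrier G" for x g h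
    using that subgroup.mem_carrier[OF assms] by (simp add: cj_cj)
  then show ?thesis
    unfolding normal_cj_iff using subgroup_Collect_cj[OF assms order_refl] by auto
qed

text \<open>Let N be the core of \<open>A\<close>. If N lies in \<open>K\<close>, it is trivial, so
  \<open>A\<close> is core-free and its p-elements lie in O_p(G). Otherwise the commutators of N
  have all their conjugates in \<open>K\<close>, so N is abelian and its p-elements lie in O_p(G).
  Either way some p-element of \<open>A\<close> outside \<open>K\<close> lies in O_p(G), and since
  \<open>A\<close> covers \<open>K\<close>, the product of \<open>K\<close> with
  \<open>A \<inter> sylow_core p\<close> is all of \<open>A\<close>.\<close>

lemma core_free_cover_p_part:
  assumes cov: "Sp_covers K A"
    and core: "\<And>x. x \<in> K \<Longrightarrow> (\<And>g. g \<in> carrier G \<Longrightarrow> cj g x \<in> K) \<Longrightarrow> x = \<one>"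
    and comm: "\<And>x y. x \<in> A \<Longrightarrow> y \<in> A \<Longrightarrow> x \<otimes> y \<otimes> inv x \<otimes> inv y \<in> K"
  shows "\<exists>p i. Factorial_Ring.prime p \<and> K <#> (A \<inter> sylow_core p) = A \<and> K \<noteq> A \<and>
    card A = card K * p ^ i \<and> i \<noteq> 0"
proof -
  have S: "Sp K" "Sp A" and KA: "K \<subseteq> A" "K \<noteq> A" using cov by (auto simp: Sp_covers_def)
  have sg: "subgroup K G" "subgroup A G" using S by (auto intro: Sp_subgroup)
  interpret A: subgroup A G by (rule sg(2))
  define N where "N = {x \<in> A. \<forall>g\<in>carrier G. cj g x \<in> A}"
  have N: "N \<lhd> G" unfolding N_def by (rule core_normal[OF sg(2)])
  have Nsg: "subgroup N G" using N by (rule normal_imp_subgroup)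
  have NA: "N \<subseteq> A" by (auto simp: N_def)
  have "\<exists>p x. Factorial_Ring.prime p \<and> x \<in> A \<and> x \<in> sylow_core p \<and> x \<notin> K"
  proof (cases "N \<subseteq> K")
    case True
    obtain x p where xp: "x \<in> A" "Factorial_Ring.prime p" "p_element p x" "x \<notin> K"
      using subgroup_eq_if_prime_power_elements[OF sg KA(1)] KA(2) by blast
    have cfA: "u = \<one>" if u: "u \<in> A" "\<And>g. g \<in> carrier G \<Longrightarrow> cj g u \<in> A" for u
    proof (rule core)
      have "u \<in> N" using u by (auto simp: N_def)
      then show "u \<in> K" using True by blast
      show "cj g u \<in> K" if "g \<in> carrier G" for g
        using N \<open>u \<in> N\<close> that True unfolding normal_cj_iff by blast
    qed
    have "x \<in> sylow_core p"
      unfolding sylow_core_def using core_free_Sp_p_element[OF S(2) cfA xp(3,1)] by blast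
    then show ?thesis using xp by blast
  next
    case False
    have NK: "subgroup (N \<inter> K) G" using Nsg sg(1) by (rule subgroups_Inter_pair)
    obtain x p where xp: "x \<in> N" "Factorial_Ring.prime p" "p_element p x" "x \<notin> K"
      using subgroup_eq_if_prime_power_elements[OF NK Nsg] False by blast
    have "u \<otimes> v = v \<otimes> u" if uv: "u \<in> N" "v \<in> N" for u v
    proof -
      have C: "u \<in> carrier G" "v \<in> carrier G" using uv subgroup.mem_carrier[OF Nsg] by auto
      let ?c = "u \<otimes> v \<otimes> inv u \<otimes> inv v"
      have "?c = \<one>"
      proof (rule core)
        show "?c \<in> K" using comm uv NA by blast
        fix g assume g: "g \<in> carrier G"
        have "cj g u \<in> A" "cj g v \<in> A" using uv g by (auto simp: N_def)
        then have "cj g u \<otimes> cj g v \<otimes> inv (cj g u) \<otimes> inv (cj g v) \<in> K" by (rule comm)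
        then show "cj g ?c \<in> K" using C g by (simp add: cj_mult cj_inv)
      qed
      then have "?c \<otimes> (v \<otimes> u) = v \<otimes> u" using C by simp
      then show ?thesis using C by (simp add: m_assoc)
    qed
    then have "x \<in> sylow_core p" using normal_abelian_p_element[OF xp(2) N _ xp(1,3)] by blast
    then show ?thesis using xp NA by blast
  qed
  then obtain p x where px: "Factorial_Ring.prime p" "x \<in> A" "x \<in> sylow_core p" "x \<notin> K" by blast
  let ?P = "A \<inter> sylow_core p"
  have P: "Sp ?P" using Sp_Int[OF S(2) Sp_normal[OF sylow_core_normal[OF px(1)]]] .
  have Psg: "subgroup ?P G" using P by (rule Sp_subgroup)
  have KP: "K <#> ?P = ?P <#> K"
    using Sp_covers_cj[OF cov] by (intro set_mult_permute_cj[OF sg(1) Psg]) blast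
  have "Sp (K <#> ?P)" using Sp_set_mult[OF S(1) P KP] .
  moreover have up: "K \<subseteq> K <#> ?P" "?P \<subseteq> K <#> ?P"
    using subset_set_mult1[OF sg(1) Psg] subset_set_mult2[OF sg(1) Psg] .
  moreover have "K <#> ?P \<subseteq> A" using KA by (intro subgroup_set_mult_subset[OF sg(2)]) auto
  ultimately have eq: "K <#> ?P = A" using cov px unfolding Sp_covers_def by blast
  obtain w where w: "card A = card K * w" "w dvd card ?P"
    using subgroup_between_index[OF sg(1) Psg sg(2) _ KA(1)] eq sg(2) by auto
  obtain S where S: "sylow_subgroup p G S" using sylow_exists[OF px(1)] by blast
  have "card ?P dvd card S"
    using card_dvd[OF Psg sylow_subgrp[OF S]] sylow_core_subset[OF S] by blast
  then have "w dvd p ^ multiplicity p (order G)" using w(2) sylow_card[OF S] by (metis dvd_trans)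
  then obtain i where i: "w = p ^ i" using px(1) by (auto simp: divides_primepow_nat)
  have "i \<noteq> 0"
  proof
    assume "i = 0"
    then have "card A = card K" using w i by simp
    then show False using subgroup_eq_card[OF sg(2) KA(1)] KA(2) by simp
  qed
  then show ?thesis using px(1) eq KA(2) w(1) i by blast
qed

lemma section_rel_imp_isomorphic:
  assumes p: "Factorial_Ring.prime p" and r: "section_rel p K H L r"
    and sg: "subgroup K G" "subgroup H G" "subgroup L G"
    and KH: "K \<lhd> G\<lparr>carrier := H\<rparr>" and KL: "K \<lhd> G\<lparr>carrier := L\<rparr>"
  shows "operator_isomorphic_sections G (p_residual p G) H K L K"
proof -
  interpret KH: normal K "G\<lparr>carrier := H\<rparr>" by fact
  interpret KL: normal K "G\<lparr>carrier := L\<rparr>" by fact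
  have HC: "h \<in> carrier G" if "h \<in> H" for h using subgroup.mem_carrier[OF sg(2) that] .
  have LC: "l \<in> carrier G" if "l \<in> L" for l using subgroup.mem_carrier[OF sg(3) that] .
  have coset_eq: "K #> x = K #> y \<longleftrightarrow> x \<otimes> inv y \<in> K" if "x \<in> carrier G" "y \<in> carrier G" for x y
    using that sg(1) repr_independence[of x K y] repr_independenceD[OF sg(1), of x y]
      subgroup.rcos_module[OF sg(1) is_group that(2,1)] by blast
  have rC: "h \<in> H" "l \<in> L" "h \<in> carrier G" "l \<in> carrier G" if "r h l" for h l
    using section_rel_dom[OF r that] HC LC by auto
  have r_coset: "K #> h = K #> h' \<longleftrightarrow> K #> l = K #> l'" if "r h l" "r h' l'" for h l h' l'
    using section_rel_iff[OF r section_rel_mult[OF r that(1) section_rel_inv[OF r that(2)]]]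
      coset_eq rC[OF that(1)] rC[OF that(2)] by simp
  \<comment> \<open>A coset is sent to the coset of any partner of any of its elements;
    \<open>r_coset\<close> makes the choice immaterial.\<close>
  define \<phi> where "\<phi> = (\<lambda>U. K #> (SOME l. \<exists>h\<in>U. r h l))"
  have phi: "\<phi> (K #> h) = K #> l" if hl: "r h l" for h l
  proof -
    have "h \<in> K #> h" using rcos_self[OF _ sg(1)] rC[OF hl] by blast
    then have "\<exists>l. \<exists>h'\<in>K #> h. r h' l" using hl by blast
    then have "\<exists>h'\<in>K #> h. r h' (SOME l. \<exists>h'\<in>K #> h. r h' l)" by (rule someI_ex)
    then obtain h' where h': "h' \<in> K #> h" "r h' (SOME l. \<exists>h'\<in>K #> h. r h' l)" by blast
    have "K #> h = K #> h'" using repr_independence[OF h'(1) _ sg(1)] rC[OF hl] by blast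
    then show ?thesis unfolding \<phi>_def using r_coset[OF hl h'(2)] by simp
  qed
  have cosH: "carrier (G\<lparr>carrier := H\<rparr> Mod K) = (\<lambda>h. K #> h) ` H"
    and cosL: "carrier (G\<lparr>carrier := L\<rparr> Mod K) = (\<lambda>h. K #> h) ` L"
    by (simp_all add: carrier_FactGroup)
  have mulH: "(K #> h) <#> (K #> h') = K #> (h \<otimes> h')" if "h \<in> H" "h' \<in> H" for h h'
    using KH.rcos_sum[of h h'] that by simp
  have mulL: "(K #> h) <#> (K #> h') = K #> (h \<otimes> h')" if "h \<in> L" "h' \<in> L" for h h'
    using KL.rcos_sum[of h h'] that by simp
  have "\<phi> \<in> iso (G\<lparr>carrier := H\<rparr> Mod K) (G\<lparr>carrier := L\<rparr> Mod K)"
  proof (rule isoI)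
    show "\<phi> \<in> hom (G\<lparr>carrier := H\<rparr> Mod K) (G\<lparr>carrier := L\<rparr> Mod K)"
    proof (rule homI)
      fix U assume "U \<in> carrier (G\<lparr>carrier := H\<rparr> Mod K)"
      then obtain h where h: "h \<in> H" "U = K #> h" using cosH by blast
      obtain l where l: "r h l" using section_rel_ex1[OF r h(1)] by blast
      show "\<phi> U \<in> carrier (G\<lparr>carrier := L\<rparr> Mod K)" unfolding cosL h(2) phi[OF l] using rC[OF l] by blast
    next
      fix U U' assume "U \<in> carrier (G\<lparr>carrier := H\<rparr> Mod K)" "U' \<in> carrier (G\<lparr>carrier := H\<rparr> Mod K)"
      then obtain h h' where h: "h \<in> H" "U = K #> h" "h' \<in> H" "U' = K #> h'"
        unfolding cosH by (elim imageE)
      obtain l where l: "r h l" using section_rel_ex1[OF r h(1)] by blast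
      obtain l' where l': "r h' l'" using section_rel_ex1[OF r h(3)] by blast
      have "\<phi> (U <#> U') = K #> (l \<otimes> l')"
        unfolding h(2,4) mulH[OF h(1,3)] by (rule phi[OF section_rel_mult[OF r l l']])
      also have "\<dots> = \<phi> U <#> \<phi> U'"
        unfolding h(2,4) phi[OF l] phi[OF l'] using mulL rC[OF l] rC[OF l'] by simp
      finally show "\<phi> (U \<otimes>\<^bsub>G\<lparr>carrier := H\<rparr> Mod K\<^esub> U') = \<phi> U \<otimes>\<^bsub>G\<lparr>carrier := L\<rparr> Mod K\<^esub> \<phi> U'"
        by simp
    qed
    show "bij_betw \<phi> (carrier (G\<lparr>carrier := H\<rparr> Mod K)) (carrier (G\<lparr>carrier := L\<rparr> Mod K))"
      unfolding cosH cosL bij_betw_def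
    proof
      show "inj_on \<phi> ((\<lambda>h. K #> h) ` H)"
      proof (rule inj_onI)
        fix U U' assume "U \<in> (\<lambda>h. K #> h) ` H" "U' \<in> (\<lambda>h. K #> h) ` H" and eq: "\<phi> U = \<phi> U'"
        then obtain h h' where h: "h \<in> H" "U = K #> h" "h' \<in> H" "U' = K #> h'" by (elim imageE)
        obtain l where l: "r h l" using section_rel_ex1[OF r h(1)] by blast
        obtain l' where l': "r h' l'" using section_rel_ex1[OF r h(3)] by blast
        show "U = U'" using eq r_coset[OF l l'] unfolding h(2,4) phi[OF l] phi[OF l'] by simp
      qed
      show "\<phi> ` (\<lambda>h. K #> h) ` H = (\<lambda>h. K #> h) ` L"
      proof
        show "\<phi> ` (\<lambda>h. K #> h) ` H \<subseteq> (\<lambda>h. K #> h) ` L"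
        proof
          fix U assume "U \<in> \<phi> ` (\<lambda>h. K #> h) ` H"
          then obtain h where h: "h \<in> H" "U = \<phi> (K #> h)" by blast
          obtain l where l: "r h l" using section_rel_ex1[OF r h(1)] by blast
          show "U \<in> (\<lambda>h. K #> h) ` L" unfolding h(2) phi[OF l] using rC[OF l] by blast
        qed
        show "(\<lambda>h. K #> h) ` L \<subseteq> \<phi> ` (\<lambda>h. K #> h) ` H"
        proof
          fix U assume "U \<in> (\<lambda>h. K #> h) ` L"
          then obtain l where l: "l \<in> L" "U = K #> l" by blast
          obtain h where h: "r h l" using section_rel_ex2[OF r l(1)] by blast
          show "U \<in> \<phi> ` (\<lambda>h. K #> h) ` H" unfolding l(2) phi[OF h, symmetric] using rC[OF h] by blast
        qed
      qed
    qed
  qed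
  moreover have "\<phi> (K #> conjugate_by G h a) = K #> conjugate_by G l a"
    if a: "a \<in> p_residual p G" and h: "h \<in> H" and l: "l \<in> L" and eq: "\<phi> (K #> h) = K #> l" for a h l
  proof -
    obtain l0 where l0: "r h l0" using section_rel_ex1[OF r h] by blast
    have "K #> l = K #> l0" using eq phi[OF l0] by simp
    then have k: "l \<otimes> inv l0 \<in> K" using coset_eq LC[OF l] rC[OF l0] by simp
    \<comment> \<open>The given representative l need not be the partner l0 found above, but it
      differs from l0 by an element of \<open>K\<close>, and every element of \<open>K\<close> is
      related to the identity.\<close>
    have "r (\<one> \<otimes> h) (l \<otimes> inv l0 \<otimes> l0)"
      using section_rel_mult[OF r section_rel_ker[OF r subgroup.one_closed[OF sg(1)] k] l0] .
    then have rhl: "r h l" using HC[OF h] LC[OF l] rC[OF l0] by (simp add: m_assoc)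
    have aC: "a \<in> carrier G" using a p_residual_carrier[OF p] by blast
    have "inv a \<in> p_residual p G" using a p_residual_subgroup[OF p] by (simp add: subgroup.m_inv_closed)
    then have "r (cj (inv a) h) (cj (inv a) l)" using section_rel_cj[OF r _ rhl] by blast
    then show ?thesis using phi aC by (simp add: conj_by_def conjugate_by_def)
  qed
  ultimately show ?thesis unfolding operator_isomorphic_sections_def by blast
qed

lemma normal_in_subgroup_cj:
  assumes "subgroup K G" "subgroup H G" "K \<subseteq> H" "\<And>h k. h \<in> H \<Longrightarrow> k \<in> K \<Longrightarrow> cj h k \<in> K"
  shows "K \<lhd> G\<lparr>carrier := H\<rparr>"
proof -
  interpret H: group "G\<lparr>carrier := H\<rparr>" using assms(2) by (rule subgroup_imp_group)
  show ?thesis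
  proof (rule H.normal_invI)
    show "subgroup K (G\<lparr>carrier := H\<rparr>)" using assms(1-3) by (simp add: subgroup_incl)
    show "x \<otimes>\<^bsub>G\<lparr>carrier := H\<rparr>\<^esub> k \<otimes>\<^bsub>G\<lparr>carrier := H\<rparr>\<^esub> inv\<^bsub>G\<lparr>carrier := H\<rparr>\<^esub> x \<in> K"
      if "x \<in> carrier (G\<lparr>carrier := H\<rparr>)" "k \<in> K" for x k
      using assms(4)[of x k] that m_inv_consistent[OF assms(2)] by (simp add: conj_by_def)
  qed
qed

lemma core_free_diamond_False:
  assumes D: "covering_diamond K A B C"
    and core: "\<And>x. x \<in> K \<Longrightarrow> (\<And>g. g \<in> carrier G \<Longrightarrow> cj g x \<in> K) \<Longrightarrow> x = \<one>"
    and coincide: "\<And>p. Factorial_Ring.prime p \<Longrightarrow> isomorphic_sections_coincide p G"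
  shows False
proof -
  define M where "M = A <#> B"
  have cov: "Sp_covers K A" "Sp_covers K B" "Sp_covers K C"
    and covM: "Sp_covers A M" "Sp_covers B M" "Sp_covers C M"
    and Int: "A \<inter> B = K" "A \<inter> C = K" "B \<inter> C = K"
    and joins: "A <#> B = M" "A <#> C = M" "B <#> C = M"
    using D unfolding covering_diamond_def M_def by blast+
  have S: "Sp K" "Sp A" "Sp B" "Sp C" "Sp M"
    using Sp_coversD(1,2)[OF cov(1)] Sp_coversD(2)[OF cov(2)] Sp_coversD(2)[OF cov(3)] Sp_coversD(2)[OF covM(1)]
    by auto
  note sg = S[THEN Sp_subgroup]
  have le: "K \<subseteq> A" "K \<subseteq> B" "K \<subseteq> C" "A \<subseteq> M" "B \<subseteq> M" "C \<subseteq> M"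
    using cov covM by (simp_all add: Sp_covers_def)
  have Kcj: "cj t ` K = K" if t: "t \<in> M" for t
  proof -
    obtain a b where ab: "a \<in> A" "b \<in> B" "t = a \<otimes> b" using t unfolding joins(1)[symmetric] by (rule set_multE)
    have "cj a ` cj b ` K = K" using Sp_covers_cj[OF cov(1) ab(1)] Sp_covers_cj[OF cov(2) ab(2)] by simp
    then show ?thesis
      using cj_image_image[OF _ _ subgroup.subset[OF sg(1)]] subgroup.mem_carrier[OF sg(2) ab(1)]
        subgroup.mem_carrier[OF sg(3) ab(2)] ab(3) by simp
  qed
  note Acj = Sp_covers_cj[OF covM(1)] and Bcj = Sp_covers_cj[OF covM(2)] and Ccj = Sp_covers_cj[OF covM(3)]
  have commA: "x \<otimes> y \<otimes> inv x \<otimes> inv y \<in> K" if "x \<in> A" "y \<in> A" for x y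
    using diamond_commutator[OF sg(1,2,3,4,5) le(4,5,6) _ _ _ Kcj Acj Bcj Ccj that] Int joins le by simp
  have commB: "x \<otimes> y \<otimes> inv x \<otimes> inv y \<in> K" if "x \<in> B" "y \<in> B" for x y
    using diamond_commutator[OF sg(1,3,2,4,5) le(5,4,6) _ _ _ Kcj Bcj Acj Ccj that] Int joins le
    by (simp add: Int_commute)
  obtain p i where p: "Factorial_Ring.prime p" "K <#> (A \<inter> sylow_core p) = A" "K \<noteq> A" "card A = card K * p ^ i" "i \<noteq> 0"
    using core_free_cover_p_part[OF cov(1) core commA] by blast
  obtain q j where q: "Factorial_Ring.prime q" "K <#> (B \<inter> sylow_core q) = B" "card B = card K * q ^ j"
    using core_free_cover_p_part[OF cov(2) core commB] by blast
  \<comment> \<open>Both products with C equal M and both intersections equal K, so A and B have the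
    same order; comparing prime powers then identifies the two primes.\<close>
  have "card A * card C = card B * card C"
    using card_set_mult[OF sg(2,4)] card_set_mult[OF sg(3,4)] joins Int by simp
  then have "card A = card B" using card_subgroup_pos[OF sg(4)] by simp
  then have pq: "p ^ i = q ^ j" using p(4) q(3) card_subgroup_pos[OF sg(1)] by simp
  have "q = p"
  proof (rule ccontr)
    assume "q \<noteq> p"
    then have "p ^ i = 1" using coprime_prime_powers[OF p(1) q(1), of "p ^ i" i j] pq by simp
    then show False using p(1,5) prime_gt_1_nat[OF p(1)] by simp
  qed
  let ?O = "sylow_core p"
  have O: "?O \<lhd> G" using sylow_core_normal[OF p(1)] .
  have Osg: "subgroup ?O G" using O by (rule normal_imp_subgroup)
  have Ocj: "cj g x \<in> ?O" if "g \<in> carrier G" "x \<in> ?O" for g x using O that by (simp add: normal_cj_iff)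
  \<comment> \<open>A and K need not be p-groups, so A/K is not yet a section of the required kind;
    its trace on O_p(G) is, and A = A'K shows that nothing is lost.\<close>
  define A' B' C' K' where defs: "A' = A \<inter> ?O" "B' = B \<inter> ?O" "C' = C \<inter> ?O" "K' = K \<inter> ?O"
  have S': "Sp A'" "Sp B'" "Sp C'" "Sp K'"
    unfolding defs by (intro Sp_Int S Sp_normal O)+
  have in_p: "A' \<in> S_permutable_p_subgroups p G" "B' \<in> S_permutable_p_subgroups p G"
      "C' \<in> S_permutable_p_subgroups p G" "K' \<in> S_permutable_p_subgroups p G"
    using S' by (auto intro!: Sp_subset_sylow_core[OF p(1)] simp: defs)
  note sg' = S'[THEN Sp_subgroup]
  have le': "K' \<subseteq> A'" "K' \<subseteq> B'" "K' \<subseteq> C'" using le by (auto simp: defs)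
  have in_M: "A' \<subseteq> M" "B' \<subseteq> M" "C' \<subseteq> M" using le by (auto simp: defs)
  have MG: "M \<subseteq> carrier G" using sg(5) by (rule subgroup.subset)
  have A_eq: "A = A' <#> K"
    using p(2) subgroup_set_mult_iff[OF sg(1) sg'(1)] sg(2) by (simp add: defs)
  have B_eq: "B = B' <#> K"
    using q(2) subgroup_set_mult_iff[OF sg(1) sg'(2)] sg(3) by (simp add: defs \<open>q = p\<close>)
  have C'cj: "cj t x \<in> C'" if "t \<in> M" "x \<in> C'" for t x
    using that Ccj[OF that(1)] Ocj MG by (auto simp: defs)
  have K'cj: "cj t x \<in> K'" if "t \<in> M" "x \<in> K'" for t x
    using that Kcj[OF that(1)] Ocj MG by (auto simp: defs)
  \<comment> \<open>C complements both A/K and B/K in M/K, so each element of A' has a partner in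
    B', unique modulo K'.\<close>
  define r where "r = (\<lambda>a b. a \<in> A' \<and> b \<in> B' \<and> inv a \<otimes> b \<in> C')"
  have car: "a \<in> carrier G" "b \<in> carrier G" if "a \<in> A'" "b \<in> B'" for a b
    using that in_M MG by auto
  have rel: "section_rel p K' A' B' r"
    unfolding section_rel_def
  proof (intro conjI)
    show "\<forall>h l. r h l \<longrightarrow> h \<in> A' \<and> l \<in> B'" by (simp add: r_def)
    show "\<forall>h\<in>A'. \<exists>l. r h l"
    proof
      fix a assume a: "a \<in> A'"
      then have "a \<in> B <#> C" using in_M joins by blast
      then obtain b c where bc: "b \<in> B" "c \<in> C" "a = b \<otimes> c" by (rule set_multE)
      \<comment> \<open>The K-part of b is shifted into C, which contains K. The element of C that
        remains is a product of elements of O_p(G), hence lies in C'.\<close>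
      have "b \<in> B' <#> K" using bc(1) B_eq by simp
      then obtain b1 k where b1: "b1 \<in> B'" "k \<in> K" "b = b1 \<otimes> k" by (rule set_multE)
      have G: "a \<in> carrier G" "b1 \<in> carrier G" "k \<in> carrier G" "c \<in> carrier G"
        using car[OF a b1(1)] subgroup.mem_carrier[OF sg(1) b1(2)] subgroup.mem_carrier[OF sg(4) bc(2)] by auto
      have "inv a \<otimes> b1 = inv (k \<otimes> c)" using G bc(3) b1(3) by (simp add: m_assoc inv_mult_group)
      moreover have "inv (k \<otimes> c) \<in> C"
        using b1(2) bc(2) le(3) by (intro subgroup.m_inv_closed[OF sg(4)] subgroup.m_closed[OF sg(4)]) auto
      moreover have "inv a \<otimes> b1 \<in> ?O"
        using a b1(1) by (intro subgroup.m_closed[OF Osg] subgroup.m_inv_closed[OF Osg]) (auto simp: defs)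
      ultimately have "r a b1" using a b1(1) by (simp add: r_def defs)
      then show "\<exists>l. r a l" by blast
    qed
    show "\<forall>l\<in>B'. \<exists>h. r h l"
    proof
      fix b assume b: "b \<in> B'"
      then have "b \<in> A <#> C" using in_M joins by blast
      then obtain a c where ac: "a \<in> A" "c \<in> C" "b = a \<otimes> c" by (rule set_multE)
      have "a \<in> A' <#> K" using ac(1) A_eq by simp
      then obtain a1 k where a1: "a1 \<in> A'" "k \<in> K" "a = a1 \<otimes> k" by (rule set_multE)
      have G: "b \<in> carrier G" "a1 \<in> carrier G" "k \<in> carrier G" "c \<in> carrier G"
        using car[OF a1(1) b] subgroup.mem_carrier[OF sg(1) a1(2)] subgroup.mem_carrier[OF sg(4) ac(2)] by auto
      have "inv a1 \<otimes> b = k \<otimes> c" using G ac(3) a1(3) by (simp add: m_assoc)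
      moreover have "k \<otimes> c \<in> C" using a1(2) ac(2) le(3) by (intro subgroup.m_closed[OF sg(4)]) auto
      moreover have "inv a1 \<otimes> b \<in> ?O"
        using b a1(1) by (intro subgroup.m_closed[OF Osg] subgroup.m_inv_closed[OF Osg]) (auto simp: defs)
      ultimately have "r a1 b" using b a1(1) by (simp add: r_def defs)
      then show "\<exists>h. r h b" by blast
    qed
    show "\<forall>h l h' l'. r h l \<longrightarrow> r h' l' \<longrightarrow> r (h \<otimes> h') (l \<otimes> l')"
    proof (intro allI impI)
      fix h l h' l' assume "r h l" "r h' l'"
      then have hl: "h \<in> A'" "l \<in> B'" "inv h \<otimes> l \<in> C'" "h' \<in> A'" "l' \<in> B'" "inv h' \<otimes> l' \<in> C'"
        by (auto simp: r_def)
      note G = car[OF hl(1,2)] car[OF hl(4,5)]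
      have "inv h' \<in> M" using subgroup.m_inv_closed[OF sg(5)] hl(4) in_M by blast
      then have "cj (inv h') (inv h \<otimes> l) \<in> C'" using hl(3) by (rule C'cj)
      then have "cj (inv h') (inv h \<otimes> l) \<otimes> (inv h' \<otimes> l') \<in> C'" using hl(6) by (rule subgroup.m_closed[OF sg'(3)])
      moreover have "cj (inv h') (inv h \<otimes> l) \<otimes> (inv h' \<otimes> l') = inv (h \<otimes> h') \<otimes> (l \<otimes> l')"
        using G by (simp add: conj_by_def m_assoc inv_mult_group)
      ultimately show "r (h \<otimes> h') (l \<otimes> l')"
        using hl sg' by (simp add: r_def subgroup.m_closed)
    qed
    show "\<forall>h l. r h l \<longrightarrow> r (inv h) (inv l)"
    proof (intro allI impI)
      fix h l assume "r h l"
      then have hl: "h \<in> A'" "l \<in> B'" "inv h \<otimes> l \<in> C'" by (auto simp: r_def)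
      note G = car[OF hl(1,2)]
      have "cj h (inv (inv h \<otimes> l)) \<in> C'"
        using hl in_M by (intro C'cj subgroup.m_inv_closed[OF sg'(3)]) auto
      moreover have "cj h (inv (inv h \<otimes> l)) = inv (inv h) \<otimes> inv l"
        using G by (simp add: conj_by_def m_assoc inv_mult_group)
      ultimately show "r (inv h) (inv l)"
        using hl sg' by (simp add: r_def subgroup.m_inv_closed)
    qed
    show "\<forall>k\<in>K'. \<forall>k'\<in>K'. r k k'"
    proof (intro ballI)
      fix k k' assume k: "k \<in> K'" "k' \<in> K'"
      have "inv k \<otimes> k' \<in> K'" using k by (intro subgroup.m_closed[OF sg'(4)] subgroup.m_inv_closed[OF sg'(4)])
      then show "r k k'" using k le' by (auto simp: r_def)
    qed
    show "\<forall>h l. r h l \<longrightarrow> (h \<in> K') = (l \<in> K')"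
    proof (intro allI impI)
      fix h l assume "r h l"
      then have hl: "h \<in> A'" "l \<in> B'" "inv h \<otimes> l \<in> C'" by (auto simp: r_def)
      note G = car[OF hl(1,2)]
      show "(h \<in> K') = (l \<in> K')"
      proof
        assume "h \<in> K'"
        then have "h \<otimes> (inv h \<otimes> l) \<in> C'"
          using subgroup.m_closed[OF sg'(3) subsetD[OF le'(3)] hl(3)] by blast
        then have "l \<in> C'" using G by simp
        then show "l \<in> K'" using hl(2) Int by (auto simp: defs)
      next
        assume "l \<in> K'"
        then have "l \<otimes> inv (inv h \<otimes> l) \<in> C'"
          using subgroup.m_closed[OF sg'(3) subsetD[OF le'(3)] subgroup.m_inv_closed[OF sg'(3) hl(3)]] by blast
        then have "h \<in> C'" using G by (simp add: inv_mult_group)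
        then show "h \<in> K'" using hl(1) Int by (auto simp: defs)
      qed
    qed
    show "\<forall>g\<in>p_residual p G. \<forall>h l. r h l \<longrightarrow> r (cj g h) (cj g l)"
    proof (intro ballI allI impI)
      fix g h l assume g: "g \<in> p_residual p G" and "r h l"
      then have hl: "h \<in> A'" "l \<in> B'" "inv h \<otimes> l \<in> C'" by (auto simp: r_def)
      note G = car[OF hl(1,2)]
      have gG: "g \<in> carrier G" using g p_residual_carrier[OF p(1)] by blast
      have "cj g (inv h \<otimes> l) \<in> C'" using cj_residual_closed[OF p(1) in_p(3) g hl(3)] .
      then have "inv (cj g h) \<otimes> cj g l \<in> C'" using G gG by (simp add: cj_mult cj_inv)
      then show "r (cj g h) (cj g l)"
        using cj_residual_closed[OF p(1) in_p(1) g hl(1)] cj_residual_closed[OF p(1) in_p(2) g hl(2)]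
        by (simp add: r_def)
    qed
  qed
  have norm: "K' \<lhd> G\<lparr>carrier := A'\<rparr>" "K' \<lhd> G\<lparr>carrier := B'\<rparr>"
    using K'cj in_M by (auto intro!: normal_in_subgroup_cj sg' le')
  have "operator_isomorphic_sections G (p_residual p G) A' K' B' K'"
    by (rule section_rel_imp_isomorphic[OF p(1) rel sg'(4,1,2) norm])
  then have "A' = B'"
    using coincide[OF p(1)] in_p norm unfolding isomorphic_sections_coincide_def by blast
  \<comment> \<open>Coincidence leaves A' inside \<open>A \<inter> B\<close>, which is K; then KA' =
    A collapses to K.\<close>
  then have "A' \<subseteq> K" using Int(1) by (auto simp: defs)
  then have "K <#> A' = K" using set_mult_absorb_right[OF sg(1) sg'(1)] by simp
  then show False using p(2,3) by (simp add: defs)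
qed

end

section \<open>Transport of covering diamonds to factor groups\<close>

context finite_epimorphism
begin

lemma preimage_image:
  assumes S: "subgroup S G" and ker: "kernel G H h \<subseteq> S"
  shows "preimage (h ` S) = S"
proof
  interpret S: subgroup S G by fact
  show "S \<subseteq> preimage (h ` S)" by (auto simp: preimage_def)
  show "preimage (h ` S) \<subseteq> S"
  proof
    fix x assume "x \<in> preimage (h ` S)"
    then obtain s where s: "x \<in> carrier G" "s \<in> S" "h x = h s" by (auto simp: preimage_def)
    then have "inv s \<otimes> x \<in> kernel G H h" by (simp add: kernel_def)
    then have "s \<otimes> (inv s \<otimes> x) \<in> S" using S.m_closed[OF s(2) subsetD[OF ker]] by blast
    then show "x \<in> S" using s by simp
  qed
qed

text \<open>Members between the two images pull back to members between \<open>K\<close> and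
  \<open>A\<close>, and image and preimage are inverse to each other there because \<open>K\<close>
  contains the kernel.\<close>

lemma Sp_covers_image:
  assumes cov: "fG.Sp_covers K A" and ker: "kernel G H h \<subseteq> K"
  shows "fH.Sp_covers (h ` K) (h ` A)"
proof -
  note c = fG.Sp_coversD[OF cov]
  have pre: "preimage (h ` K) = K" "preimage (h ` A) = A"
    using preimage_image[OF fG.Sp_subgroup[OF c(1)] ker]
      preimage_image[OF fG.Sp_subgroup[OF c(2)] subset_trans[OF ker c(3)]] by auto
  have "h ` K \<noteq> h ` A" using pre c(4) by metis
  moreover have "Z = h ` K \<or> Z = h ` A" if Z: "S_permutable H Z" "h ` K \<subseteq> Z" "Z \<subseteq> h ` A" for Z
  proof -
    have im: "h ` preimage Z = Z" using fH.Sp_subgroup[OF Z(1)] by (simp add: image_preimage subgroup.subset)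
    have "K \<subseteq> preimage Z" using Z(2) pre(1) unfolding preimage_def by blast
    moreover have "preimage Z \<subseteq> A" using Z(3) pre(2) unfolding preimage_def by blast
    ultimately have "preimage Z = K \<or> preimage Z = A" using c(5)[OF Sp_preimage[OF Z(1)]] by blast
    then show ?thesis using im by metis
  qed
  moreover have "h ` K \<subseteq> h ` A" using c(3) by (rule image_mono)
  ultimately show ?thesis using Sp_image[OF c(1)] Sp_image[OF c(2)] unfolding fH.Sp_covers_def by blast
qed

lemma covering_diamond_image:
  assumes D: "fG.covering_diamond K A B C" and ker: "kernel G H h \<subseteq> K"
  shows "fH.covering_diamond (h ` K) (h ` A) (h ` B) (h ` C)"
proof -
  have cov: "fG.Sp_covers K A" "fG.Sp_covers K B" "fG.Sp_covers K C"
    and covM: "fG.Sp_covers A (A <#> B)" "fG.Sp_covers B (A <#> B)" "fG.Sp_covers C (A <#> B)"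
    and Int: "A \<inter> B = K" "A \<inter> C = K" "B \<inter> C = K"
    and joins: "A <#> B = B <#> A" "A <#> C = A <#> B" "B <#> C = A <#> B" "C <#> A = A <#> B" "C <#> B = A <#> B"
    using D unfolding fG.covering_diamond_def by blast+
  have le: "K \<subseteq> A" "K \<subseteq> B" "K \<subseteq> C" using cov[THEN fG.Sp_coversD(3)] .
  have sg: "subgroup A G" "subgroup B G" "subgroup C G" using cov[THEN fG.Sp_coversD(2), THEN fG.Sp_subgroup] .
  note sub = sg[THEN subgroup.subset]
  note mult = set_mult_hom[OF homh, symmetric]
  \<comment> \<open>Images respect these intersections because V contains the kernel and so is the
    full preimage of its image.\<close>
  have image_Int: "h ` U \<inter> h ` V = h ` (U \<inter> V)" if "subgroup U G" "subgroup V G" "K \<subseteq> V" for U V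
  proof
    show "h ` U \<inter> h ` V \<subseteq> h ` (U \<inter> V)"
    proof
      fix y assume "y \<in> h ` U \<inter> h ` V"
      then obtain u where u: "u \<in> U" "y = h u" "h u \<in> h ` V" by blast
      then have "u \<in> preimage (h ` V)" using subgroup.mem_carrier[OF that(1)] by (simp add: preimage_def)
      then have "u \<in> V" using preimage_image[OF that(2) subset_trans[OF ker that(3)]] by simp
      then show "y \<in> h ` (U \<inter> V)" using u by blast
    qed
  qed blast
  have coverM: "fH.Sp_covers (h ` U) (h ` (A <#> B))" if "fG.Sp_covers U (A <#> B)" "K \<subseteq> U" for U
    using Sp_covers_image[OF that(1) subset_trans[OF ker that(2)]] .
  show ?thesis
    unfolding fH.covering_diamond_def
    using Sp_covers_image[OF cov(1) ker] Sp_covers_image[OF cov(2) ker] Sp_covers_image[OF cov(3) ker]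
      coverM[OF covM(1) le(1)] coverM[OF covM(2) le(2)] coverM[OF covM(3) le(3)]
      image_Int[OF sg(1,2) le(2)] image_Int[OF sg(1,3) le(3)] image_Int[OF sg(2,3) le(3)]
    unfolding mult[OF sub(1,2)] mult[OF sub(2,1)] mult[OF sub(1,3)] mult[OF sub(3,1)] mult[OF sub(2,3)] mult[OF sub(3,2)]
      Int joins(2-5) joins(1)[symmetric]
    by blast
qed

end

context finite_group
begin

theorem conditions_imp_Sp_distributive:
  assumes perm: "\<And>A B. Sp A \<Longrightarrow> Sp B \<Longrightarrow> A <#> B = B <#> A"
    and coincide: "\<And>R p. R \<lhd> G \<Longrightarrow> Factorial_Ring.prime p \<Longrightarrow> isomorphic_sections_coincide p (G Mod R)"
  shows Sp_distributive
proof (rule ccontr)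
  assume "\<not> Sp_distributive"
  from covering_diamond_exists[OF perm this]
  obtain K A B C where D: "covering_diamond K A B C" by blast
  have Ksg: "subgroup K G"
    using D Sp_coversD(1) Sp_subgroup unfolding covering_diamond_def by blast
  define R where "R = {x \<in> K. \<forall>g\<in>carrier G. cj g x \<in> K}"
  have R: "R \<lhd> G" unfolding R_def by (rule core_normal[OF Ksg])
  have RK: "R \<subseteq> K" by (auto simp: R_def)
  have Rsg: "subgroup R G" using R by (rule normal_imp_subgroup)
  interpret e: finite_epimorphism G "G Mod R" "\<lambda>x. R #> x" by (rule finite_epimorphism_FactGroup[OF R])
  have ker: "kernel G (G Mod R) (\<lambda>x. R #> x) \<subseteq> K"
    using coset_join1[OF _ _ Rsg] RK by (auto simp: kernel_def)
  have pre: "e.preimage ((\<lambda>x. R #> x) ` K) = K" by (rule e.preimage_image[OF Ksg ker])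
  show False
  proof (rule e.fH.core_free_diamond_False[OF e.covering_diamond_image[OF D ker]])
    show "isomorphic_sections_coincide p (G Mod R)" if "Factorial_Ring.prime p" for p
      using coincide[OF R that] .
    fix y assume y: "y \<in> (\<lambda>x. R #> x) ` K"
      and cy: "\<And>g. g \<in> carrier (G Mod R) \<Longrightarrow> conj_by (G Mod R) g y \<in> (\<lambda>x. R #> x) ` K"
    from y obtain x where x: "x \<in> K" "y = R #> x" by blast
    have xG: "x \<in> carrier G" using subgroup.mem_carrier[OF Ksg x(1)] .
    \<comment> \<open>An element of the core of K/R lifts into the core of K, which is R, because K
      is the full preimage of its image.\<close>
    have "cj g x \<in> K" if g: "g \<in> carrier G" for g
    proof -
      have "R #> g \<in> carrier (G Mod R)" using g by (rule e.hom_closed)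
      then have "R #> cj g x \<in> (\<lambda>x. R #> x) ` K" using cy e.h_cj[OF g xG] x(2) by simp
      then have "cj g x \<in> e.preimage ((\<lambda>x. R #> x) ` K)" using g xG by (simp add: e.preimage_def)
      then show ?thesis using pre by simp
    qed
    then have "x \<in> R" using x(1) by (simp add: R_def)
    then show "y = \<one>\<^bsub>G Mod R\<^esub>" using x(2) xG Rsg by (simp add: coset_join2)
  qed
qed

end

theorem corollary1p4:
  fixes G :: "('a, 'b) monoid_scheme" and D :: "'a set"
  assumes "group G" and "finite (carrier G)"
    and "D = nilpotent_residual G"
  shows "distributive_lattice (S_permutable_lattice G) \<longleftrightarrow>
     ((\<forall>A \<in> carrier (S_permutable_lattice G). \<forall>B \<in> carrier (S_permutable_lattice G).
          permutable_sets G A B)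
      \<and> distributive_lattice (normal_lattice G)
      \<and> cyclic_group (G Mod D)
      \<and> meet_distributive (S_permutable_lattice G) D)
     \<and> (\<forall>R. R \<lhd> G \<longrightarrow> (\<forall>p. Factorial_Ring.prime p \<longrightarrow> isomorphic_sections_coincide p (G Mod R)))"
proof -
  interpret finite_group G using assms(1,2) by (simp add: finite_group_def finite_group_axioms_def)
  have perm: "A <#>\<^bsub>G\<^esub> B = B <#>\<^bsub>G\<^esub> A"
    if "\<forall>A \<in> carrier (S_permutable_lattice G). \<forall>B \<in> carrier (S_permutable_lattice G). permutable_sets G A B"
      "S_permutable G A" "S_permutable G B" for A B
    using that by (simp add: S_permutable_lattice_def permutable_sets_def)
  show ?thesis
    unfolding distributive_lattice_Sp_iff_Sp_distributive assms(3)
    using Sp_distributive_imp_conditions conditions_imp_Sp_distributive perm by blast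
qed

end
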